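(* Let $f$ be a transcendental entire function for which there exist constants $a>0$, $b>1$ and $r_0>0$ such that for every $r\geq r_0$ there exists $\rho\in(r,br)$ with $m(\rho,f)\leq a$. Let $n\geq 2$ be an integer. Then there exist a constant $c>0$, a sequence $(\xi_k)$ of periodic points of $f$ of period $n$ with $|\xi_k|\to\infty$ as $k\to\infty$, and a sequence of real numbers $(\delta_k)$ with $\delta_k\to 0$ as $k\to\infty$, such that for all $k$ $$|(f^n)'(\xi_k)| > c\,\log M\big((1-\delta_k)|\xi_k|,\, f^n\big).$$
   Context: For an entire function $h$ and $r>0$, $M(r,h)=\max_{|z|=r}|h(z)|$ is the maximum modulus and $m(r,h)=\min_{|z|=r}|h(z)|$ is the minimum modulus. The iterates of $f$ are $f^0(z)=z$ and $f^n(z)=f(f^{n-1}(z))$ for $n\geq 1$. A point $\xi\in\mathbb{C}$ is a periodic point of $f$ if $f^n(\xi)=\xi$ for some $n\geq 1$; the smallest such $n$ is its period. A transcendental entire function is an entire function that is not a polynomial. *)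

theory Defs
  imports "HOL-Complex_Analysis.Complex_Analysis"
    "HOL-Computational_Algebra.Polynomial"
begin

definition transcendental_entire :: "(complex \<Rightarrow> complex) \<Rightarrow> bool" where
  "transcendental_entire f \<longleftrightarrow> f holomorphic_on UNIV \<and> \<not> (\<exists>p :: complex poly. f = poly p)"

(* For continuous h and r > 0 the supremum and the infimum below are attained, since
   the circle is compact, so they are the maximum and the minimum modulus. For r < 0
   the circle is empty and the values are meaningless. *)

definition max_modulus :: "real \<Rightarrow> (complex \<Rightarrow> complex) \<Rightarrow> real" where
  "max_modulus r h = (SUP z\<in>sphere 0 r. norm (h z))"

definition min_modulus :: "real \<Rightarrow> (complex \<Rightarrow> complex) \<Rightarrow> real" where
  "min_modulus r h = (INF z\<in>sphere 0 r. norm (h z))"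

definition periodic_point :: "(complex \<Rightarrow> complex) \<Rightarrow> complex \<Rightarrow> bool" where
  "periodic_point f \<xi> \<longleftrightarrow> (\<exists>n\<ge>1. (f ^^ n) \<xi> = \<xi>)"

(* Meaningful only for periodic points. *)
definition period :: "(complex \<Rightarrow> complex) \<Rightarrow> complex \<Rightarrow> nat" where
  "period f \<xi> = (LEAST n. n \<ge> 1 \<and> (f ^^ n) \<xi> = \<xi>)"

end

theory Submission
  imports Defs
begin

text \<open>
  Let \<open>m = n - 1\<close>. Near a suitable point \<open>\<zeta>\<close> of maximum modulus one has
  \<open>f (\<zeta> * exp (\<tau> / N)) \<approx> f \<zeta> * exp \<tau>\<close> with \<open>N\<close> large (a weak form of Wiman-Valiron theory), so the
  \<open>m\<close>-th iterate has inverse branches over an annulus of radius comparable to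
  \<open>R \<ge> M(norm \<zeta>, f ^^ m)\<close>. In the coordinate \<open>N * (z / \<zeta> - 1)\<close> their values are nearly
  \<open>\<mu> + 2 * pi * \<i> * j\<close> for all integers \<open>j\<close> in a long range. In this annulus some circle of radius
  \<open>\<rho>\<close> carries both a point where \<open>norm f \<le> a\<close> and one where \<open>norm f = M(\<rho>, f)\<close>. Hence
  \<open>h z = N * (f (\<rho> * z) / \<zeta> - 1)\<close> takes a value of modulus 1 with a derivative of order
  \<open>ln (M(\<rho>, f))\<close>, by the Hopf lemma applied to \<open>ln (norm h)\<close>, and Zalcman's rescaling of \<open>h\<close> converges
  to a nonconstant entire function \<open>G\<close>.

  Such a \<open>G\<close> may omit a given value or be ramified over it, but not over all points
  \<open>\<mu> + 2 * pi * \<i> * j\<close>: a zero-free entire function (here \<open>exp (G - \<mu>)\<close>) has a simple 1-point,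
  since a second rescaling reduces to the case of an exponential. So \<open>f\<close> maps a small disc in the annulus
  univalently over the image of an inverse branch of the iterate, and Brouwer's theorem yields a periodic
  point. The factors \<open>N\<close> and \<open>1 / N\<close> in the two derivatives cancel, leaving a multiplier of order
  \<open>ln (M(\<rho>, f))\<close>.
\<close>

section \<open>Harnack and Hopf estimates\<close>

text \<open>The quantity to control is \<open>N\<close>. Where \<open>norm f \<le> a\<close>, the
  function \<open>h\<close> can be as large as \<open>2 * N\<close>, so \<open>ln (norm h)\<close>
  has a useful drop along the circle only if \<open>ln N\<close> is negligible against
  \<open>ln (M(\<rho>, f))\<close>. Hence the barrier \<open>la / (s2 - s)\<close>: its slope is at
  most the square of its value, and at \<open>\<zeta>\<close> its value is bounded by a multiple of
  \<open>ln (norm (f \<zeta>))\<close>. A second obstacle is the order of choices. \<open>G\<close>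
  exists only after a limit over \<open>k\<close>, and the \<open>j\<close> whose point it takes
  simply is not known in advance. Stage \<open>k\<close> therefore provides branches for all
  \<open>\<bar>j\<bar> \<le> k\<close>, with errors below \<open>1 / (k + 1)\<close>. The period is
  exactly \<open>n\<close> because \<open>norm \<xi> \<le> 4 * norm \<zeta>\<close>, while the
  iterates of \<open>\<xi>\<close> up to the \<open>m\<close>-th lie outside that disc. Since
  \<open>\<xi> / \<zeta>\<close> tends to 1, \<open>\<delta>\<close> can be defined by
  \<open>(1 - \<delta>) * norm \<xi> = norm \<zeta>\<close>. On this circle \<open>f ^^ n\<close> is
  bounded by \<open>M(\<rho>, f)\<close>, as \<open>f ^^ m\<close> maps it into the disc of radius
  \<open>\<rho>\<close>.\<close>

lemma positive_real_part_Schwarz: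
  assumes F: "F holomorphic_on ball x d" and d: "d > 0"
    and pos: "\<And>z. z \<in> ball x d \<Longrightarrow> Re (F z) > 0"
  shows "\<And>z. z \<in> ball x d \<Longrightarrow> norm (F z - F x) * d \<le> norm (F z + cnj (F x)) * norm (z - x)"
    and "norm (deriv F x) * d \<le> 2 * Re (F x)"
proof -
  define c where "c = F x"
  have cpos: "Re c > 0"
    using pos[of x] d by (simp add: c_def)
  \<comment> \<open>A Cayley transform takes the right half-plane to the unit disc and
    \<open>c\<close> to 0, so that Schwarz's lemma applies.\<close>
  define \<phi> where "\<phi> = (\<lambda>w::complex. (F (x + d * w) - c) / (F (x + d * w) + cnj c))"
  have mem: "x + complex_of_real d * w \<in> ball x d" if "norm w < 1" for w
    using that d by (simp add: dist_norm norm_mult)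
  have nz: "F (x + complex_of_real d * w) + cnj c \<noteq> 0" if "norm w < 1" for w
  proof -
    have "Re (F (x + complex_of_real d * w) + cnj c) > 0"
      using pos[OF mem[OF that]] cpos by simp
    then show ?thesis by (auto simp del: plus_complex.sel)
  qed
  have Fh: "(\<lambda>w. F (x + d * w)) holomorphic_on ball 0 1"
    using mem by (intro holomorphic_on_compose_gen[OF _ F, unfolded o_def] holomorphic_intros) auto
  have hol: "\<phi> holomorphic_on ball 0 1"
    unfolding \<phi>_def using nz by (intro holomorphic_intros Fh) auto
  have \<phi>0: "\<phi> 0 = 0" by (simp add: \<phi>_def c_def)
  have lt: "norm (\<phi> w) < 1" if "norm w < 1" for w
  proof -
    define v where "v = F (x + d * w)"
    have v: "Re v > 0" using pos[OF mem[OF that]] by (simp add: v_def)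
    have "(norm (v + cnj c))\<^sup>2 - (norm (v - c))\<^sup>2 = 4 * Re v * Re c"
      unfolding cmod_power2 by (simp add: power2_eq_square algebra_simps)
    moreover have "4 * Re v * Re c > 0" using v cpos by simp
    ultimately have "(norm (v - c))\<^sup>2 < (norm (v + cnj c))\<^sup>2" by linarith
    then have "norm (v - c) < norm (v + cnj c)" by (rule power2_less_imp_less) simp
    moreover have "norm (v + cnj c) > 0" using calculation norm_ge_zero[of "v - c"] by linarith
    ultimately show ?thesis unfolding \<phi>_def v_def[symmetric] by (simp add: norm_divide)
  qed
  show "norm (F z - F x) * d \<le> norm (F z + cnj (F x)) * norm (z - x)" if z: "z \<in> ball x d" for z
  proof -
    define w where "w = (z - x) / d"
    have w: "norm w < 1" using z d by (simp add: w_def norm_divide dist_norm norm_minus_commute)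
    have zw: "x + d * w = z" using d by (simp add: w_def)
    have "norm (\<phi> w) \<le> norm w"
      by (rule Schwarz_Lemma(1)[OF hol \<phi>0 lt w])
    then have "norm (F z - c) / norm (F z + cnj c) \<le> norm (z - x) / d"
      unfolding \<phi>_def zw using d by (simp add: w_def norm_divide)
    moreover have "norm (F z + cnj c) > 0" using nz[OF w] zw by simp
    ultimately show ?thesis using d unfolding c_def by (simp add: field_simps)
  qed
  show "norm (deriv F x) * d \<le> 2 * Re (F x)"
  proof -
    have Fx: "(F has_field_derivative deriv F x) (at x)"
      using F d by (intro holomorphic_derivI[OF F]) auto
    have "((\<lambda>w. F (x + d * w)) has_field_derivative deriv F x * d) (at 0)"
      by (rule DERIV_chain2[where f = F]) (auto intro!: derivative_eq_intros simp: Fx)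
    moreover have "F (x + complex_of_real d * 0) + cnj c \<noteq> 0" using nz[of 0] by simp
    ultimately have D: "(\<phi> has_field_derivative (deriv F x * d * (F (x + d * 0) + cnj c)
          - (F (x + d * 0) - c) * (deriv F x * d)) / ((F (x + d * 0) + cnj c) * (F (x + d * 0) + cnj c))) (at 0)"
      unfolding \<phi>_def by (auto intro!: derivative_eq_intros)
    have cc: "c + cnj c = of_real (2 * Re c)" by (simp add: complex_add_cnj)
    have "deriv \<phi> 0 = deriv F x * d / of_real (2 * Re c)"
      using DERIV_imp_deriv[OF D] cpos cc by (simp add: c_def[symmetric] field_simps)
    moreover have "norm (deriv \<phi> 0) \<le> 1"
      by (rule Schwarz_Lemma(2)[OF hol \<phi>0 lt, of 0]) auto
    ultimately show ?thesis using d cpos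
      by (simp add: norm_divide norm_mult c_def)
  qed
qed

lemma Harnack_inequality:
  assumes "F holomorphic_on ball x d" "d > 0" "\<And>z. z \<in> ball x d \<Longrightarrow> Re (F z) > 0"
    and z: "z \<in> ball x d"
  shows "Re (F x) * (d - norm (z - x)) \<le> Re (F z) * (d + norm (z - x))"
    and "Re (F z) * (d - norm (z - x)) \<le> Re (F x) * (d + norm (z - x))"
proof -
  define v c r where "v = F z" "c = F x" "r = norm (z - x)"
  have v: "Re v > 0" and c: "Re c > 0" using assms by (auto simp: v_c_r_def)
  have r: "0 \<le> r" "r < d" using z by (auto simp: v_c_r_def dist_norm norm_minus_commute)
  have "norm (v - c) * d \<le> norm (v + cnj c) * r"
    unfolding v_c_r_def by (rule positive_real_part_Schwarz(1)[OF assms(1,2,3) z]) 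
  then have "(norm (v - c) * d)\<^sup>2 \<le> (norm (v + cnj c) * r)\<^sup>2"
    using assms(2) by (intro power_mono) auto
  then have "((Re v - Re c)\<^sup>2 + (Im v - Im c)\<^sup>2) * d\<^sup>2 \<le> ((Re v + Re c)\<^sup>2 + (Im v - Im c)\<^sup>2) * r\<^sup>2"
    by (simp add: power_mult_distrib cmod_power2)
  moreover have "(Im v - Im c)\<^sup>2 * r\<^sup>2 \<le> (Im v - Im c)\<^sup>2 * d\<^sup>2"
    using r by (intro mult_left_mono power_mono) auto
  ultimately have "(Re v - Re c)\<^sup>2 * d\<^sup>2 \<le> (Re v + Re c)\<^sup>2 * r\<^sup>2"
    by (simp add: distrib_right)
  then have "((Re v - Re c) * d)\<^sup>2 \<le> ((Re v + Re c) * r)\<^sup>2"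
    by (simp add: power_mult_distrib)
  then have "\<bar>(Re v - Re c) * d\<bar> \<le> (Re v + Re c) * r"
    using abs_le_square_iff[of "(Re v - Re c) * d" "(Re v + Re c) * r"] v c r by simp
  then show "Re (F x) * (d - norm (z - x)) \<le> Re (F z) * (d + norm (z - x))"
    "Re (F z) * (d - norm (z - x)) \<le> Re (F x) * (d + norm (z - x))"
    unfolding v_c_r_def[symmetric] by (auto simp: algebra_simps abs_le_iff)
qed

lemma Harnack_ln_norm:
  assumes h: "h holomorphic_on ball x d" and d: "d > 0"
    and gt: "\<And>z. z \<in> ball x d \<Longrightarrow> norm (h z) > 1" and z: "z \<in> ball x d"
  shows "ln (norm (h x)) * (d - norm (z - x)) \<le> ln (norm (h z)) * (d + norm (z - x))"
    and "ln (norm (h z)) * (d - norm (z - x)) \<le> ln (norm (h x)) * (d + norm (z - x))"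
    and "norm (deriv h x) * d \<le> 2 * norm (h x) * ln (norm (h x))"
proof -
  have xm: "x \<in> ball x d" using d by simp
  have nz: "h w \<noteq> 0" if "w \<in> ball x d" for w
    using gt[OF that] by auto
  obtain F where F: "F holomorphic_on ball x d" and ex: "\<And>w. w \<in> ball x d \<Longrightarrow> exp (F w) = h w"
    using holomorphic_logarithm_exists[OF convex_ball open_ball h nz xm] by blast
  have re: "Re (F w) = ln (norm (h w))" if "w \<in> ball x d" for w
    unfolding ex[OF that, symmetric] by simp
  have pos: "Re (F w) > 0" if "w \<in> ball x d" for w
    using ln_gt_zero[OF gt[OF that]] re[OF that] by simp
  show "ln (norm (h x)) * (d - norm (z - x)) \<le> ln (norm (h z)) * (d + norm (z - x))"
    "ln (norm (h z)) * (d - norm (z - x)) \<le> ln (norm (h x)) * (d + norm (z - x))"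
    using Harnack_inequality[OF F d pos z] re[OF z] re[OF xm] by auto
  have "deriv h x = deriv (\<lambda>w. exp (F w)) x"
    using xm ex by (intro deriv_cong_ev refl eventually_nhds_in_open[THEN eventually_mono, of "ball x d"]) auto
  also have "\<dots> = exp (F x) * deriv F x"
    using holomorphic_derivI[OF F open_ball xm]
    by (intro DERIV_imp_deriv) (auto intro!: derivative_eq_intros)
  finally have "norm (deriv h x) = norm (h x) * norm (deriv F x)"
    using ex[OF xm] by (simp add: norm_mult)
  moreover have "norm (deriv F x) * d \<le> 2 * ln (norm (h x))"
    using positive_real_part_Schwarz(2)[OF F d pos] re[OF xm] by simp
  ultimately show "norm (deriv h x) * d \<le> 2 * norm (h x) * ln (norm (h x))"
    using mult_left_mono[of "norm (deriv F x) * d" "2 * ln (norm (h x))" "norm (h x)"]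
    by (simp add: mult_ac)
qed

text \<open>Harnack's inequality along the radius from \<open>z\<close> to \<open>x\<close> bounds
  \<open>ln (norm (h (y t)))\<close> below by a multiple of \<open>t\<close>, and with it the
  difference quotients at \<open>z\<close>, where \<open>norm h\<close> equals 1.\<close>

lemma Hopf_boundary_derivative:
  assumes h: "h holomorphic_on UNIV" and d: "d > 0"
    and gt: "\<And>z. z \<in> ball x d \<Longrightarrow> norm (h z) > 1"
    and z: "norm (z - x) = d" and hz: "norm (h z) = 1"
  shows "ln (norm (h x)) \<le> 2 * d * norm (deriv h z)"
proof -
  define u where "u = ln (norm (h x))"
  define y where "y = (\<lambda>t::real. z + t * (x - z))"
  have quot: "u / (2 * d) \<le> norm ((h (y t) - h z) / (y t - z))" if t: "0 < t" "t < 1" for t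
  proof -
    have yx: "norm (y t - x) = (1 - t) * d"
    proof -
      have "y t - x = of_real (1 - t) * (z - x)" by (simp add: y_def algebra_simps)
      then show ?thesis using t z by (simp only: norm_mult norm_of_real)
    qed
    have ym: "y t \<in> ball x d" using yx t d by (simp add: dist_norm norm_minus_commute)
    have yz: "norm (y t - z) = t * d"
      using t z by (simp add: y_def norm_mult norm_minus_commute)
    have "u * (t * d) \<le> ln (norm (h (y t))) * ((2 - t) * d)"
      using Harnack_ln_norm(1)[OF holomorphic_on_subset[OF h] d gt ym] yx
      by (simp add: u_def algebra_simps)
    then have "(u * t) * d \<le> (ln (norm (h (y t))) * (2 - t)) * d"
      by (simp add: mult_ac)
    then have "u * t \<le> ln (norm (h (y t))) * (2 - t)"
      using d by (rule mult_right_le_imp_le)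
    also have "\<dots> \<le> ln (norm (h (y t))) * 2"
      using gt[OF ym] t by (intro mult_left_mono) auto
    finally have "u * t / 2 \<le> ln (norm (h (y t)))" by simp
    also have "\<dots> \<le> norm (h (y t)) - 1"
      using gt[OF ym] by (intro ln_le_minus_one) linarith
    also have "\<dots> \<le> norm (h (y t) - h z)"
      using hz norm_triangle_ineq2[of "h (y t)" "h z"] by simp
    finally have "u * t / 2 \<le> norm (h (y t) - h z)" .
    then have "u * t / 2 / (t * d) \<le> norm (h (y t) - h z) / (t * d)"
      using t d by (intro divide_right_mono) auto
    then show ?thesis using t d yz by (simp add: norm_divide field_simps)
  qed
  have "(h has_field_derivative deriv h z) (at z)"
    using h by (intro holomorphic_derivI[OF h]) auto
  then have "((\<lambda>w. (h w - h z) / (w - z)) \<longlongrightarrow> deriv h z) (at z)"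
    by (simp add: has_field_derivative_iff)
  moreover have "filterlim y (at z) (at_right 0)"
  proof (rule filterlim_atI)
    have "((\<lambda>t. z + complex_of_real t * (x - z)) \<longlongrightarrow> z + of_real 0 * (x - z)) (at_right 0)"
      by (intro tendsto_intros)
    then show "(y \<longlongrightarrow> z) (at_right 0)" by (simp add: y_def)
    have "x \<noteq> z" using z d by auto
    then show "\<forall>\<^sub>F t in at_right 0. y t \<noteq> z"
      by (auto simp: y_def eventually_at_right_field intro!: exI[of _ 1])
  qed
  ultimately have "((\<lambda>t. norm ((h (y t) - h z) / (y t - z))) \<longlongrightarrow> norm (deriv h z)) (at_right 0)"
    by (intro tendsto_norm) (rule filterlim_compose)
  moreover have "\<forall>\<^sub>F t in at_right 0. u / (2 * d) \<le> norm ((h (y t) - h z) / (y t - z))"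
    using quot by (auto simp: eventually_at_right_field intro!: exI[of _ 1])
  ultimately have "u / (2 * d) \<le> norm (deriv h z)"
    by (rule tendsto_lowerbound) simp
  then show ?thesis using d by (simp add: u_def field_simps)
qed

text \<open>The largest disc about \<open>x\<close> that avoids the closed set
  \<open>norm (h y) \<le> 1\<close> touches it at a point of modulus exactly 1, by continuity. This
  is the configuration for \<open>Hopf_boundary_derivative\<close>.\<close>

lemma nearest_modulus_one:
  assumes h: "h holomorphic_on UNIV" and gt1: "norm (h x) > 1" and w: "norm (h w) \<le> 1"
  shows "\<exists>z. norm (h z) = 1 \<and> norm (z - x) > 0 \<and> norm (z - x) \<le> norm (w - x)
           \<and> (\<forall>y\<in>ball x (norm (z - x)). norm (h y) > 1)"
proof -
  define S where "S = {w. norm (h w) \<le> 1}"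
  have ch: "continuous_on UNIV h" using h by (rule holomorphic_on_imp_continuous_on)
  have clS: "closed S" unfolding S_def
    by (intro closed_Collect_le continuous_intros continuous_on_subset[OF ch]) auto
  have wS: "w \<in> S" using w by (simp add: S_def)
  obtain z where z: "z \<in> S" "\<And>y. y \<in> S \<Longrightarrow> dist x z \<le> dist x y"
    using distance_attains_inf[OF clS, of x] wS by blast
  define d where "d = dist x z"
  have dz: "norm (z - x) = d" by (simp add: d_def dist_norm norm_minus_commute)
  have dpos: "d > 0" using gt1 z(1) by (auto simp: d_def S_def)
  have gt: "norm (h y) > 1" if "y \<in> ball x d" for y
    using z(2)[of y] that by (force simp: d_def S_def)
  have "closed {y. 1 \<le> norm (h y)}"
    by (intro closed_Collect_le continuous_intros continuous_on_subset[OF ch]) auto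
  moreover have "ball x d \<subseteq> {y. 1 \<le> norm (h y)}" using gt by force
  ultimately have "closure (ball x d) \<subseteq> {y. 1 \<le> norm (h y)}" by (intro closure_minimal)
  moreover have "z \<in> closure (ball x d)" using dpos by (simp add: d_def)
  ultimately have "norm (h z) = 1" using z(1) by (auto simp: S_def)
  moreover have "d \<le> norm (w - x)" using z(2)[OF wS] by (simp add: d_def dist_norm norm_minus_commute)
  ultimately show ?thesis using dpos gt by (intro exI[of _ z]) (auto simp: dz)
qed

text \<open>Harnack's inequality loses a factor 3 on each of the 13 discs covering an arc
  from \<^term>\<open>z1\<close> to \<^term>\<open>z0\<close>.\<close>

lemma large_boundary_derivative:
  assumes h: "h holomorphic_on UNIV" and z0: "norm z0 = 1" and z1: "norm z1 = 1"
    and A: "norm (h z0) \<le> A" "A \<ge> 1" and B: "3 ^ 13 * ln A < ln (norm (h z1))"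
  shows "\<exists>z. 1/2 \<le> norm z \<and> norm z \<le> 3/2 \<and> norm (h z) = 1
           \<and> ln (norm (h z1)) \<le> 3 ^ 13 * norm (deriv h z)"
proof -
  define \<theta> where "\<theta> = Arg (z0 / z1)"
  \<comment> \<open>Thirteen steps of angle at most \<open>pi / 13\<close>, which is below 1/4.
    Consecutive centres are thus within half the radius 1/2 of the discs, where the Harnack ratio
    \<open>(1/2 + s) / (1/2 - s)\<close> is at most 3.\<close>
  define x where "x = (\<lambda>i. z1 * cis (\<theta> * real i / 13))"
  define b where "b = ln (norm (h z1))"
  have lnA: "0 \<le> ln A" using A by simp
  have bpos: "b > 0" using B lnA unfolding b_def by simp
  have z1nz: "z1 \<noteq> 0" using z1 by auto
  have x0: "x 0 = z1" by (simp add: x_def)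
  have "cis \<theta> = z0 / z1"
  proof -
    have "cis \<theta> = sgn (z0 / z1)"
      using z0 z1 unfolding \<theta>_def by (intro cis_Arg) auto
    then show ?thesis using z0 z1 by (simp add: sgn_eq norm_divide)
  qed
  then have x13: "x 13 = z0" using z1nz by (simp add: x_def)
  have nx: "norm (x i) = 1" for i using z1 by (simp add: x_def norm_mult)
  have step: "norm (x (Suc i) - x i) \<le> 1/4" for i
  proof -
    have "x (Suc i) - x i = x i * (cis (\<theta> / 13) - 1)"
      by (simp add: x_def algebra_simps cis_mult add_divide_distrib)
    then have "norm (x (Suc i) - x i) = norm (exp (\<i> * of_real (\<theta> / 13)) - 1)"
      using nx[of i] by (simp add: norm_mult cis_conv_exp)
    also have "\<dots> = 2 * \<bar>sin (\<theta> / 13 / 2)\<bar>"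
      by (rule dist_exp_i_1)
    also have "\<dots> \<le> \<bar>\<theta>\<bar> / 13"
      using abs_sin_x_le_abs_x[of "\<theta> / 13 / 2"] by simp
    also have "\<dots> \<le> 1/4"
    proof -
      have "pi < 13 / 4" using pi_approx by simp
      then show ?thesis using Arg_bounded[of "z0 / z1"] unfolding \<theta>_def by linarith
    qed
    finally show ?thesis .
  qed
  \<comment> \<open>The chain stops at the first disc that meets the set
    \<open>norm (h w) \<le> 1\<close>. If there were none, the estimate would reach
    \<open>z0\<close> and contradict \<open>B\<close>.\<close>
  define hit where "hit = (\<lambda>i. \<exists>w\<in>ball (x i) (1/2). norm (h w) \<le> 1)"
  have chain: "b \<le> 3 ^ i * ln (norm (h (x i)))" if "\<And>k. k < i \<Longrightarrow> \<not> hit k" for i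
    using that
  proof (induction i)
    case 0
    then show ?case by (simp add: x0 b_def)
  next
    case (Suc i)
    have IH: "b \<le> 3 ^ i * ln (norm (h (x i)))" using Suc by simp
    have gt: "norm (h z) > 1" if "z \<in> ball (x i) (1/2)" for z
      using Suc.prems[of i] that by (force simp: hit_def)
    have m: "x (Suc i) \<in> ball (x i) (1/2)"
      using step[of i] by (simp add: dist_norm norm_minus_commute)
    define l L s where "l = ln (norm (h (x i)))" "L = ln (norm (h (x (Suc i))))" "s = norm (x (Suc i) - x i)"
    have s: "0 \<le> s" "s \<le> 1/4" using step[of i] by (auto simp: l_L_s_def)
    have pos: "l \<ge> 0" "L \<ge> 0"
      using gt[OF m] gt[of "x i"] by (auto simp: l_L_s_def)
    have "l * (1/4) \<le> l * (1/2 - s)" using s pos by (intro mult_left_mono) auto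
    also have "\<dots> \<le> L * (1/2 + s)"
      using Harnack_ln_norm(1)[OF holomorphic_on_subset[OF h] _ gt m] by (simp add: l_L_s_def)
    also have "\<dots> \<le> L * (3/4)" using s pos by (intro mult_left_mono) auto
    finally have "l \<le> 3 * L" by simp
    then have "3 ^ i * l \<le> 3 ^ i * (3 * L)" by (intro mult_left_mono) auto
    with IH have "b \<le> 3 ^ i * (3 * L)" unfolding l_L_s_def by (rule order_trans)
    then show ?case by (simp add: l_L_s_def mult_ac)
  qed
  have ex: "\<exists>i\<le>13. hit i"
  proof (rule ccontr)
    assume "\<not> ?thesis"
    then have le: "b \<le> 3 ^ 13 * ln (norm (h (x 13)))" by (intro chain) auto
    then have "0 < ln (norm (h z0))" using bpos x13 by simp
    then have "norm (h z0) \<noteq> 0" by auto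
    then have "ln (norm (h z0)) \<le> ln A" using A by simp
    then show False using le B x13 unfolding b_def by simp
  qed
  define i where "i = (LEAST i. hit i)"
  have i: "hit i" and i13: "i \<le> 13"
    unfolding i_def using ex by (blast intro: LeastI) (meson ex Least_le order_trans)
  have i': "\<not> hit k" if "k < i" for k
    using that unfolding i_def by (rule not_less_Least)
  have bi: "b \<le> 3 ^ i * ln (norm (h (x i)))" by (intro chain i')
  then have lpos: "0 < ln (norm (h (x i)))"
    using bpos by (metis less_le_trans zero_less_mult_pos zero_less_numeral zero_less_power)
  have gt1: "norm (h (x i)) > 1"
  proof (rule ccontr)
    assume "\<not> ?thesis"
    then have "ln (norm (h (x i))) \<le> 0" by (cases "h (x i) = 0") auto
    then show False using lpos by simp
  qed
  obtain w where w: "w \<in> ball (x i) (1/2)" "norm (h w) \<le> 1" using i by (auto simp: hit_def)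
  obtain z where hz: "norm (h z) = 1" and z: "norm (z - x i) > 0" "norm (z - x i) \<le> norm (w - x i)"
    and gt: "\<And>y. y \<in> ball (x i) (norm (z - x i)) \<Longrightarrow> norm (h y) > 1"
    using nearest_modulus_one[OF h gt1 w(2)] by blast
  define d where "d = norm (z - x i)"
  have d12: "d < 1/2" using z(2) w(1) by (simp add: d_def dist_norm norm_minus_commute)
  have dpos: "d > 0" using z(1) by (simp add: d_def)
  have nzx: "norm (z - x i) = d" by (simp add: d_def)
  have "ln (norm (h (x i))) \<le> 2 * d * norm (deriv h z)"
    by (rule Hopf_boundary_derivative[OF h dpos gt[folded d_def] nzx hz])
  also have "\<dots> \<le> 1 * norm (deriv h z)" using d12 by (intro mult_right_mono) auto
  finally have H: "ln (norm (h (x i))) \<le> norm (deriv h z)" by simp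
  have "b \<le> 3 ^ i * ln (norm (h (x i)))" by (rule bi)
  also have "\<dots> \<le> 3 ^ 13 * norm (deriv h z)"
    using H i13 lpos by (intro mult_mono power_increasing) auto
  finally have "b \<le> 3 ^ 13 * norm (deriv h z)" .
  moreover have "1/2 \<le> norm z" "norm z \<le> 3/2"
    using nzx d12 nx[of i] norm_triangle_ineq2[of z "x i"] norm_triangle_ineq2[of "x i" z]
    by (auto simp: norm_minus_commute)
  ultimately show ?thesis using hz unfolding b_def by blast
qed

section \<open>Zalcman rescaling\<close>

definition spherical_deriv :: "(complex \<Rightarrow> complex) \<Rightarrow> complex \<Rightarrow> real" where
  "spherical_deriv h z = norm (deriv h z) / (1 + (norm (h z))\<^sup>2)"

lemma one_plus_norm_sq_pos [simp]: "1 + (norm (w::complex))\<^sup>2 > 0"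
  by (metis add_pos_nonneg zero_le_power2 zero_less_one)

lemma spherical_deriv_nonneg [simp]: "spherical_deriv h z \<ge> 0"
  by (simp add: spherical_deriv_def less_imp_le)

lemma deriv_affine:
  assumes "h holomorphic_on UNIV"
  shows "deriv (\<lambda>z. h (p + s * z)) z = s * deriv h (p + s * z)"
proof -
  have "(h has_field_derivative deriv h (p + s * z)) (at (p + s * z))"
    using assms by (intro holomorphic_derivI[OF assms]) auto
  then have "((\<lambda>z. h (p + s * z)) has_field_derivative deriv h (p + s * z) * s) (at z)"
    by (rule DERIV_chain2) (auto intro!: derivative_eq_intros)
  then show ?thesis by (simp add: DERIV_imp_deriv mult.commute)
qed

lemma holomorphic_affine:
  assumes "h holomorphic_on UNIV"
  shows "(\<lambda>z. h (p + s * z)) holomorphic_on UNIV"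
  by (intro holomorphic_on_compose_gen[OF _ assms, unfolded o_def] holomorphic_intros) auto

lemma spherical_deriv_affine:
  assumes "h holomorphic_on UNIV"
  shows "spherical_deriv (\<lambda>z. h (p + s * z)) z = norm s * spherical_deriv h (p + s * z)"
  by (simp add: spherical_deriv_def deriv_affine[OF assms] norm_mult)

text \<open>The point \<^term>\<open>p\<close> maximises \<^term>\<open>\<lambda>z. (l - norm (z - w)) * spherical_deriv h z\<close>.\<close>

lemma Zalcman_rescale:
  assumes h: "h holomorphic_on UNIV" and l: "l > 0" and w: "spherical_deriv h w > 0"
  shows "\<exists>p s. p \<in> ball w l \<and> s > 0 \<and> s \<le> 1 / spherical_deriv h w
    \<and> spherical_deriv (\<lambda>z. h (p + of_real s * z)) 0 = 1
    \<and> (\<forall>z\<in>cball 0 (l * spherical_deriv h w / 2). spherical_deriv (\<lambda>z. h (p + of_real s * z)) z \<le> 2)"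
proof -
  define \<Phi> where "\<Phi> = (\<lambda>z. (l - norm (z - w)) * spherical_deriv h z)"
  have nz: "1 + (norm (h z))\<^sup>2 \<noteq> 0" for z
    using one_plus_norm_sq_pos[of "h z"] by linarith
  have hd: "deriv h holomorphic_on UNIV" using h by (intro holomorphic_deriv) auto
  have "continuous_on (cball w l) \<Phi>"
    unfolding \<Phi>_def spherical_deriv_def
    by (intro continuous_intros holomorphic_on_imp_continuous_on[OF holomorphic_on_subset[OF h]]
        holomorphic_on_imp_continuous_on[OF holomorphic_on_subset[OF hd]]) (use nz in auto)
  then obtain p where p: "p \<in> cball w l" and max: "\<And>z. z \<in> cball w l \<Longrightarrow> \<Phi> z \<le> \<Phi> p"
    using continuous_attains_sup[of "cball w l" \<Phi>] l by auto
  define D where "D = l * spherical_deriv h w"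
  define m where "m = l - norm (p - w)"
  have Dpos: "D > 0" using l w by (simp add: D_def)
  have DV: "D \<le> m * spherical_deriv h p"
    using max[of w] l by (simp add: \<Phi>_def D_def m_def)
  have m0: "m \<ge> 0" using p by (simp add: m_def dist_norm norm_minus_commute)
  have mpos: "m > 0" and hp: "spherical_deriv h p > 0"
    using DV Dpos m0 by (metis less_le_trans less_eq_real_def mult_eq_0_iff spherical_deriv_nonneg not_le)+
  \<comment> \<open>This scale normalises the derivative at 0. Comparing \<open>p\<close> with the
    centre \<open>w\<close> gives \<open>s * D \<le> m\<close>, so the disc of radius
    \<open>D / 2\<close> is carried into the ball of radius \<open>m / 2\<close> about
    \<open>p\<close>.\<close>
  define s where "s = 1 / spherical_deriv h p"
  have spos: "s > 0" using hp by (simp add: s_def)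
  have sD: "s * D \<le> m" using DV hp by (simp add: s_def field_simps)
  have "s * D \<le> l" using sD by (simp add: m_def) (smt (verit) norm_ge_zero)
  then have s1: "s \<le> 1 / spherical_deriv h w"
    using l w by (simp add: D_def field_simps)
  \<comment> \<open>At distance at most \<open>m / 2\<close> from \<open>p\<close> the weight is
    still at least \<open>m / 2\<close>, so maximality at \<open>p\<close> costs only a factor
    2.\<close>
  have "spherical_deriv (\<lambda>z. h (p + of_real s * z)) z \<le> 2" if z: "z \<in> cball 0 (D / 2)" for z
  proof -
    define q where "q = p + of_real s * z"
    have "norm (q - p) = s * norm z" using spos by (simp add: q_def norm_mult)
    also have "\<dots> \<le> s * (D / 2)" using z spos by (intro mult_left_mono) auto
    finally have qp: "norm (q - p) \<le> m / 2" using sD by simp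
    have "norm (q - w) \<le> norm (q - p) + norm (p - w)"
      using norm_triangle_ineq[of "q - p" "p - w"] by simp
    then have lq: "l - norm (q - w) \<ge> m / 2" using qp by (simp add: m_def)
    then have "q \<in> cball w l" using mpos by (simp add: dist_norm norm_minus_commute)
    then have "\<Phi> q \<le> \<Phi> p" by (rule max)
    moreover have "m / 2 * spherical_deriv h q \<le> \<Phi> q"
      unfolding \<Phi>_def using lq by (intro mult_right_mono) auto
    ultimately have "m / 2 * spherical_deriv h q \<le> m * spherical_deriv h p"
      by (simp add: \<Phi>_def m_def)
    then have "m * (spherical_deriv h q / 2) \<le> m * spherical_deriv h p" by simp
    then have "spherical_deriv h q / 2 \<le> spherical_deriv h p"
      using mpos by (rule mult_left_le_imp_le)
    then have "s * spherical_deriv h q \<le> s * (2 * spherical_deriv h p)"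
      using spos by (intro mult_left_mono) auto
    then show ?thesis using spos hp
      by (simp add: spherical_deriv_affine[OF h] q_def[symmetric]) (simp add: s_def divide_le_eq)
  qed
  moreover have "spherical_deriv (\<lambda>z. h (p + of_real s * z)) 0 = 1"
    using spos hp by (simp add: spherical_deriv_affine[OF h]) (simp add: s_def)
  moreover have "p \<in> ball w l" using mpos by (simp add: m_def dist_norm norm_minus_commute)
  ultimately show ?thesis using spos s1 unfolding D_def by blast
qed

text \<open>Up to an affine map, \<open>1 / (1 + (norm (g x))\<^sup>2)\<close> is the height of
  \<open>g x\<close> on the Riemann sphere. Its gradient is at most
  \<open>2 * G / (1 + G\<^sup>2)\<close> times the spherical derivative, where
  \<open>G = norm (g x)\<close>, and that factor is at most 1.\<close>

lemma spherical_deriv_bound_Lipschitz: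
  assumes g: "g holomorphic_on UNIV" and S: "convex S"
    and le: "\<And>z. z \<in> S \<Longrightarrow> spherical_deriv g z \<le> 2" and xy: "x \<in> S" "y \<in> S"
  shows "\<bar>1 / (1 + (norm (g x))\<^sup>2) - 1 / (1 + (norm (g y))\<^sup>2)\<bar> \<le> 2 * norm (x - y)"
proof -
  define Y where "Y = (\<lambda>z. 1 / (1 + g z \<bullet> g z))"
  define Y' where "Y' = (\<lambda>z v. - (2 * (g z \<bullet> (deriv g z * v))) / (1 + g z \<bullet> g z)\<^sup>2)"
  have Yd: "(Y has_derivative Y' z) (at z within S)" if "z \<in> S" for z
  proof -
    have "(g has_field_derivative deriv g z) (at z within S)"
      using g by (intro has_field_derivative_at_within[OF holomorphic_derivI[OF g]]) auto
    then have gd: "(g has_derivative (\<lambda>v. deriv g z * v)) (at z within S)"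
      by (simp add: has_field_derivative_def)
    have nz: "1 + g z \<bullet> g z \<noteq> 0"
      by (metis one_plus_norm_sq_pos less_irrefl power2_norm_eq_inner)
    show ?thesis unfolding Y_def Y'_def
      by (rule derivative_eq_intros gd refl nz)+
        (auto simp: fun_eq_iff power2_eq_square inner_commute field_simps)
  qed
  have on: "onorm (Y' z) \<le> 2" if "z \<in> S" for z
  proof (rule onorm_le)
    fix v
    define G where "G = norm (g z)"
    have "\<bar>Y' z v\<bar> = 2 * \<bar>g z \<bullet> (deriv g z * v)\<bar> / (1 + G\<^sup>2)\<^sup>2"
      by (simp add: Y'_def G_def power2_norm_eq_inner abs_mult)
    also have "\<dots> \<le> 2 * (G * (norm (deriv g z) * norm v)) / (1 + G\<^sup>2)\<^sup>2"
      using Cauchy_Schwarz_ineq2[of "g z" "deriv g z * v"]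
      by (intro divide_right_mono mult_left_mono) (auto simp: G_def norm_mult)
    also have "\<dots> = (2 * G / (1 + G\<^sup>2)) * spherical_deriv g z * norm v"
      by (simp add: spherical_deriv_def G_def power2_eq_square)
    also have "\<dots> \<le> 1 * 2 * norm v"
    proof (intro mult_mono le)
      have "0 \<le> (1 - G)\<^sup>2" by simp
      then have "2 * G \<le> 1 + G\<^sup>2" by (simp add: power2_diff)
      then show "2 * G / (1 + G\<^sup>2) \<le> 1"
        using one_plus_norm_sq_pos[of "g z"] by (simp add: G_def divide_le_eq)
    qed (use that in auto)
    finally show "norm (Y' z v) \<le> 2 * norm v" by simp
  qed
  have "norm (Y x - Y y) \<le> 2 * norm (x - y)"
    by (rule differentiable_bound[OF S Yd on xy])
  then show ?thesis by (simp add: Y_def power2_norm_eq_inner)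
qed

text \<open>If \<open>norm (g x) \<le> 1\<close>, the Lipschitz bound keeps
  \<open>norm (g z) \<le> 2\<close>. Otherwise it keeps \<open>norm (2 * g y)\<close> above 1 on the
  disc of radius 1/8, and Harnack's inequality for its logarithm has ratio 3 at distance 1/16,
  whence the cube. Bounds on the functions themselves let Montel's theorem replace Marty's.\<close>

lemma spherical_deriv_bound_growth:
  assumes g: "g holomorphic_on UNIV" and le: "\<And>z. z \<in> cball x (1/8) \<Longrightarrow> spherical_deriv g z \<le> 2"
    and gx: "norm (g x) \<le> A" "A \<ge> 1" and z: "norm (z - x) \<le> 1/16"
  shows "norm (g z) \<le> (2 * A) ^ 3"
proof -
  define Y where "Y = (\<lambda>z. 1 / (1 + (norm (g z))\<^sup>2))"
  have Lip: "\<bar>Y y - Y x\<bar> \<le> 1/4" if "y \<in> cball x (1/8)" for y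
  proof -
    have "\<bar>Y y - Y x\<bar> \<le> 2 * norm (y - x)"
      unfolding Y_def using that by (intro spherical_deriv_bound_Lipschitz[OF g convex_cball[of x "1/8"] le]) auto
    then show ?thesis using that by (simp add: dist_norm norm_minus_commute)
  qed
  have zm: "z \<in> cball x (1/8)" using z by (simp add: dist_norm norm_minus_commute)
  show ?thesis
  proof (cases "norm (g x) \<le> 1")
    case True
    then have "(norm (g x))\<^sup>2 \<le> 1" by (simp add: power_le_one)
    then have "Y x \<ge> 1/2" by (simp add: Y_def le_divide_eq)
    then have "Y z \<ge> 1/4" using Lip[OF zm] by linarith
    then have "(norm (g z))\<^sup>2 \<le> 3"
      using one_plus_norm_sq_pos[of "g z"] by (simp add: Y_def le_divide_eq)
    then have "(norm (g z))\<^sup>2 \<le> 2\<^sup>2" by simp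
    then have "norm (g z) \<le> 2" by (rule power2_le_imp_le) simp
    also have "\<dots> \<le> (2 * A) ^ 1" using gx by simp
    also have "\<dots> \<le> (2 * A) ^ 3" using gx by (intro power_increasing) auto
    finally show ?thesis .
  next
    case False
    then have "(norm (g x))\<^sup>2 \<ge> 1" by simp
    then have Yx: "Y x \<le> 1/2" using one_plus_norm_sq_pos[of "g x"] by (simp add: Y_def divide_le_eq)
    have gt: "norm (2 * g y) > 1" if y: "y \<in> ball x (1/8)" for y
    proof -
      have "\<bar>Y y - Y x\<bar> \<le> 1/4" using y by (intro Lip) auto
      then have "Y y \<le> 3/4" using Yx by linarith
      then have "(norm (g y))\<^sup>2 \<ge> 1/3"
        using one_plus_norm_sq_pos[of "g y"] by (simp add: Y_def divide_le_eq)
      then have "(norm (g y))\<^sup>2 > (1/2)\<^sup>2" by (simp add: power2_eq_square)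
      then have "norm (g y) > 1/2" by (rule power2_less_imp_less) simp
      then show ?thesis by (simp add: norm_mult)
    qed
    have zb: "z \<in> ball x (1/8)" using z by (simp add: dist_norm norm_minus_commute)
    define l L s where "l = ln (norm (2 * g x))" "L = ln (norm (2 * g z))" "s = norm (z - x)"
    have "(\<lambda>z. 2 * g z) holomorphic_on ball x (1/8)"
      by (intro holomorphic_intros holomorphic_on_subset[OF g]) auto
    from Harnack_ln_norm(2)[OF this _ gt zb]
    have "L * (1/8 - s) \<le> l * (1/8 + s)" by (simp add: l_L_s_def)
    moreover have "0 \<le> s" "s \<le> 1/16" using z by (auto simp: l_L_s_def)
    moreover have "l > 0" "L > 0"
      unfolding l_L_s_def by (intro ln_gt_zero gt zb; simp)+
    moreover from calculation have "L * (1/16) \<le> L * (1/8 - s)" "l * (1/8 + s) \<le> l * (3/16)"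
      by (auto intro!: mult_left_mono)
    ultimately have "L \<le> 3 * l" by linarith
    then have "exp L \<le> exp l ^ 3" by (simp flip: exp_of_nat_mult)
    moreover have "exp L = norm (2 * g z)" "exp l = norm (2 * g x)"
      using gt[OF zb] gt[of x] unfolding l_L_s_def by (auto simp del: norm_mult intro!: exp_ln)
    ultimately have "2 * norm (g z) \<le> (2 * norm (g x)) ^ 3" by (simp add: norm_mult)
    also have "\<dots> \<le> (2 * A) ^ 3" using gx by (intro power_mono) auto
    finally show ?thesis using norm_ge_zero[of "g z"] by linarith
  qed
qed

text \<open>This excludes infinity as a limit. If \<open>G = norm (g 0)\<close> were large,
  \<open>ln (norm (2 * g y))\<close> would be positive near 0 and the gradient estimate would give
  \<open>norm (deriv g 0) \<le> 16 * G * ln (2 * G)\<close>, whereas the normalisation says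
  \<open>norm (deriv g 0) = 1 + G\<^sup>2\<close>. With
  \<open>ln (2 * G) \<le> 2 * sqrt (2 * G)\<close> this yields 2048.\<close>

lemma normalised_value_bound:
  assumes g: "g holomorphic_on UNIV" and le: "\<And>z. z \<in> cball 0 (1/8) \<Longrightarrow> spherical_deriv g z \<le> 2"
    and 1: "spherical_deriv g 0 = 1"
  shows "norm (g 0) \<le> 2048"
proof (rule ccontr)
  assume "\<not> ?thesis"
  then have big: "norm (g 0) > 2048" by simp
  define G where "G = norm (g 0)"
  define Y where "Y = (\<lambda>z. 1 / (1 + (norm (g z))\<^sup>2))"
  have gt: "norm (2 * g y) > 1" if y: "y \<in> ball 0 (1/8)" for y
  proof -
    have "\<bar>Y y - Y 0\<bar> \<le> 2 * norm (y - 0)"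
      unfolding Y_def using y
      by (intro spherical_deriv_bound_Lipschitz[OF g convex_cball[of 0 "1/8"] le]) auto
    moreover have "1 \<le> (norm (g 0))\<^sup>2" using big by simp
    then have "Y 0 \<le> 1/2" using one_plus_norm_sq_pos[of "g 0"] by (simp add: Y_def divide_le_eq)
    ultimately have "Y y \<le> 3/4" using y by auto
    then have "(norm (g y))\<^sup>2 \<ge> 1/3"
      using one_plus_norm_sq_pos[of "g y"] by (simp add: Y_def divide_le_eq)
    then have "(norm (g y))\<^sup>2 > (1/2)\<^sup>2" by (simp add: power2_eq_square)
    then have "norm (g y) > 1/2" by (rule power2_less_imp_less) simp
    then show ?thesis by (simp add: norm_mult)
  qed
  have g2: "(\<lambda>z. 2 * g z) holomorphic_on ball 0 (1/8)"
    by (intro holomorphic_intros holomorphic_on_subset[OF g]) auto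
  have "g field_differentiable at 0"
    using g by (simp add: holomorphic_on_open field_differentiable_def)
  then have d2: "deriv (\<lambda>z. 2 * g z) 0 = 2 * deriv g 0" by (rule deriv_cmult)
  have "norm (2 * deriv g 0) * (1/8) \<le> 2 * norm (2 * g 0) * ln (norm (2 * g 0))"
    using Harnack_ln_norm(3)[OF g2 _ gt, of 0] unfolding d2 by simp
  then have "norm (deriv g 0) \<le> 16 * G * ln (2 * G)"
    by (simp add: norm_mult G_def)
  moreover have "norm (deriv g 0) = 1 + G\<^sup>2"
    using 1 one_plus_norm_sq_pos[of "g 0"] by (simp add: spherical_deriv_def G_def divide_eq_1_iff)
  moreover have "ln (2 * G) \<le> 2 * sqrt (2 * G)"
  proof -
    have "ln (sqrt (2 * G)) \<le> sqrt (2 * G) - 1"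
      using big by (intro ln_le_minus_one) (auto simp: G_def)
    then show ?thesis using big by (simp add: ln_sqrt G_def)
  qed
  ultimately have "1 + G\<^sup>2 \<le> 16 * G * (2 * sqrt (2 * G))"
    using big by (smt (verit) G_def mult_left_mono)
  then have "G * G \<le> G * (32 * sqrt (2 * G))" by (simp add: power2_eq_square)
  then have "G \<le> 32 * sqrt (2 * G)"
    by (rule mult_left_le_imp_le) (use big in \<open>auto simp: G_def\<close>)
  then have "G\<^sup>2 \<le> (32 * sqrt (2 * G))\<^sup>2" using big by (intro power_mono) (auto simp: G_def)
  then have "G\<^sup>2 \<le> 1024 * (2 * G)" using big by (simp add: power_mult_distrib G_def)
  then have "G * G \<le> 2048 * G" by (simp add: power2_eq_square)
  then have "G \<le> 2048" by (rule mult_right_le_imp_le) (use big in \<open>auto simp: G_def\<close>)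
  then show False using big by (simp add: G_def)
qed

text \<open>The growth bound is iterated outwards from 0 in steps of 1/16. The resulting
  \<open>\<Theta>\<close> depends on \<open>j\<close> alone, which makes a normalised family locally
  bounded.\<close>

lemma spherical_deriv_bound_local:
  "\<exists>\<Theta>\<ge>1. \<forall>g z. g holomorphic_on UNIV \<longrightarrow> norm (g 0) \<le> 2048 \<longrightarrow> norm z \<le> real j / 16 \<longrightarrow>
           (\<forall>w\<in>cball 0 (real j / 16 + 1/8). spherical_deriv g w \<le> 2) \<longrightarrow> norm (g z) \<le> \<Theta>"
proof (induction j)
  case 0
  then show ?case by (intro exI[of _ 2048]) auto
next
  case (Suc j)
  then obtain \<Theta> where \<Theta>: "\<Theta> \<ge> 1" and
    IH: "\<And>g z. g holomorphic_on UNIV \<Longrightarrow> norm (g 0) \<le> 2048 \<Longrightarrow> norm z \<le> real j / 16 \<Longrightarrow>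
           (\<forall>w\<in>cball 0 (real j / 16 + 1/8). spherical_deriv g w \<le> 2) \<Longrightarrow> norm (g z) \<le> \<Theta>"
    by blast
  have "norm (g z) \<le> (2 * \<Theta>) ^ 3"
    if g: "g holomorphic_on UNIV" "norm (g 0) \<le> 2048" and z: "norm z \<le> real (Suc j) / 16"
      and le: "\<forall>w\<in>cball 0 (real (Suc j) / 16 + 1/8). spherical_deriv g w \<le> 2" for g z
  proof -
    define x where "x = of_real (real j / real (Suc j)) * z"
    have nx: "norm x = real j / real (Suc j) * norm z"
      by (simp only: x_def norm_mult norm_of_real) simp
    also have "\<dots> \<le> real j / real (Suc j) * (real (Suc j) / 16)"
      using z by (intro mult_left_mono) auto
    finally have x: "norm x \<le> real j / 16" by simp
    have "1 - real j / real (Suc j) = 1 / real (Suc j)" by (simp add: field_simps)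
    moreover have "z - x = of_real (1 - real j / real (Suc j)) * z"
      unfolding x_def of_real_diff by (simp add: algebra_simps)
    ultimately have "z - x = of_real (1 / real (Suc j)) * z" by simp
    then have "norm (z - x) = norm z / real (Suc j)" by (simp only: norm_mult norm_of_real) simp
    also have "\<dots> \<le> (real (Suc j) / 16) / real (Suc j)"
      using z by (intro divide_right_mono) auto
    also have "\<dots> = 1/16" by simp
    finally have zx: "norm (z - x) \<le> 1/16" .
    have "norm (g x) \<le> \<Theta>"
      by (intro IH[OF g x] ballI bspec[OF le]) (auto simp: add_divide_distrib)
    moreover have "spherical_deriv g w \<le> 2" if "w \<in> cball x (1/8)" for w
    proof -
      have "norm w \<le> norm x + norm (w - x)" using norm_triangle_ineq[of x "w - x"] by simp
      also have "\<dots> \<le> real (Suc j) / 16 + 1/8"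
        using x that by (simp add: dist_norm norm_minus_commute add_divide_distrib)
      finally show ?thesis using le by auto
    qed
    ultimately show ?thesis using spherical_deriv_bound_growth[OF g(1) _ _ \<Theta> zx] by blast
  qed
  moreover have "(2 * \<Theta>) ^ 3 \<ge> 1" using \<Theta> by (intro one_le_power) auto
  ultimately show ?case by blast
qed

lemma deriv_tendsto_of_locally_uniform:
  assumes hol: "\<And>k. g k holomorphic_on UNIV"
    and lim: "\<And>K. compact K \<Longrightarrow> uniform_limit K g G sequentially"
  shows "(\<lambda>k. deriv (g k) z) \<longlonglongrightarrow> deriv G z"
proof -
  have "uniform_limit (ball z 1) g G sequentially"
    by (rule uniform_limit_on_subset[OF lim[of "cball z 1"]]) auto
  then show ?thesis
    by (rule deriv_complex_uniform_limit)
      (auto intro: always_eventually holomorphic_on_subset[OF hol])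
qed

text \<open>Montel's theorem applies by local boundedness, and the derivatives converge as well. So
  the normalisation at 0 passes to \<open>G\<close> and prevents it from being constant.\<close>

lemma Zalcman_limit:
  fixes g :: "nat \<Rightarrow> complex \<Rightarrow> complex" and L :: "nat \<Rightarrow> real"
  assumes hol: "\<And>k. g k holomorphic_on UNIV" and L: "filterlim L at_top sequentially"
    and le: "\<And>k z. z \<in> cball 0 (L k) \<Longrightarrow> spherical_deriv (g k) z \<le> 2"
    and 1: "\<And>k. spherical_deriv (g k) 0 = 1"
  shows "\<exists>G r. strict_mono (r :: nat \<Rightarrow> nat) \<and> G holomorphic_on UNIV
      \<and> (\<forall>K. compact K \<longrightarrow> uniform_limit K (g \<circ> r) G sequentially)
      \<and> spherical_deriv G 0 = 1 \<and> (\<forall>z. spherical_deriv G z \<le> 2)"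
proof -
  have bdd: "\<exists>B. \<forall>h\<in>range g. \<forall>z\<in>K. norm (h z) \<le> B" if K: "compact K" for K
  proof -
    obtain R where R: "\<And>z. z \<in> K \<Longrightarrow> norm z \<le> R"
      using compact_imp_bounded[OF K] by (auto simp: bounded_iff)
    obtain j :: nat where j: "16 * R \<le> real j" using real_arch_simple by blast
    obtain \<Theta> where \<Theta>: "\<And>g z. g holomorphic_on UNIV \<Longrightarrow> norm (g 0) \<le> 2048 \<Longrightarrow> norm z \<le> real j / 16 \<Longrightarrow>
           (\<forall>w\<in>cball 0 (real j / 16 + 1/8). spherical_deriv g w \<le> 2) \<Longrightarrow> norm (g z) \<le> \<Theta>"
      using spherical_deriv_bound_local[of j] by blast
    obtain k0 where k0: "\<And>k. k \<ge> k0 \<Longrightarrow> L k \<ge> real j / 16 + 1/8"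
      using L by (auto simp: filterlim_at_top eventually_sequentially)
    have b1: "norm (g k z) \<le> \<Theta>" if "k \<ge> k0" "z \<in> K" for k z
    proof (rule \<Theta>[OF hol])
      have 2: "spherical_deriv (g k) w \<le> 2" if "w \<in> cball 0 (real j / 16 + 1/8)" for w
        using that k0[OF \<open>k \<ge> k0\<close>] by (intro le) auto
      then show "\<forall>w\<in>cball 0 (real j / 16 + 1/8). spherical_deriv (g k) w \<le> 2" by blast
      have "spherical_deriv (g k) w \<le> 2" if "w \<in> cball 0 (1/8)" for w
        using that by (intro 2) auto
      then show "norm (g k 0) \<le> 2048" by (intro normalised_value_bound hol 1)
      show "norm z \<le> real j / 16" using R[OF that(2)] j by simp
    qed
    \<comment> \<open>The discs on which \<open>spherical_deriv (g k)\<close> is controlled are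
      large enough only for \<open>k \<ge> k0\<close>; the finitely many other functions are bounded
      on \<open>K\<close> by continuity.\<close>
    have "bounded (\<Union>k<k0. g k ` K)"
      by (intro bounded_UN compact_imp_bounded compact_continuous_image ballI
          holomorphic_on_imp_continuous_on holomorphic_on_subset[OF hol] K) auto
    then obtain B where B: "\<And>k z. k < k0 \<Longrightarrow> z \<in> K \<Longrightarrow> norm (g k z) \<le> B"
      by (fastforce simp: bounded_iff)
    have "norm (g k z) \<le> max B \<Theta>" if "z \<in> K" for k z
      using b1[of k z] B[of k z] that by (cases "k < k0") auto
    then show ?thesis by blast
  qed
  obtain G r where G: "G holomorphic_on UNIV" "strict_mono (r :: nat \<Rightarrow> nat)"
    and pt: "\<And>x. x \<in> UNIV \<Longrightarrow> (\<lambda>n. g (r n) x) \<longlonglongrightarrow> G x"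
    and ul: "\<And>K. compact K \<Longrightarrow> K \<subseteq> UNIV \<Longrightarrow> uniform_limit K (g \<circ> r) G sequentially"
    by (rule Montel[of UNIV "range g" g]) (use hol bdd in auto)
  have D: "(\<lambda>k. deriv (g (r k)) z) \<longlonglongrightarrow> deriv G z" for z
    using deriv_tendsto_of_locally_uniform[of "g \<circ> r" G z] hol ul by (simp add: o_def)
  have S: "(\<lambda>k. spherical_deriv (g (r k)) z) \<longlonglongrightarrow> spherical_deriv G z" for z
    unfolding spherical_deriv_def
    by (intro tendsto_intros D pt less_imp_neq[OF one_plus_norm_sq_pos, symmetric]) auto
  have "spherical_deriv G 0 = 1"
    using S[of 0] 1 by (simp add: LIMSEQ_const_iff)
  moreover have "spherical_deriv G z \<le> 2" for z
  proof (rule tendsto_upperbound[OF S])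
    have "\<forall>\<^sub>F k in sequentially. norm z \<le> L (r k)"
      using filterlim_compose[OF L filterlim_subseq[OF G(2)]] by (simp add: filterlim_at_top)
    then show "\<forall>\<^sub>F k in sequentially. spherical_deriv (g (r k)) z \<le> 2"
      by eventually_elim (auto intro: le)
  qed simp
  ultimately show ?thesis using G ul by blast
qed

section \<open>Simple values of limit functions\<close>

text \<open>\<open>F z - L * z\<close> has derivative at most \<open>norm L / 2\<close>, so
  \<open>F\<close> multiplies distances by at least \<open>norm L / 2\<close>. This gives
  injectivity, a covered disc and a Lipschitz inverse at once.\<close>

lemma holomorphic_local_inverse:
  assumes F: "F holomorphic_on ball x s" and s: "s > 0" and L: "L \<noteq> 0"
    and near: "\<And>z. z \<in> ball x s \<Longrightarrow> norm (deriv F z - L) \<le> norm L / 2"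
  shows "\<exists>G. continuous_on (ball (F x) (norm L * s / 4)) G
    \<and> (\<forall>y\<in>ball (F x) (norm L * s / 4). G y \<in> ball x s \<and> F (G y) = y)"
proof -
  have lower: "norm L / 2 * norm (z - w) \<le> norm (F z - F w)" if zw: "z \<in> ball x s" "w \<in> ball x s" for z w
  proof -
    have "norm ((F z - L * z) - (F w - L * w)) \<le> norm L / 2 * norm (z - w)"
    proof (rule field_differentiable_bound[where f = "\<lambda>z. F z - L * z" and f' = "\<lambda>z. deriv F z - L",
          OF convex_ball _ near zw])
      fix u assume u: "u \<in> ball x s"
      have "(F has_field_derivative deriv F u) (at u within ball x s)"
        by (rule has_field_derivative_at_within[OF holomorphic_derivI[OF F open_ball u]])
      then show "((\<lambda>z. F z - L * z) has_field_derivative deriv F u - L) (at u within ball x s)"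
        by (auto intro!: derivative_eq_intros)
    qed
    moreover have "norm (L * (z - w)) \<le> norm (F z - F w) + norm ((F z - L * z) - (F w - L * w))"
      using norm_triangle_ineq4[of "F z - F w" "(F z - L * z) - (F w - L * w)"] by (simp add: algebra_simps)
    ultimately show ?thesis by (simp add: norm_mult)
  qed
  have inj: "inj_on F (ball x s)"
  proof (rule inj_onI)
    fix z w assume "z \<in> ball x s" "w \<in> ball x s" "F z = F w"
    then have "norm L / 2 * norm (z - w) \<le> 0" using lower[of z w] by simp
    then show "z = w" using L by (simp add: mult_le_0_iff)
  qed
  have sub: "ball x (s/2) \<subseteq> ball x s" "cball x (s/2) \<subseteq> ball x s" using s by auto
  \<comment> \<open>Half the radius, so that the closure still lies where \<open>F\<close> is
    controlled. Points of its frontier have images at distance at least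
    \<open>norm L / 2 * (s / 2)\<close> from \<open>F x\<close>, the radius in the claim.\<close>
  define S where "S = ball x (s/2)"
  have "open (F ` S)"
    unfolding S_def using sub by (intro open_mapping_thm3[of F]) (auto intro: holomorphic_on_subset[OF F] inj_on_subset[OF inj])
  then have cover: "ball (F x) (norm L * s / 4) \<subseteq> F ` S"
  proof (intro ball_subset_open_map_image)
    show "continuous_on (closure S) F"
      using s sub by (intro holomorphic_on_imp_continuous_on holomorphic_on_subset[OF F]) (auto simp: S_def)
    show "norm L * s / 4 \<le> norm (F z - F x)" if "z \<in> frontier S" for z
    proof -
      have z: "norm (z - x) = s / 2" using that s by (simp add: S_def dist_norm norm_minus_commute)
      then have "z \<in> ball x s" using s by (simp add: dist_norm norm_minus_commute)
      from lower[OF this, of x] show ?thesis using z s by simp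
    qed
  qed (use s L in \<open>auto simp: S_def\<close>)
  define G where "G = inv_into S F"
  have G: "G y \<in> S" "F (G y) = y" if "y \<in> ball (F x) (norm L * s / 4)" for y
    using subsetD[OF cover that] by (simp_all add: G_def inv_into_into f_inv_into_f)
  have "(2 / norm L)-lipschitz_on (ball (F x) (norm L * s / 4)) G"
  proof (rule lipschitz_onI)
    fix y y' assume y: "y \<in> ball (F x) (norm L * s / 4)" "y' \<in> ball (F x) (norm L * s / 4)"
    have "norm L / 2 * norm (G y - G y') \<le> norm (F (G y) - F (G y'))"
      using G(1)[OF y(1)] G(1)[OF y(2)] sub(1) unfolding S_def by (intro lower) blast+
    then show "dist (G y) (G y') \<le> 2 / norm L * dist y y'"
      using L by (simp add: G(2)[OF y(1)] G(2)[OF y(2)] dist_norm field_simps)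
  qed simp
  then have "continuous_on (ball (F x) (norm L * s / 4)) G"
    by (rule lipschitz_on_continuous_on)
  moreover have "G y \<in> ball x s \<and> F (G y) = y" if "y \<in> ball (F x) (norm L * s / 4)" for y
    using G[OF that] sub(1) unfolding S_def by blast
  ultimately show ?thesis by blast
qed

lemma uniform_limit_deriv:
  assumes hol: "\<And>k. g k holomorphic_on UNIV" "G holomorphic_on UNIV"
    and lim: "uniform_limit (cball z 2) g G sequentially"
  shows "uniform_limit (cball z 1) (\<lambda>k. deriv (g k)) (deriv G) sequentially"
proof (rule uniform_limitI)
  fix e :: real assume e: "e > 0"
  have "\<forall>\<^sub>F k in sequentially. \<forall>w\<in>cball z 2. dist (g k w) (G w) < e / 2"
    using uniform_limitD[OF lim, of "e/2"] e by simp
  then show "\<forall>\<^sub>F k in sequentially. \<forall>w\<in>cball z 1. dist (deriv (g k) w) (deriv G w) < e"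
  proof eventually_elim
    case (elim k)
    show ?case
    proof
      fix w assume w: "w \<in> cball z 1"
      have fd: "h field_differentiable at w" if "h holomorphic_on UNIV" for h
        using that by (simp add: holomorphic_on_open field_differentiable_def)
      have "norm ((deriv ^^ 1) (\<lambda>w. g k w - G w) w) \<le> fact 1 * (e / 2) / 1 ^ 1"
      proof (rule Cauchy_inequality)
        show "(\<lambda>w. g k w - G w) holomorphic_on ball w 1"
          by (intro holomorphic_intros holomorphic_on_subset[OF hol(1)] holomorphic_on_subset[OF hol(2)]) auto
        show "continuous_on (cball w 1) (\<lambda>w. g k w - G w)"
          by (intro continuous_intros holomorphic_on_imp_continuous_on
              holomorphic_on_subset[OF hol(1)] holomorphic_on_subset[OF hol(2)]) auto
        fix u assume u: "norm (w - u) = 1"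
        have "dist z u \<le> dist z w + dist w u" by (rule dist_triangle)
        then have "u \<in> cball z 2" using w u by (simp add: dist_norm)
        then show "norm (g k u - G u) \<le> e / 2" using elim by (force simp: dist_norm)
      qed auto
      also have "(deriv ^^ 1) (\<lambda>w. g k w - G w) w = deriv (g k) w - deriv G w"
        using deriv_diff[OF fd[OF hol(1)] fd[OF hol(2)]] by simp
      finally show "dist (deriv (g k) w) (deriv G w) < e" using e by (simp add: dist_norm)
    qed
  qed
qed

text \<open>Supplies the hypothesis of \<open>holomorphic_local_inverse\<close> for all late
  \<open>g k\<close> with one radius \<open>s\<close> and one \<open>L = deriv G z\<close>, so the
  inverses live on discs whose size does not depend on \<open>k\<close>.\<close>

lemma eventually_deriv_near:
  assumes hol: "\<And>k. g k holomorphic_on UNIV" "G holomorphic_on UNIV"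
    and lim: "uniform_limit (cball z 2) g G sequentially" and nz: "deriv G z \<noteq> 0" and e: "e > 0"
  shows "\<exists>s>0. s \<le> e \<and> (\<forall>\<^sub>F k in sequentially. \<forall>w\<in>ball z s.
           norm (deriv (g k) w - deriv G z) \<le> norm (deriv G z) / 2)"
proof -
  define c where "c = norm (deriv G z) / 4"
  have c: "c > 0" using nz by (simp add: c_def)
  have "continuous_on UNIV (deriv G)"
    using hol(2) by (intro holomorphic_on_imp_continuous_on holomorphic_deriv) auto
  then have "isCont (deriv G) z" by (simp add: continuous_on_eq_continuous_at)
  then obtain d where d: "d > 0" "\<And>w. dist w z < d \<Longrightarrow> dist (deriv G w) (deriv G z) < c"
    using c unfolding continuous_at_eps_delta by blast
  define s where "s = min e (min d 1)"
  have "\<forall>\<^sub>F k in sequentially. \<forall>w\<in>cball z 1. dist (deriv (g k) w) (deriv G w) < c"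
    using uniform_limitD[OF uniform_limit_deriv[OF hol lim] c] .
  then have "\<forall>\<^sub>F k in sequentially. \<forall>w\<in>ball z s. norm (deriv (g k) w - deriv G z) \<le> norm (deriv G z) / 2"
  proof eventually_elim
    case (elim k)
    show ?case
    proof
      fix w assume w: "w \<in> ball z s"
      have "dist (deriv (g k) w) (deriv G w) < c" using elim w by (auto simp: s_def)
      moreover have "dist (deriv G w) (deriv G z) < c" using d w by (auto simp: s_def dist_commute)
      ultimately have "dist (deriv (g k) w) (deriv G z) < c + c"
        using dist_triangle[of "deriv (g k) w" "deriv G z" "deriv G w"] by linarith
      then show "norm (deriv (g k) w - deriv G z) \<le> norm (deriv G z) / 2"
        by (simp add: dist_norm c_def)
    qed
  qed
  then show ?thesis using d e by (intro exI[of _ s]) (auto simp: s_def)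
qed

text \<open>A form of Hurwitz's theorem that keeps simplicity: \<open>g k\<close> maps
  \<open>ball z s\<close> over a disc of fixed radius about \<open>g k z\<close>, which eventually
  contains \<open>G z\<close>, and its derivative has no zero in that ball.\<close>

lemma simple_value_persists:
  assumes hol: "\<And>k. g k holomorphic_on UNIV" "G holomorphic_on UNIV"
    and lim: "uniform_limit (cball z 2) g G sequentially" and nz: "deriv G z \<noteq> 0"
  shows "\<forall>\<^sub>F k in sequentially. \<exists>w. g k w = G z \<and> deriv (g k) w \<noteq> 0"
proof -
  obtain s where s: "s > 0" and near: "\<forall>\<^sub>F k in sequentially. \<forall>w\<in>ball z s.
           norm (deriv (g k) w - deriv G z) \<le> norm (deriv G z) / 2"
    using eventually_deriv_near[OF hol lim nz zero_less_one] by blast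
  have "(\<lambda>k. g k z) \<longlonglongrightarrow> G z"
    using tendsto_uniform_limitI[OF lim, of z] by simp
  then have "\<forall>\<^sub>F k in sequentially. dist (g k z) (G z) < norm (deriv G z) * s / 4"
    using s nz by (intro tendstoD) auto
  with near show ?thesis
  proof eventually_elim
    case (elim k)
    obtain H where H: "\<And>y. y \<in> ball (g k z) (norm (deriv G z) * s / 4) \<Longrightarrow> H y \<in> ball z s \<and> g k (H y) = y"
      using holomorphic_local_inverse[OF holomorphic_on_subset[OF hol(1)] s nz, of z k] elim(1) by blast
    have "H (G z) \<in> ball z s" "g k (H (G z)) = G z" using H[of "G z"] elim(2) by auto
    moreover have "deriv (g k) (H (G z)) \<noteq> 0"
    proof
      assume "deriv (g k) (H (G z)) = 0"
      then have "norm (deriv G z) \<le> norm (deriv G z) / 2" using elim(1) calculation(1) by force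
      then show False using nz by simp
    qed
    ultimately show ?case by blast
  qed
qed

text \<open>Let \<open>y\<close> be the nearest point of modulus one, at distance \<open>d\<close>.
  Hopf's lemma bounds \<open>ln (norm (E z))\<close> by \<open>4 * C * d\<close>, and the gradient
  estimate at \<open>z\<close> divides by \<open>d\<close>, so the distance cancels.\<close>

lemma log_deriv_bound:
  assumes E: "E holomorphic_on UNIV" and bd: "\<And>z. spherical_deriv E z \<le> C"
    and w: "norm (E w) \<le> 1" and z: "norm (E z) \<ge> 1"
  shows "norm (deriv E z) \<le> 8 * C * norm (E z)"
proof -
  have C: "C \<ge> 0" using bd[of 0] spherical_deriv_nonneg[of E 0] by linarith
  have at1: "norm (deriv E x) \<le> 2 * C" if "norm (E x) = 1" for x
    using bd[of x] that by (simp add: spherical_deriv_def)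
  show ?thesis
  proof (cases "norm (E z) = 1")
    case True
    then show ?thesis using at1[of z] C by simp
  next
    case False
    then have gt1: "norm (E z) > 1" using z by simp
    obtain y where y: "norm (E y) = 1" "norm (y - z) > 0"
      and gt: "\<And>x. x \<in> ball z (norm (y - z)) \<Longrightarrow> norm (E x) > 1"
      using nearest_modulus_one[OF E gt1 w] by blast
    define d where "d = norm (y - z)"
    have d: "d > 0" using y by (simp add: d_def)
    have "norm (deriv E z) * d \<le> 2 * norm (E z) * ln (norm (E z))"
      by (rule Harnack_ln_norm(3)[OF holomorphic_on_subset[OF E] d gt[folded d_def], where z = z]) (use d in auto)
    also have "\<dots> \<le> 2 * norm (E z) * (2 * d * norm (deriv E y))"
      by (intro mult_left_mono Hopf_boundary_derivative[OF E d gt[folded d_def] d_def[symmetric] y(1)]) auto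
    also have "\<dots> \<le> 2 * norm (E z) * (2 * d * (2 * C))"
      using at1[OF y(1)] d by (intro mult_left_mono) auto
    finally have "norm (deriv E z) * d \<le> (8 * C * norm (E z)) * d" by (simp add: mult_ac)
    then show ?thesis using d by (rule mult_right_le_imp_le)
  qed
qed

text \<open>A zero-free entire function with bounded spherical derivative is an exponential
  \<^term>\<open>\<lambda>z. c * exp (\<alpha> * z)\<close> (Clunie and Hayman).\<close>

lemma zero_free_bounded_spherical_deriv_simple_one:
  assumes E: "E holomorphic_on UNIV" and nz: "\<And>z. E z \<noteq> 0" and nc: "\<not> E constant_on UNIV"
    and bd: "\<And>z. spherical_deriv E z \<le> C"
  shows "\<exists>z. E z = 1 \<and> deriv E z \<noteq> 0"
proof -
  have dE: "(E has_field_derivative deriv E z) (at z)" for z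
    using E by (intro holomorphic_derivI[OF E]) auto
  \<comment> \<open>The reciprocal has the same spherical derivative, so the estimate obtained where
    \<open>norm (E z) \<ge> 1\<close> also covers the rest of the plane, and
    \<open>deriv E z / E z\<close> is bounded.\<close>
  define I where "I = (\<lambda>z. inverse (E z))"
  have I: "I holomorphic_on UNIV" unfolding I_def using nz by (intro holomorphic_intros E) auto
  have dI: "deriv I z = - deriv E z / (E z)\<^sup>2" for z
    unfolding I_def using nz[of z]
    by (intro DERIV_imp_deriv) (auto intro!: derivative_eq_intros dE simp: power2_eq_square divide_simps)
  have sI: "spherical_deriv I z = spherical_deriv E z" for z
  proof -
    have "spherical_deriv I z = norm (deriv E z) / ((norm (E z))\<^sup>2 * (1 + (inverse (norm (E z)))\<^sup>2))"
    proof -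
      have "norm (I z) = inverse (norm (E z))" by (simp add: I_def norm_inverse)
      then show ?thesis by (simp add: spherical_deriv_def dI norm_divide norm_power)
    qed
    also have "(norm (E z))\<^sup>2 * (1 + (inverse (norm (E z)))\<^sup>2) = 1 + (norm (E z))\<^sup>2"
      using nz[of z] by (simp add: field_simps)
    finally show ?thesis by (simp add: spherical_deriv_def)
  qed
  have le1: "\<exists>w. norm (E w) \<le> 1"
  proof (rule ccontr)
    assume "\<not> ?thesis"
    then have "norm (E z) > 1" for z by (simp add: not_le)
    then have "norm (I z) \<le> 1" for z
      by (simp add: I_def norm_inverse inverse_le_1_iff less_imp_le)
    then have "I constant_on UNIV" by (intro Liouville_theorem I) (auto simp: bounded_iff)
    then obtain c where "\<And>z. I z = c" by (auto simp: constant_on_def)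
    then have "E z = inverse c" for z by (metis I_def inverse_inverse_eq)
    then show False using nc by (auto simp: constant_on_def)
  qed
  have ge1: "\<exists>w. norm (E w) \<ge> 1"
  proof (rule ccontr)
    assume "\<not> ?thesis"
    then have "E constant_on UNIV"
      by (intro Liouville_theorem E) (auto simp: bounded_iff not_le intro!: exI[of _ 1] less_imp_le)
    then show False using nc by simp
  qed
  have bound: "norm (deriv E z / E z) \<le> 8 * C" for z
  proof (cases "norm (E z) \<ge> 1")
    case True
    then show ?thesis
      using log_deriv_bound[OF E bd _ True] le1 nz[of z] by (auto simp: norm_divide divide_le_eq)
  next
    case False
    then have "norm (I z) \<ge> 1"
      using nz[of z] by (simp add: I_def norm_inverse one_le_inverse)
    moreover obtain w where "norm (I w) \<le> 1"
      using ge1 by (auto simp: I_def norm_inverse inverse_le_1_iff)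
    ultimately have "norm (deriv I z) \<le> 8 * C * norm (I z)"
      using bd by (intro log_deriv_bound[OF I]) (auto simp: sI)
    moreover have "norm (I z) = 1 / norm (E z)" by (simp add: I_def norm_inverse divide_inverse)
    moreover have "x / e \<le> 8 * C" if "x / e\<^sup>2 \<le> 8 * C * (1 / e)" "e > 0" for x e :: real
      using that by (simp add: field_simps power2_eq_square)
    ultimately show ?thesis using nz[of z]
      by (simp add: dI norm_divide norm_power)
  qed
  have "(\<lambda>z. deriv E z / E z) constant_on UNIV"
    using bound nz E by (intro Liouville_theorem holomorphic_intros) (auto simp: bounded_iff)
  then obtain \<alpha> where \<alpha>: "\<And>z. deriv E z / E z = \<alpha>" by (auto simp: constant_on_def)
  have dE': "deriv E z = \<alpha> * E z" for z using \<alpha>[of z] nz[of z] by (simp add: field_simps)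
  have "((\<lambda>z. E z * exp (- \<alpha> * z)) has_field_derivative 0) (at z)" for z
    by (auto intro!: derivative_eq_intros dE simp: dE')
  then obtain c where c: "\<And>z. E z * exp (- \<alpha> * z) = c"
    using has_field_derivative_zero_constant[OF convex_UNIV, of "\<lambda>z. E z * exp (- \<alpha> * z)"] by force
  have Ez: "E z = c * exp (\<alpha> * z)" for z
    using c[of z] by (simp add: exp_minus field_simps)
  have cnz: "c \<noteq> 0" using Ez[of 0] nz[of 0] by auto
  have anz: "\<alpha> \<noteq> 0"
  proof
    assume "\<alpha> = 0"
    then show False using Ez nc by (auto simp: constant_on_def)
  qed
  define z where "z = - Ln c / \<alpha>"
  have "E z = 1" using cnz anz by (simp add: Ez z_def exp_minus)
  then show ?thesis using dE' anz by (intro exI[of _ z]) auto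
qed

text \<open>Being zero-free and having a simple 1-point are both invariant under an affine change of
  variable. If the spherical derivative is unbounded, rescaled copies of \<open>E\<close> have a
  limit that is zero-free by Hurwitz's theorem and falls under the bounded case; its simple 1-point
  persists in some copy.\<close>

lemma zero_free_simple_one:
  assumes E: "E holomorphic_on UNIV" and nz: "\<And>z. E z \<noteq> 0" and nc: "\<not> E constant_on UNIV"
  shows "\<exists>z. E z = 1 \<and> deriv E z \<noteq> 0"
proof (cases "\<exists>C. \<forall>z. spherical_deriv E z \<le> C")
  case True
  then show ?thesis using zero_free_bounded_spherical_deriv_simple_one[OF E nz nc] by blast
next
  case False
  then have "\<exists>w. spherical_deriv E w > real k" for k by (meson not_le)
  then obtain w where w: "\<And>k. spherical_deriv E (w k) > real k" by metis
  have wpos: "spherical_deriv E (w k) > 0" for k using w[of k] by simp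
  obtain p s where s: "\<And>k. s k > (0::real)"
    and p1: "\<And>k. spherical_deriv (\<lambda>z. E (p k + of_real (s k) * z)) 0 = 1"
    and p2: "\<And>k z. z \<in> cball 0 (1 * spherical_deriv E (w k) / 2) \<Longrightarrow>
        spherical_deriv (\<lambda>z. E (p k + of_real (s k) * z)) z \<le> 2"
    using Zalcman_rescale[OF E zero_less_one wpos] by metis
  define g where "g = (\<lambda>k z. E (p k + of_real (s k) * z))"
  have hol: "g k holomorphic_on UNIV" for k unfolding g_def by (intro holomorphic_affine E)
  have "filterlim (\<lambda>k. 1 * spherical_deriv E (w k) / 2) at_top sequentially"
  proof (rule filterlim_at_top_mono)
    show "filterlim (\<lambda>k. real k / 2) at_top sequentially"
      using filterlim_tendsto_pos_mult_at_top[OF tendsto_const[of "1/2::real"] _ filterlim_real_sequentially] by simp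
    show "\<forall>\<^sub>F k in sequentially. real k / 2 \<le> 1 * spherical_deriv E (w k) / 2"
      using w by (intro always_eventually allI) (simp add: less_imp_le)
  qed
  then have "\<exists>G r. strict_mono (r :: nat \<Rightarrow> nat) \<and> G holomorphic_on UNIV
      \<and> (\<forall>K. compact K \<longrightarrow> uniform_limit K (g \<circ> r) G sequentially)
      \<and> spherical_deriv G 0 = 1 \<and> (\<forall>z. spherical_deriv G z \<le> 2)"
    by (rule Zalcman_limit[OF hol]) (use p1 p2 in \<open>auto simp: g_def\<close>)
  then obtain G r where G: "G holomorphic_on UNIV"
    and ul: "\<And>K. compact K \<Longrightarrow> uniform_limit K (g \<circ> r) G sequentially"
    and G0: "spherical_deriv G 0 = 1" and G2: "\<And>z. spherical_deriv G z \<le> 2"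
    by blast
  have Gnc: "\<not> G constant_on UNIV"
  proof
    assume "G constant_on UNIV"
    then obtain c where "G = (\<lambda>_. c)" by (auto simp: constant_on_def fun_eq_iff)
    then show False using G0 by (simp add: spherical_deriv_def)
  qed
  have Gnz: "G z \<noteq> 0" for z
    by (rule Hurwitz_no_zeros[of UNIV "g \<circ> r" G]) (use hol G ul Gnc nz in \<open>auto simp: g_def\<close>)
  obtain z where z: "G z = 1" "deriv G z \<noteq> 0"
    using zero_free_bounded_spherical_deriv_simple_one[OF G Gnz Gnc G2] by blast
  have "\<forall>\<^sub>F k in sequentially. \<exists>u. (g \<circ> r) k u = G z \<and> deriv ((g \<circ> r) k) u \<noteq> 0"
    by (rule simple_value_persists[OF _ G ul z(2)]) (use hol in auto)
  then obtain k u where "g (r k) u = 1" "deriv (g (r k)) u \<noteq> 0"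
    using z(1) by (auto simp: eventually_sequentially)
  then show ?thesis unfolding g_def deriv_affine[OF E] by auto
qed

text \<open>The 1-points of \<open>E = exp (g - \<mu>)\<close> are the points where \<open>g\<close>
  takes one of the listed values, and \<open>deriv E z = E z * deriv g z\<close> shows that
  simplicity agrees.\<close>

lemma entire_simple_value_mod_2pi_i:
  assumes g: "g holomorphic_on UNIV" and nc: "\<not> g constant_on UNIV"
  shows "\<exists>z (j::int). g z = \<mu> + of_int j * (2 * pi * \<i>) \<and> deriv g z \<noteq> 0"
proof -
  have dg: "(g has_field_derivative deriv g z) (at z)" for z
    using g by (intro holomorphic_derivI[OF g]) auto
  define E where "E = (\<lambda>z. exp (g z - \<mu>))"
  have E: "E holomorphic_on UNIV" unfolding E_def by (intro holomorphic_intros g)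
  have dE: "deriv E z = E z * deriv g z" for z
    unfolding E_def by (intro DERIV_imp_deriv) (auto intro!: derivative_eq_intros dg)
  have "\<not> E constant_on UNIV"
  proof
    assume "E constant_on UNIV"
    then obtain c where "E = (\<lambda>_. c)" by (auto simp: constant_on_def fun_eq_iff)
    then have "deriv E z = 0" for z by simp
    then have "deriv g z = 0" for z using dE[of z] by (simp add: E_def)
    then have "(g has_field_derivative 0) (at z)" for z using dg[of z] by simp
    then have "g constant_on UNIV"
      using has_field_derivative_zero_constant[OF convex_UNIV, of g] by (force simp: constant_on_def)
    then show False using nc by simp
  qed
  then obtain z where z: "E z = 1" "deriv E z \<noteq> 0"
    using zero_free_simple_one[OF E] by (auto simp: E_def)
  have "exp (g z - \<mu>) = 1" using z(1) by (simp add: E_def)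
  then obtain j :: int where "Re (g z - \<mu>) = 0" "Im (g z - \<mu>) = of_int (2 * j) * pi"
    unfolding exp_eq_1 by blast
  then have "g z - \<mu> = of_real (2 * of_int j * pi) * \<i>" by (simp add: complex_eq_iff)
  then have "g z = \<mu> + of_int j * (2 * pi * \<i>)" by (simp add: algebra_simps)
  moreover have "deriv g z \<noteq> 0" using z dE[of z] by simp
  ultimately show ?thesis by blast
qed

section \<open>Growth of the maximum modulus\<close>

lemma norm_le_max_modulus:
  assumes h: "h holomorphic_on UNIV" and z: "norm z \<le> r"
  shows "norm (h z) \<le> max_modulus r h"
proof -
  have bdd: "bdd_above ((\<lambda>z. norm (h z)) ` sphere 0 r)"
    by (intro bounded_imp_bdd_above compact_imp_bounded compact_continuous_image continuous_intros
        holomorphic_on_imp_continuous_on holomorphic_on_subset[OF h]) auto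
  have "norm (h w) \<le> max_modulus r h" if "w \<in> sphere 0 r" for w
    unfolding max_modulus_def using bdd that by (intro cSUP_upper)
  then show ?thesis
  proof (rule maximum_modulus_frontier[where S = "cball 0 r", rotated 3])
    show "h holomorphic_on interior (cball 0 r)" by (rule holomorphic_on_subset[OF h]) simp
    show "continuous_on (closure (cball 0 r)) h"
      by (rule holomorphic_on_imp_continuous_on[OF holomorphic_on_subset[OF h]]) simp
    show "z \<in> cball 0 r" using z by simp
  qed (auto simp: frontier_cball)
qed

lemma max_modulus_attained:
  assumes h: "h holomorphic_on UNIV" and r: "r \<ge> 0"
  shows "\<exists>z. norm z = r \<and> norm (h z) = max_modulus r h"
proof -
  have cont: "continuous_on (sphere 0 r) (\<lambda>z. norm (h z))"
    by (intro continuous_on_norm holomorphic_on_imp_continuous_on holomorphic_on_subset[OF h]) auto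
  have "sphere (0::complex) r \<noteq> {}" using r by simp
  then obtain z where z: "z \<in> sphere 0 r" "\<And>w. w \<in> sphere 0 r \<Longrightarrow> norm (h w) \<le> norm (h z)"
    using continuous_attains_sup[OF compact_sphere _ cont] by blast
  then have "max_modulus r h = norm (h z)"
    unfolding max_modulus_def by (intro antisym cSUP_least cSUP_upper bdd_aboveI2) auto
  then show ?thesis using z by auto
qed

lemma min_modulus_attained:
  assumes h: "h holomorphic_on UNIV" and r: "r \<ge> 0"
  shows "\<exists>z. norm z = r \<and> norm (h z) = min_modulus r h"
proof -
  have cont: "continuous_on (sphere 0 r) (\<lambda>z. norm (h z))"
    by (intro continuous_on_norm holomorphic_on_imp_continuous_on holomorphic_on_subset[OF h]) auto
  have "sphere (0::complex) r \<noteq> {}" using r by simp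
  then obtain z where z: "z \<in> sphere 0 r" "\<And>w. w \<in> sphere 0 r \<Longrightarrow> norm (h z) \<le> norm (h w)"
    using continuous_attains_inf[OF compact_sphere _ cont] by blast
  then have "min_modulus r h = norm (h z)"
    unfolding min_modulus_def by (intro antisym cINF_greatest cINF_lower bdd_belowI2) auto
  then show ?thesis using z by auto
qed

lemma max_modulus_mono:
  assumes h: "h holomorphic_on UNIV" and r: "0 \<le> r" "r \<le> s"
  shows "max_modulus r h \<le> max_modulus s h"
  using max_modulus_attained[OF h r(1)] norm_le_max_modulus[OF h, of _ s] r by metis

lemma max_modulus_nonneg:
  assumes "h holomorphic_on UNIV" and "0 \<le> r"
  shows "0 \<le> max_modulus r h"
  using max_modulus_attained[OF assms] by (metis norm_ge_zero)

lemma transcendental_entire_quotient: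
  assumes f: "transcendental_entire f"
  shows "\<exists>g. transcendental_entire g \<and> (\<forall>z. f z = f 0 + z * g z)"
proof -
  have fh: "f holomorphic_on UNIV" using f by (simp add: transcendental_entire_def)
  define g where "g = (\<lambda>z. if z = 0 then deriv f 0 else (f z - f 0) / (z - 0))"
  have "g holomorphic_on UNIV" unfolding g_def by (rule pole_lemma[OF fh]) auto
  moreover have fg: "f z = f 0 + z * g z" for z by (simp add: g_def)
  moreover have "\<nexists>p. g = poly p"
  proof
    assume "\<exists>p. g = poly p"
    then obtain p where p: "g = poly p" by blast
    have "f = poly (pCons (f 0) p)" by (rule ext, subst fg) (simp add: p)
    then show False using f by (auto simp: transcendental_entire_def)
  qed
  ultimately show ?thesis unfolding transcendental_entire_def by blast
qed

text \<open>Splitting off the constant term replaces power series: the factor \<open>z\<close>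
  raises the power by one, and the constant \<open>C + 1\<close> used for \<open>g\<close> leaves a
  spare \<open>r ^ Suc n\<close> that absorbs \<open>f 0\<close>.\<close>

lemma transcendental_max_modulus_growth:
  assumes "transcendental_entire f"
  shows "\<exists>r1. \<forall>r\<ge>r1. C * r ^ n \<le> max_modulus r f"
  using assms
proof (induction n arbitrary: f C)
  case (0 f C)
  have fh: "f holomorphic_on UNIV" using 0 by (simp add: transcendental_entire_def)
  have "\<exists>z. norm (f z) \<ge> C"
  proof (rule ccontr)
    assume "\<not> ?thesis"
    then have "norm (f z) \<le> C" for z by (simp add: not_le less_imp_le)
    then have "f constant_on UNIV" by (intro Liouville_theorem fh) (auto simp: bounded_iff)
    then obtain c where "f = poly [:c:]" by (auto simp: constant_on_def fun_eq_iff)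
    then show False using 0 unfolding transcendental_entire_def by blast
  qed
  then obtain z where "norm (f z) \<ge> C" by blast
  then show ?case using norm_le_max_modulus[OF fh, of z] by (intro exI[of _ "norm z"]) force
next
  case (Suc n f C)
  have fh: "f holomorphic_on UNIV" using Suc.prems by (simp add: transcendental_entire_def)
  obtain g where g: "transcendental_entire g" and fg: "\<And>z. f z = f 0 + z * g z"
    using transcendental_entire_quotient[OF Suc.prems] by blast
  have gh: "g holomorphic_on UNIV" using g by (simp add: transcendental_entire_def)
  obtain r1 where r1: "\<And>r. r \<ge> r1 \<Longrightarrow> (C + 1) * r ^ n \<le> max_modulus r g"
    using Suc.IH[OF g, of "C + 1"] by blast
  have "C * r ^ Suc n \<le> max_modulus r f" if r: "r \<ge> max (max r1 1) (norm (f 0))" for r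
  proof -
    obtain z where z: "norm z = r" "norm (g z) = max_modulus r g"
      using max_modulus_attained[OF gh, of r] r by auto
    have "r \<le> r ^ Suc n" using r by (intro self_le_power) auto
    then have f0: "norm (f 0) \<le> r ^ Suc n" using r by linarith
    have "(C + 1) * r ^ Suc n = r * ((C + 1) * r ^ n)" by simp
    also have "\<dots> \<le> norm (z * g z)" using r1[of r] r z by (auto simp: norm_mult intro!: mult_left_mono)
    also have "\<dots> \<le> norm (f z) + norm (f 0)"
      using norm_triangle_ineq4[of "f z" "f 0"] by (simp add: fg[of z])
    also have "norm (f z) \<le> max_modulus r f" using z by (intro norm_le_max_modulus fh) auto
    finally show ?thesis using f0 by (simp add: algebra_simps)
  qed
  then show ?case by blast
qed

text \<open>The factor \<open>z\<close> in \<open>f z = f 0 + z * g z\<close> contributes a factor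
  \<open>t\<close> to the ratio. The term \<open>f 0\<close> costs a little, hence the strict bound
  \<open>c < t ^ n\<close>; the loss is absorbed once \<open>max_modulus r f\<close> exceeds the
  threshold \<open>C\<close>.\<close>

lemma transcendental_max_modulus_ratio_power:
  assumes "transcendental_entire f" and t: "t > 1" and "c < t ^ n"
  shows "\<exists>r1. \<forall>r\<ge>r1. c * max_modulus r f \<le> max_modulus (t * r) f"
  using assms(1,3)
proof (induction n arbitrary: f c)
  case (0 f c)
  have fh: "f holomorphic_on UNIV" using 0 by (simp add: transcendental_entire_def)
  have "c * max_modulus r f \<le> max_modulus (t * r) f" if r: "r \<ge> 0" for r
  proof -
    have "c * max_modulus r f \<le> 1 * max_modulus r f"
      using 0 by (intro mult_right_mono max_modulus_nonneg fh r) auto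
    also have "\<dots> \<le> max_modulus (t * r) f"
      using r t mult_right_mono[of 1 t r] by (simp add: max_modulus_mono[OF fh])
    finally show ?thesis .
  qed
  then show ?case by blast
next
  case (Suc n f c)
  have fh: "f holomorphic_on UNIV" using Suc.prems by (simp add: transcendental_entire_def)
  obtain g where g: "transcendental_entire g" and fg: "\<And>z. f z = f 0 + z * g z"
    using transcendental_entire_quotient[OF Suc.prems(1)] by blast
  have gh: "g holomorphic_on UNIV" using g by (simp add: transcendental_entire_def)
  have "max (c / t) 0 < t ^ n"
    using Suc.prems(2) t by (auto simp: field_simps)
  then obtain c0 where c0: "max (c / t) 0 < c0" "c0 < t ^ n"
    using dense by blast
  have c0': "0 < c0" "t * c0 - c > 0" using c0 t by (auto simp: field_simps)
  obtain r1 where r1: "\<And>r. r \<ge> r1 \<Longrightarrow> c0 * max_modulus r g \<le> max_modulus (t * r) g"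
    using Suc.IH[OF g c0(2)] by blast
  define C where "C = (t * c0 + 1) * norm (f 0) / (t * c0 - c)"
  obtain r2 where r2: "\<And>r. r \<ge> r2 \<Longrightarrow> C \<le> max_modulus r f"
    using transcendental_max_modulus_growth[OF Suc.prems(1), of C 0] by auto
  have "c * max_modulus r f \<le> max_modulus (t * r) f" if r: "r \<ge> max (max r1 1) r2" for r
  proof -
    define M where "M = max_modulus r f"
    have tr: "t * r \<ge> 0" using r t by simp
    obtain z where z: "norm z = t * r" "norm (g z) = max_modulus (t * r) g"
      using max_modulus_attained[OF gh tr] by auto
    obtain w where w: "norm w = r" "norm (f w) = M"
      using max_modulus_attained[OF fh, of r] r by (auto simp: M_def)
    have "M \<le> norm (f 0) + r * norm (g w)"
      using norm_triangle_ineq[of "f 0" "w * g w"] w by (simp add: fg[of w, symmetric] norm_mult)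
    also have "\<dots> \<le> norm (f 0) + r * max_modulus r g"
      using w r by (intro add_left_mono mult_left_mono norm_le_max_modulus gh) auto
    finally have 1: "M - norm (f 0) \<le> r * max_modulus r g" by simp
    have "t * c0 * (M - norm (f 0)) \<le> t * c0 * (r * max_modulus r g)"
      using 1 t c0' by (intro mult_left_mono) auto
    also have "\<dots> = (t * r) * (c0 * max_modulus r g)" by simp
    also have "\<dots> \<le> (t * r) * max_modulus (t * r) g"
      using r1[of r] r tr by (intro mult_left_mono) auto
    also have "\<dots> = norm (z * g z)" using z by (simp add: norm_mult)
    also have "\<dots> \<le> norm (f z) + norm (f 0)"
      using norm_triangle_ineq4[of "f z" "f 0"] by (simp add: fg[of z])
    also have "norm (f z) \<le> max_modulus (t * r) f" using z by (intro norm_le_max_modulus fh) auto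
    finally have 2: "t * c0 * (M - norm (f 0)) \<le> max_modulus (t * r) f + norm (f 0)" by simp
    have "C \<le> M" using r2[of r] r by (simp add: M_def)
    then have "(t * c0 + 1) * norm (f 0) \<le> M * (t * c0 - c)"
      using c0' by (simp add: C_def divide_le_eq)
    then show ?thesis using 2 unfolding M_def[symmetric] by (simp add: algebra_simps)
  qed
  then show ?case by blast
qed

lemma transcendental_max_modulus_ratio:
  assumes f: "transcendental_entire f" and t: "t > 1"
  shows "\<exists>r1. \<forall>r\<ge>r1. c * max_modulus r f \<le> max_modulus (t * r) f"
  using transcendental_max_modulus_ratio_power[OF f t] real_arch_pow[OF t, of c] by blast

section \<open>Behaviour near points of maximum modulus\<close>

text \<open>The point \<^term>\<open>\<zeta>\<close> maximises \<^term>\<open>\<lambda>z. norm (f z) * exp (- la / (s2 - ln (norm z)))\<close>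
  over the annulus. The barrier tends to infinity at the outer boundary, and its slope at
  \<^term>\<open>ln (norm \<zeta>)\<close> is \<^term>\<open>N\<close>.\<close>

lemma Wiman_Valiron_point:
  assumes f: "transcendental_entire f" and K: "K > 0" and e: "e > 0"
  shows "\<exists>r1>0. \<forall>r\<ge>r1. \<exists>\<zeta> N. r \<le> norm \<zeta> \<and> norm \<zeta> \<le> 2 * r
    \<and> norm (f \<zeta>) = max_modulus (norm \<zeta>) f \<and> N \<ge> 1 / e \<and> N \<le> 4 * (ln (max_modulus (norm \<zeta>) f))\<^sup>2
    \<and> (\<forall>\<tau>\<in>ball 0 K. norm (f (\<zeta> * exp (\<tau> / of_real N))) \<le> (1 + e) * exp (Re \<tau>) * norm (f \<zeta>))"
proof -
  have fh: "f holomorphic_on UNIV" using f by (simp add: transcendental_entire_def)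
  \<comment> \<open>\<open>8 * K\<close> keeps \<open>K / N\<close> below \<open>D / 8\<close>; the
    second entry bounds the quadratic error by \<open>ln (1 + e)\<close>; \<open>1 / e\<close> is a
    lower bound for \<open>N\<close>; and \<open>la \<ge> 1\<close> gives
    \<open>N \<le> (la / D)\<^sup>2\<close>.\<close>
  define la where "la = Max {8 * K, 2 * K\<^sup>2 / ln (1 + e), 1 / e, 1}"
  have la: "8 * K \<le> la" "2 * K\<^sup>2 / ln (1 + e) \<le> la" "1 / e \<le> la" "1 \<le> la"
    by (simp_all add: la_def)
  have lapos: "la > 0" using la by simp
  obtain ra where ra: "\<And>r. r \<ge> ra \<Longrightarrow> exp (3 * la) * max_modulus r f \<le> max_modulus (exp (1/8) * r) f"
    using transcendental_max_modulus_ratio[OF f, of "exp (1/8)" "exp (3 * la)"] by auto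
  obtain rb where rb: "\<And>r. r \<ge> rb \<Longrightarrow> exp (2 * la) \<le> max_modulus r f"
    using transcendental_max_modulus_growth[OF f, of "exp (2 * la)" 0] by auto
  define r1 where "r1 = max 1 (max ra rb)"
  have "\<exists>\<zeta> N. r \<le> norm \<zeta> \<and> norm \<zeta> \<le> 2 * r
    \<and> norm (f \<zeta>) = max_modulus (norm \<zeta>) f \<and> N \<ge> 1 / e \<and> N \<le> 4 * (ln (max_modulus (norm \<zeta>) f))\<^sup>2
    \<and> (\<forall>\<tau>\<in>ball 0 K. norm (f (\<zeta> * exp (\<tau> / of_real N))) \<le> (1 + e) * exp (Re \<tau>) * norm (f \<zeta>))"
    if r: "r \<ge> r1" for r
  proof -
    have rpos: "r \<ge> 1" "r \<ge> ra" "r \<ge> rb" using r by (auto simp: r1_def)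
    define s1 where "s1 = ln r"
    define s2 where "s2 = ln (2 * r)"
    have s12: "s2 = s1 + ln 2" using rpos by (simp add: s1_def s2_def ln_mult)
    have ln2: "2/3 \<le> ln (2::real)" "ln (2::real) \<le> 0.7"
      using ln2_ge_two_thirds ln2_le_25_over_36 by auto
    define Q where "Q = (\<lambda>z. norm (f z) * exp (- la / (s2 - ln (norm z))))"
    have Q_eq: "Q z = norm (f z) * exp (- la / (s2 - ln (norm z)))" for z by (simp add: Q_def)
    define M where "M = (\<lambda>s. max_modulus (exp s) f)"
    have Mmono: "M s \<le> M t" if "s \<le> t" for s t
      unfolding M_def using that by (intro max_modulus_mono[OF fh]) auto
    have ers: "exp s1 = r" "exp s2 = 2 * r" using rpos by (auto simp: s1_def s2_def)
    have fM: "norm (f z) \<le> M s" if "z \<noteq> 0" "ln (norm z) \<le> s" for z s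
    proof -
      have "norm z = exp (ln (norm z))" using that by simp
      also have "\<dots> \<le> exp s" using that by (simp only: exp_le_cancel_iff)
      finally show ?thesis unfolding M_def by (rule norm_le_max_modulus[OF fh])
    qed
    have M1: "M (s1 + 1/8) \<ge> exp (2 * la)"
    proof -
      have "exp (2 * la) \<le> M s1" unfolding M_def ers by (rule rb[OF rpos(3)])
      also have "\<dots> \<le> M (s1 + 1/8)" by (rule Mmono) simp
      finally show ?thesis .
    qed
    have M1pos: "M (s1 + 1/8) > 0" using M1 by (rule less_le_trans[rotated]) simp
    \<comment> \<open>A competitor that keeps the maximum away from the inner boundary: from
      logarithmic radius \<open>s1 + 1/8\<close> to \<open>s1 + 1/4\<close> the maximum modulus
      gains \<open>exp (3 * la)\<close>, more than the barrier takes away at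
      \<open>q\<close>.\<close>
    obtain q where q: "norm q = exp (s1 + 1/4)" "norm (f q) = M (s1 + 1/4)"
      using max_modulus_attained[OF fh, of "exp (s1 + 1/4)"] by (auto simp: M_def)
    have Qq: "Q q > M (s1 + 1/8) * exp (- la / ln 2)"
    proof -
      have "exp (3 * la) * M (s1 + 1/8) \<le> max_modulus (exp (1/8) * exp (s1 + 1/8)) f"
        unfolding M_def
      proof (rule ra)
        have "exp s1 \<le> exp (s1 + 1/8)" by simp
        then show "ra \<le> exp (s1 + 1/8)" using rpos ers by linarith
      qed
      also have "exp (1/8) * exp (s1 + 1/8) = exp (s1 + 1/4)" by (simp flip: exp_add)
      finally have 1: "exp (3 * la) * M (s1 + 1/8) \<le> norm (f q)" by (simp add: q M_def)
      have sq: "s2 - ln (norm q) = ln 2 - 1/4" by (simp add: q s12)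
      have "la / (ln 2 - 1/4) \<le> la / 0.4" using ln2 lapos by (intro divide_left_mono) auto
      also have "\<dots> < 3 * la" using lapos by simp
      also have "\<dots> \<le> 3 * la + la / ln 2" using lapos by simp
      finally have "exp (- la / ln 2) < exp (3 * la) * exp (- la / (ln 2 - 1/4))"
        by (simp flip: exp_add)
      with M1pos have "M (s1 + 1/8) * exp (- la / ln 2) <
          exp (3 * la) * M (s1 + 1/8) * exp (- la / (ln 2 - 1/4))" by simp
      also have "\<dots> \<le> Q q"
        unfolding Q_def sq using 1 by (intro mult_right_mono) auto
      finally show ?thesis .
    qed
    have Qqpos: "Q q > 0" using Qq M1pos by (smt (verit) exp_gt_zero mult_pos_pos)
    \<comment> \<open>Width of the outer strip to be cut off. There the barrier pushes
      \<open>Q\<close> below \<open>Q q\<close>, so a maximum over the compact \<open>A\<close> is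
      one over the whole open annulus; the second summand ensures that \<open>q\<close> remains in
      \<open>A\<close>.\<close>
    define h where "h = la / (\<bar>ln (M s2 / Q q)\<bar> + la / (ln 2 - 1/4) + 1)"
    have den: "\<bar>ln (M s2 / Q q)\<bar> + la / (ln 2 - 1/4) + 1 > 0" using ln2 lapos by (auto intro!: add_nonneg_pos)
    have h: "h > 0" using den lapos by (simp add: h_def)
    have lah: "la / h = \<bar>ln (M s2 / Q q)\<bar> + la / (ln 2 - 1/4) + 1"
      using lapos by (simp add: h_def)
    have hq: "s1 + 1/4 \<le> s2 - h"
    proof -
      have "la / (ln 2 - 1/4) \<le> la / h" using lah by simp
      then have "h \<le> ln 2 - 1/4"
        using divide_strict_left_mono[of "ln 2 - 1/4" h la] h ln2 lapos by (force simp: not_less[symmetric])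
      then show ?thesis by (simp add: s12)
    qed
    define A where "A = cball (0::complex) (exp (s2 - h)) - ball 0 (exp s1)"
    have Anz: "z \<noteq> 0" if "z \<in> A" for z using that by (auto simp: A_def)
    have lnA: "ln (norm z) \<le> s2 - h" if "z \<in> A" for z
    proof -
      have "ln (norm z) \<le> ln (exp (s2 - h))"
        using that Anz[OF that] by (intro ln_mono) (auto simp: A_def)
      then show ?thesis by simp
    qed
    have qA: "q \<in> A" using q hq by (auto simp: A_def)
    have "continuous_on A Q"
      unfolding Q_def using Anz lnA h
      by (intro continuous_intros holomorphic_on_imp_continuous_on holomorphic_on_subset[OF fh]) force+
    moreover have "compact A" unfolding A_def by (intro compact_diff) auto
    ultimately obtain \<zeta> where \<zeta>: "\<zeta> \<in> A" "\<And>z. z \<in> A \<Longrightarrow> Q z \<le> Q \<zeta>"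
      using continuous_attains_sup[of A Q] qA by blast
    have Q\<zeta>: "Q q \<le> Q \<zeta>" by (rule \<zeta>(2)[OF qA])
    define s0 where "s0 = ln (norm \<zeta>)"
    have \<zeta>nz: "\<zeta> \<noteq> 0" by (rule Anz[OF \<zeta>(1)])
    have n\<zeta>: "norm \<zeta> = exp s0" using \<zeta>nz by (simp add: s0_def)
    have max: "Q z \<le> Q \<zeta>" if z: "z \<noteq> 0" "s1 \<le> ln (norm z)" "ln (norm z) < s2" for z
    proof (cases "ln (norm z) \<le> s2 - h")
      case True
      have "exp (ln (norm z)) = norm z" using z(1) by simp
      then have "exp s1 \<le> norm z" "norm z \<le> exp (s2 - h)"
        using z(2) True by (metis exp_le_cancel_iff)+
      then have "z \<in> A" by (simp add: A_def)
      then show ?thesis by (rule \<zeta>(2))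
    next
      case False
      then have "s2 - ln (norm z) \<le> h" "s2 - ln (norm z) > 0" using z by auto
      then have "la / h \<le> la / (s2 - ln (norm z))" using lapos h by (intro divide_left_mono) auto
      moreover have "0 \<le> la / (ln 2 - 1/4)" using ln2 lapos by simp
      then have "ln (M s2 / Q q) \<le> la / h" using lah abs_ge_self[of "ln (M s2 / Q q)"] by linarith
      ultimately have le: "- la / (s2 - ln (norm z)) \<le> - ln (M s2 / Q q)" by simp
      have Mpos: "M s2 > 0"
        using M1 Mmono[of "s1 + 1/8" s2] s12 ln2 exp_gt_zero[of "2 * la"] by linarith
      have "Q z \<le> M s2 * exp (- ln (M s2 / Q q))"
        using le fM[of z s2] z Mpos unfolding Q_eq[of z] by (intro mult_mono) auto
      also have "\<dots> = Q q" using Mpos Qqpos by (simp add: exp_minus)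
      finally show ?thesis using Q\<zeta> by simp
    qed
    have s0: "s1 + 1/8 < s0" "s0 < s2"
    proof -
      show "s0 < s2" using lnA[OF \<zeta>(1)] h by (simp add: s0_def)
      show "s1 + 1/8 < s0"
      proof (rule ccontr)
        assume n: "\<not> ?thesis"
        have "exp s1 \<le> exp s0" using \<zeta>(1) n\<zeta> by (auto simp: A_def)
        then have "s2 - s0 \<le> ln 2" by (simp add: s12)
        then have "la / ln 2 \<le> la / (s2 - s0)" using \<open>s0 < s2\<close> lapos by (intro divide_left_mono) auto
        then have "Q \<zeta> \<le> M (s1 + 1/8) * exp (- la / ln 2)"
          unfolding Q_def using n fM[OF \<zeta>nz, of "s1 + 1/8"] M1pos
          by (intro mult_mono) (auto simp: s0_def)
        then show False using Qq Q\<zeta> by simp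
      qed
    qed
    define D where "D = s2 - s0"
    define N where "N = la / D\<^sup>2"
    have D: "D > 0" "D \<le> 1" using s0 s12 ln2 by (auto simp: D_def)
    have Npos: "N > 0" using lapos D by (simp add: N_def)
    have f\<zeta>: "norm (f \<zeta>) = max_modulus (norm \<zeta>) f"
    proof (rule antisym)
      show "norm (f \<zeta>) \<le> max_modulus (norm \<zeta>) f" by (rule norm_le_max_modulus[OF fh]) simp
      obtain z where z: "norm z = norm \<zeta>" "norm (f z) = max_modulus (norm \<zeta>) f"
        using max_modulus_attained[OF fh, of "norm \<zeta>"] by auto
      have "Q z \<le> Q \<zeta>" using z \<zeta>nz s0 by (intro max) (auto simp: s0_def)
      then show "max_modulus (norm \<zeta>) f \<le> norm (f \<zeta>)" using z by (simp add: Q_def)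
    qed
    have Nla: "la \<le> N"
    proof -
      have "D\<^sup>2 \<le> 1" using D by (simp add: power_le_one)
      then show ?thesis using lapos D by (simp add: N_def le_divide_eq)
    qed
    \<comment> \<open>The competitor gives \<open>Q \<zeta> \<ge> exp (- la / ln 2)\<close>, so the
      barrier value \<open>la / D\<close> is at most \<open>m + 2 * la\<close>, hence at most
      \<open>2 * m\<close>.\<close>
    have N4: "N \<le> 4 * (ln (max_modulus (norm \<zeta>) f))\<^sup>2"
    proof -
      define m where "m = ln (norm (f \<zeta>))"
      have "exp (2 * la) \<le> M (s1 + 1/8)" by (rule M1)
      also have "\<dots> \<le> M s0" using s0 by (intro Mmono) auto
      finally have big: "exp (2 * la) \<le> norm (f \<zeta>)" by (simp add: f\<zeta> M_def n\<zeta>)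
      then have fpos: "norm (f \<zeta>) > 0" using exp_gt_zero[of "2 * la"] by linarith
      have m2: "2 * la \<le> m" using big fpos by (simp add: m_def ln_ge_iff)
      have "1 * exp (- la / ln 2) \<le> M (s1 + 1/8) * exp (- la / ln 2)"
        using M1 lapos by (intro mult_right_mono order_trans[OF _ M1]) auto
      also have "\<dots> \<le> Q \<zeta>" using Qq Q\<zeta> by simp
      also have "\<dots> = exp (m - la / D)"
        using fpos by (simp add: Q_def m_def D_def s0_def exp_diff exp_minus divide_inverse)
      finally have "- la / ln 2 \<le> m - la / D" by simp
      moreover have "la / ln 2 \<le> la / 0.5" using ln2 lapos by (intro divide_left_mono) auto
      ultimately have "la / D \<le> 2 * m" using m2 by simp
      then have "(la / D)\<^sup>2 \<le> (2 * m)\<^sup>2" using lapos D by (intro power_mono) auto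
      moreover have "N \<le> (la / D)\<^sup>2"
        using la(4) lapos D by (simp add: N_def power2_eq_square divide_right_mono)
      ultimately show ?thesis by (simp add: m_def f\<zeta> power_mult_distrib)
    qed
    have grow: "norm (f (\<zeta> * exp (\<tau> / of_real N))) \<le> (1 + e) * exp (Re \<tau>) * norm (f \<zeta>)"
      if \<tau>: "\<tau> \<in> ball 0 K" for \<tau>
    proof -
      define z where "z = \<zeta> * exp (\<tau> / of_real N)"
      define x where "x = Re \<tau> / N"
      have lnz: "ln (norm z) = s0 + x" and znz: "z \<noteq> 0"
        using \<zeta>nz by (auto simp: z_def norm_mult ln_mult s0_def x_def)
      have "\<bar>x\<bar> \<le> K / N"
        using \<tau> abs_Re_le_cmod[of \<tau>] Npos by (simp add: x_def divide_right_mono)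
      moreover have KN: "K / N \<le> D / 8"
      proof -
        have "8 * K * D \<le> la * 1" using la(1) D K by (intro mult_mono) auto
        then have "K * D * D * 8 \<le> la * D" using D by simp
        then show ?thesis using lapos D by (simp add: N_def field_simps power2_eq_square)
      qed
      ultimately have x: "\<bar>x\<bar> \<le> K / N" "\<bar>x\<bar> \<le> D / 8" by linarith+
      have Qz: "Q z \<le> Q \<zeta>"
        using x s0 D znz by (intro max) (auto simp: lnz D_def)
      have Dx: "D - x \<ge> D / 2" using x D by linarith
      have "norm (f z) \<le> norm (f \<zeta>) * exp (la / (D - x) - la / D)"
      proof -
        have "norm (f z) * exp (- la / (D - x)) \<le> norm (f \<zeta>) * exp (- la / D)"
          using Qz by (simp add: Q_def lnz s0_def[symmetric] D_def algebra_simps)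
        then have "norm (f z) * exp (- la / (D - x)) * exp (la / (D - x))
            \<le> norm (f \<zeta>) * exp (- la / D) * exp (la / (D - x))"
          by (intro mult_right_mono) auto
        then show ?thesis by (simp add: mult.assoc flip: exp_add)
      qed
      \<comment> \<open>The linear term is exactly \<open>Re \<tau>\<close> because \<open>N\<close>
        is the slope of the barrier; what remains is quadratic in \<open>x\<close>.\<close>
      also have "la / (D - x) - la / D = Re \<tau> + N * x\<^sup>2 / (D - x)"
      proof -
        have "Re \<tau> = N * x" using Npos by (simp add: x_def)
        then show ?thesis using Dx D unfolding N_def by (simp add: field_simps power2_eq_square)
      qed
      also have "N * x\<^sup>2 / (D - x) \<le> ln (1 + e)"
      proof -
        have "\<bar>x\<bar>\<^sup>2 \<le> (K / N)\<^sup>2" using x by (intro power_mono) auto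
        then have "N * x\<^sup>2 \<le> N * (K / N)\<^sup>2" using Npos by (intro mult_left_mono) auto
        then have "N * x\<^sup>2 / (D - x) \<le> N * (K / N)\<^sup>2 / (D / 2)"
          using Dx D Npos by (intro frac_le) auto
        also have "\<dots> = 2 * K\<^sup>2 * D / la"
          using D lapos by (simp add: N_def field_simps power2_eq_square)
        also have "\<dots> \<le> 2 * K\<^sup>2 * 1 / la" using D lapos by (intro divide_right_mono mult_left_mono) auto
        also have "\<dots> \<le> ln (1 + e)" using la(2) lapos e by (simp add: field_simps)
        finally show ?thesis .
      qed
      finally have "norm (f z) \<le> norm (f \<zeta>) * exp (Re \<tau> + ln (1 + e))"
        by (simp add: mult_left_mono)
      then show ?thesis using e by (simp add: z_def exp_add mult_ac)
    qed
    have "exp s1 \<le> exp s0" "exp s0 \<le> exp s2" using s0 by auto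
    then have "r \<le> norm \<zeta>" "norm \<zeta> \<le> 2 * r" unfolding n\<zeta> ers .
    then show ?thesis using f\<zeta> Nla la(3) N4 grow by (intro exI[of _ \<zeta>] exI[of _ N]) auto
  qed
  moreover have "r1 > 0" by (simp add: r1_def)
  ultimately show ?thesis by blast
qed

lemma norm_exp_minus_one_le:
  fixes z :: complex
  assumes "norm z \<le> 1"
  shows "norm (exp z - 1) \<le> 3 * norm z" and "norm (exp z - 1 - z) \<le> 3 * (norm z)\<^sup>2"
proof -
  have 1: "norm (exp w - 1) \<le> 3 * norm w" if w: "norm w \<le> 1" for w :: complex
  proof -
    have "norm (exp w - exp 0) \<le> 3 * norm (w - 0)"
    proof (rule field_differentiable_bound[where f' = exp, OF convex_cball[of "0::complex" 1]])
      fix u :: complex assume "u \<in> cball 0 1"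
      then have "norm (exp u) \<le> exp 1" using norm_exp[of u] by (auto intro: order_trans)
      also have "\<dots> \<le> 3" by (rule exp_le)
      finally show "norm (exp u) \<le> 3" .
    qed (use w in \<open>auto intro!: derivative_eq_intros\<close>)
    then show ?thesis by simp
  qed
  show "norm (exp z - 1) \<le> 3 * norm z" by (rule 1[OF assms])
  have "norm ((exp z - 1 - z) - (exp 0 - 1 - 0)) \<le> (3 * norm z) * norm (z - 0)"
  proof (rule field_differentiable_bound[where f' = "\<lambda>w. exp w - 1", OF convex_cball[of "0::complex" "norm z"]])
    fix u :: complex assume "u \<in> cball 0 (norm z)"
    then show "norm (exp u - 1) \<le> 3 * norm z" using 1[of u] assms by auto
  qed (auto intro!: derivative_eq_intros)
  then show "norm (exp z - 1 - z) \<le> 3 * (norm z)\<^sup>2" by (simp add: power2_eq_square)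
qed

text \<open>The one-sided growth bound forces closeness:
  \<open>1 + 2 * \<eta> - F \<tau> * exp (- \<tau>)\<close> has positive real part and the tiny
  value \<open>2 * \<eta>\<close> at 0, so the Schwarz estimate keeps its deviation from that value
  of order \<open>\<eta>\<close> on a disc of half the radius.\<close>

lemma Wiman_Valiron_exp:
  assumes f: "transcendental_entire f" and K: "K > 0" and e: "e > 0"
  shows "\<exists>r1>0. \<forall>r\<ge>r1. \<exists>\<zeta> N. r \<le> norm \<zeta> \<and> norm \<zeta> \<le> 2 * r \<and> f \<zeta> \<noteq> 0
    \<and> norm (f \<zeta>) = max_modulus (norm \<zeta>) f \<and> N \<ge> 1 / e \<and> N \<le> 4 * (ln (max_modulus (norm \<zeta>) f))\<^sup>2
    \<and> (\<forall>\<tau>\<in>cball 0 K. norm (f (\<zeta> * exp (\<tau> / of_real N)) / f \<zeta> - exp \<tau>) \<le> e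
        \<and> norm (deriv (\<lambda>\<tau>. f (\<zeta> * exp (\<tau> / of_real N)) / f \<zeta>) \<tau> - exp \<tau>) \<le> e)"
proof -
  have fh: "f holomorphic_on UNIV" using f by (simp add: transcendental_entire_def)
  define \<eta> where "\<eta> = min e (e / (4 * exp (K + 1)))"
  have \<eta>: "\<eta> > 0" "\<eta> \<le> e" "4 * exp (K + 1) * \<eta> \<le> e"
    using e by (auto simp: \<eta>_def min_def field_simps)
  \<comment> \<open>The points with \<open>norm \<tau> \<le> K + 1\<close> must lie in the disc of
    half the radius; the extra 1 is the radius of the Cauchy estimate for the derivative.\<close>
  define K' where "K' = 2 * (K + 2)"
  have K': "K' > 0" using K by (simp add: K'_def)
  have *: "f \<zeta> \<noteq> 0 \<and> N \<ge> 1 / e \<and> (\<forall>\<tau>\<in>cball 0 K. norm (f (\<zeta> * exp (\<tau> / of_real N)) / f \<zeta> - exp \<tau>) \<le> e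
        \<and> norm (deriv (\<lambda>\<tau>. f (\<zeta> * exp (\<tau> / of_real N)) / f \<zeta>) \<tau> - exp \<tau>) \<le> e)"
    if m: "norm (f \<zeta>) = max_modulus (norm \<zeta>) f" and N1: "N \<ge> 1 / \<eta>"
      and N4: "N \<le> 4 * (ln (max_modulus (norm \<zeta>) f))\<^sup>2"
      and gr: "\<And>\<tau>. \<tau> \<in> ball 0 K' \<Longrightarrow>
        norm (f (\<zeta> * exp (\<tau> / of_real N))) \<le> (1 + \<eta>) * exp (Re \<tau>) * norm (f \<zeta>)" for \<zeta> N
  proof -
    have "1 / \<eta> > 0" using \<eta> by simp
    then have Npos: "N > 0" using N1 by linarith
    \<comment> \<open>Otherwise the maximum modulus would be 0, and \<open>ln 0 = 0\<close> would
      force \<open>N \<le> 0\<close>.\<close>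
    have fnz: "f \<zeta> \<noteq> 0" using N4 Npos m by auto
    have "1 / e \<le> 1 / \<eta>" using \<eta> by (intro divide_left_mono) auto
    then have Ne: "N \<ge> 1 / e" using N1 by linarith
    define F where "F = (\<lambda>\<tau>. f (\<zeta> * exp (\<tau> / of_real N)) / f \<zeta>)"
    have Fh: "F holomorphic_on UNIV"
      unfolding F_def using fnz Npos
      by (intro holomorphic_intros holomorphic_on_compose_gen[OF _ fh, unfolded o_def]) auto
    define h where "h = (\<lambda>\<tau>. of_real (1 + 2 * \<eta>) - F \<tau> * exp (- \<tau>))"
    have hh: "h holomorphic_on ball 0 K'"
      unfolding h_def by (intro holomorphic_intros holomorphic_on_subset[OF Fh]) auto
    have h0: "h 0 = of_real (2 * \<eta>)" using fnz by (simp add: h_def F_def)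
    have pos: "Re (h \<tau>) > 0" if "\<tau> \<in> ball 0 K'" for \<tau>
    proof -
      have "norm (F \<tau> * exp (- \<tau>)) = norm (f (\<zeta> * exp (\<tau> / of_real N))) / norm (f \<zeta>) * exp (- Re \<tau>)"
        by (simp add: F_def norm_mult norm_divide)
      also have "\<dots> \<le> (1 + \<eta>) * exp (Re \<tau>) * norm (f \<zeta>) / norm (f \<zeta>) * exp (- Re \<tau>)"
        using gr[OF that] by (intro mult_right_mono divide_right_mono) auto
      also have "\<dots> = 1 + \<eta>" using fnz by (simp add: exp_minus)
      finally have "Re (F \<tau> * exp (- \<tau>)) \<le> 1 + \<eta>"
        using complex_Re_le_cmod order_trans by blast
      then show ?thesis using \<eta> by (simp add: h_def)
    qed
    have near: "norm (F \<tau> - exp \<tau>) \<le> e" if \<tau>: "norm \<tau> \<le> K + 1" for \<tau>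
    proof -
      define x where "x = norm (h \<tau> - h 0)"
      have "x * K' \<le> norm (h \<tau> + cnj (h 0)) * norm (\<tau> - 0)"
        unfolding x_def using \<tau> K by (intro positive_real_part_Schwarz(1)[OF hh K' pos]) (auto simp: K'_def)
      also have "\<dots> \<le> norm (h \<tau> + cnj (h 0)) * (K' / 2)"
        using \<tau> by (intro mult_left_mono) (auto simp: K'_def)
      also have "norm (h \<tau> + cnj (h 0)) \<le> x + norm (h 0 + cnj (h 0))"
        using norm_triangle_ineq[of "h \<tau> - h 0" "h 0 + cnj (h 0)"] by (simp add: x_def)
      also have "norm (h 0 + cnj (h 0)) = 4 * \<eta>"
      proof -
        have "h 0 + cnj (h 0) = of_real (4 * \<eta>)" by (simp add: h0)
        then show ?thesis using \<eta> by (simp only: norm_of_real)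
      qed
      finally have "x * K' \<le> (x + 4 * \<eta>) * (K' / 2)" using K' by simp
      then have "K' * x \<le> K' * ((x + 4 * \<eta>) / 2)" by (simp add: mult_ac)
      then have "x \<le> (x + 4 * \<eta>) / 2" using K' by (rule mult_left_le_imp_le)
      then have x4: "x \<le> 4 * \<eta>" by simp
      have "h \<tau> - h 0 = 1 - F \<tau> * exp (- \<tau>)" unfolding h0 by (simp add: h_def)
      then have "exp \<tau> * (h \<tau> - h 0) = exp \<tau> - F \<tau> * (exp \<tau> * exp (- \<tau>))"
        by (simp only: right_diff_distrib mult_1_right mult.left_commute)
      also have "exp \<tau> * exp (- \<tau>) = 1" by (simp flip: exp_add)
      finally have "F \<tau> - exp \<tau> = - (exp \<tau> * (h \<tau> - h 0))" by simp
      then have "norm (F \<tau> - exp \<tau>) = exp (Re \<tau>) * x"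
        by (simp add: norm_mult x_def)
      also have "\<dots> \<le> exp (K + 1) * (4 * \<eta>)"
        using x4 \<tau> complex_Re_le_cmod[of \<tau>] by (intro mult_mono) (auto simp: x_def)
      finally show ?thesis using \<eta> by simp
    qed
    have dnear: "norm (deriv F \<tau> - exp \<tau>) \<le> e" if \<tau>: "norm \<tau> \<le> K" for \<tau>
    proof -
      have "norm ((deriv ^^ 1) (\<lambda>w. F w - exp w) \<tau>) \<le> fact 1 * e / 1 ^ 1"
      proof (rule Cauchy_inequality)
        show "(\<lambda>w. F w - exp w) holomorphic_on ball \<tau> 1"
          by (intro holomorphic_intros holomorphic_on_subset[OF Fh]) auto
        show "continuous_on (cball \<tau> 1) (\<lambda>w. F w - exp w)"
          by (intro continuous_intros holomorphic_on_imp_continuous_on holomorphic_on_subset[OF Fh]) auto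
        fix u assume "norm (\<tau> - u) = 1"
        then have "norm u \<le> K + 1" using \<tau> norm_triangle_ineq2[of u \<tau>] by (simp add: norm_minus_commute)
        then show "norm (F u - exp u) \<le> e" by (rule near)
      qed auto
      moreover have "deriv (\<lambda>w. F w - exp w) \<tau> = deriv F \<tau> - exp \<tau>"
        using holomorphic_derivI[OF Fh open_UNIV UNIV_I, of \<tau>]
        by (intro DERIV_imp_deriv) (auto intro!: derivative_eq_intros)
      ultimately show ?thesis by simp
    qed
    have "norm (F \<tau> - exp \<tau>) \<le> e \<and> norm (deriv F \<tau> - exp \<tau>) \<le> e" if "\<tau> \<in> cball 0 K" for \<tau>
      using near[of \<tau>] dnear[of \<tau>] that by simp
    then show ?thesis using fnz Ne unfolding F_def by blast
  qed
  obtain r1 where r1: "r1 > 0" "\<And>r. r \<ge> r1 \<Longrightarrow> \<exists>\<zeta> N. r \<le> norm \<zeta> \<and> norm \<zeta> \<le> 2 * r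
    \<and> norm (f \<zeta>) = max_modulus (norm \<zeta>) f \<and> N \<ge> 1 / \<eta> \<and> N \<le> 4 * (ln (max_modulus (norm \<zeta>) f))\<^sup>2
    \<and> (\<forall>\<tau>\<in>ball 0 K'. norm (f (\<zeta> * exp (\<tau> / of_real N))) \<le> (1 + \<eta>) * exp (Re \<tau>) * norm (f \<zeta>))"
    using Wiman_Valiron_point[OF f K' \<eta>(1)] by blast
  show ?thesis
  proof (intro exI[of _ r1] conjI allI impI r1(1))
    fix r assume "r \<ge> r1"
    then obtain \<zeta> N where \<zeta>: "r \<le> norm \<zeta>" "norm \<zeta> \<le> 2 * r"
      and 1: "norm (f \<zeta>) = max_modulus (norm \<zeta>) f" "N \<ge> 1 / \<eta>" "N \<le> 4 * (ln (max_modulus (norm \<zeta>) f))\<^sup>2"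
      and 2: "\<And>\<tau>. \<tau> \<in> ball 0 K' \<Longrightarrow>
        norm (f (\<zeta> * exp (\<tau> / of_real N))) \<le> (1 + \<eta>) * exp (Re \<tau>) * norm (f \<zeta>)"
      using r1(2) by blast
    show "\<exists>\<zeta> N. r \<le> norm \<zeta> \<and> norm \<zeta> \<le> 2 * r \<and> f \<zeta> \<noteq> 0
      \<and> norm (f \<zeta>) = max_modulus (norm \<zeta>) f \<and> N \<ge> 1 / e \<and> N \<le> 4 * (ln (max_modulus (norm \<zeta>) f))\<^sup>2
      \<and> (\<forall>\<tau>\<in>cball 0 K. norm (f (\<zeta> * exp (\<tau> / of_real N)) / f \<zeta> - exp \<tau>) \<le> e
        \<and> norm (deriv (\<lambda>\<tau>. f (\<zeta> * exp (\<tau> / of_real N)) / f \<zeta>) \<tau> - exp \<tau>) \<le> e)"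
      using \<zeta> 1 *[OF 1 2] by (intro exI[of _ \<zeta>] exI[of _ N]) blast
  qed
qed

section \<open>Inverse branches of iterates\<close>

text \<open>In the coordinate \<^term>\<open>of_real N * (z / \<zeta> - 1)\<close> the branches differ by multiples
  of \<^term>\<open>2 * pi * \<i>\<close>, up to \<^term>\<open>\<epsilon>\<close>.\<close>

definition inverse_branches ::
  "(complex \<Rightarrow> complex) \<Rightarrow> nat \<Rightarrow> real \<Rightarrow> real \<Rightarrow> nat \<Rightarrow> real \<Rightarrow> complex \<Rightarrow> real \<Rightarrow> real \<Rightarrow> bool" where
  "inverse_branches f m C \<epsilon> J \<kappa> \<zeta> N R \<longleftrightarrow>
    (\<forall>w. R \<le> norm w \<and> norm w \<le> C * R \<longrightarrow> (\<exists>\<mu>. norm \<mu> \<le> ln C + 4 \<and>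
      (\<forall>j::int. \<bar>j\<bar> \<le> int J \<longrightarrow> (\<exists>G. continuous_on (ball w (\<kappa> * norm w)) G \<and>
        (\<forall>y\<in>ball w (\<kappa> * norm w).
            norm (of_real N * (G y / \<zeta> - 1) - (\<mu> + of_int j * (2 * pi * \<i>))) < \<epsilon>
          \<and> (f ^^ m) (G y) = y
          \<and> N * norm w / (4 * norm \<zeta>) \<le> norm (deriv (f ^^ m) (G y))
          \<and> (\<forall>i\<in>{1..m}. 4 * norm \<zeta> < norm ((f ^^ i) (G y))))))))"

text \<open>\<open>\<zeta>\<close> and \<open>N\<close> belong to the first application of
  \<open>f\<close>, \<open>R\<close> to the last. \<open>R\<close> is only an upper bound for
  \<open>f ^^ m\<close> on the disc, since the induction takes it from the base point of the next
  level.\<close>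

definition branching_near ::
  "(complex \<Rightarrow> complex) \<Rightarrow> nat \<Rightarrow> real \<Rightarrow> real \<Rightarrow> nat \<Rightarrow> real \<Rightarrow> real \<Rightarrow> complex \<Rightarrow> real \<Rightarrow> real \<Rightarrow> bool" where
  "branching_near f m C \<epsilon> J \<kappa> r \<zeta> N R \<longleftrightarrow>
     r \<le> norm \<zeta> \<and> norm \<zeta> \<le> 2 * r \<and> 1 / \<epsilon> \<le> N \<and> N \<le> 4 * (ln (max_modulus (norm \<zeta>) f))\<^sup>2
     \<and> 8 * norm \<zeta> \<le> R \<and> (\<forall>z\<in>cball 0 (norm \<zeta>). norm ((f ^^ m) z) \<le> R)
     \<and> inverse_branches f m C \<epsilon> J \<kappa> \<zeta> N R"

text \<open>In the model \<open>f \<zeta> * exp \<tau>\<close> the preimages of \<open>w\<close> are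
  \<open>Ln (w / f \<zeta>) + 2 * pi * \<i> * j\<close>. The local inverse of \<open>F\<close> near
  each of them is a genuine branch, on a disc whose relative radius \<open>\<kappa>\<close> does not
  depend on \<open>r\<close>.\<close>

lemma branching_near_one:
  assumes f: "transcendental_entire f" and C: "C \<ge> 2" and e: "\<epsilon> > 0"
  shows "\<exists>\<kappa>>0. \<exists>r1>0. \<forall>r\<ge>r1. \<exists>\<zeta> N R. branching_near f 1 C \<epsilon> J \<kappa> r \<zeta> N R"
proof -
  have fh: "f holomorphic_on UNIV" using f by (simp add: transcendental_entire_def)
  have df: "(f has_field_derivative deriv f z) (at z)" for z
    using fh by (intro holomorphic_derivI[OF fh]) auto
  define s where "s = min \<epsilon> 1 / 16"
  define \<kappa> where "\<kappa> = s / 8"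
  \<comment> \<open>Bounds all \<open>norm \<mu>'\<close> with a margin of 2, which leaves room for
    the discs of radius \<open>s\<close> about them.\<close>
  define K where "K = ln C + 2 * pi * real J + 6"
  \<comment> \<open>\<open>s / 8\<close> controls the error against \<open>exp\<close>. The other
    entries act through \<open>N \<ge> 1 / e1\<close>: they give
    \<open>1 / \<epsilon> \<le> N\<close>, the smallness of the second-order error
    \<open>3 * K\<^sup>2 / N\<close>, and \<open>N \<ge> 3 * K\<close>.\<close>
  define e1 where "e1 = Min {s / 8, \<epsilon>, \<epsilon> / (6 * K\<^sup>2), 1 / (3 * K)}"
  have s: "0 < s" "s \<le> 1/16" "s \<le> \<epsilon> / 16" using e by (auto simp: s_def)
  have lnC: "ln C > 0" using C by simp
  have K: "K \<ge> 6" using lnC by (simp add: K_def)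
  have e1: "e1 > 0" "e1 \<le> s / 8" "e1 \<le> \<epsilon>" "e1 \<le> \<epsilon> / (6 * K\<^sup>2)" "e1 \<le> 1 / (3 * K)"
    using s e K by (simp_all add: e1_def)
  obtain r1 where r1: "r1 > 0" "\<And>r. r \<ge> r1 \<Longrightarrow> \<exists>\<zeta> N. r \<le> norm \<zeta> \<and> norm \<zeta> \<le> 2 * r \<and> f \<zeta> \<noteq> 0
    \<and> norm (f \<zeta>) = max_modulus (norm \<zeta>) f \<and> N \<ge> 1 / e1 \<and> N \<le> 4 * (ln (max_modulus (norm \<zeta>) f))\<^sup>2
    \<and> (\<forall>\<tau>\<in>cball 0 K. norm (f (\<zeta> * exp (\<tau> / of_real N)) / f \<zeta> - exp \<tau>) \<le> e1
        \<and> norm (deriv (\<lambda>\<tau>. f (\<zeta> * exp (\<tau> / of_real N)) / f \<zeta>) \<tau> - exp \<tau>) \<le> e1)"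
    using Wiman_Valiron_exp[OF f, of K e1] K e1 by auto
  obtain r2 where r2: "\<And>r. r \<ge> r2 \<Longrightarrow> 8 * r ^ 1 \<le> max_modulus r f"
    using transcendental_max_modulus_growth[OF f, of 8 1] by blast
  have "\<exists>\<zeta> N R. branching_near f 1 C \<epsilon> J \<kappa> r \<zeta> N R" if r: "r \<ge> max r1 r2" for r
  proof -
    obtain \<zeta> N where \<zeta>: "r \<le> norm \<zeta>" "norm \<zeta> \<le> 2 * r" "f \<zeta> \<noteq> 0" and m: "norm (f \<zeta>) = max_modulus (norm \<zeta>) f"
      and N: "N \<ge> 1 / e1" "N \<le> 4 * (ln (max_modulus (norm \<zeta>) f))\<^sup>2"
      and nearF: "\<And>\<tau>. \<tau> \<in> cball 0 K \<Longrightarrow> norm (f (\<zeta> * exp (\<tau> / of_real N)) / f \<zeta> - exp \<tau>) \<le> e1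
        \<and> norm (deriv (\<lambda>\<tau>. f (\<zeta> * exp (\<tau> / of_real N)) / f \<zeta>) \<tau> - exp \<tau>) \<le> e1"
      using r1(2)[of r] r by auto
    have rpos: "r > 0" using r r1 by simp
    have znz: "\<zeta> \<noteq> 0" using \<zeta> rpos by auto
    define R where "R = norm (f \<zeta>)"
    define F where "F = (\<lambda>\<tau>. f (\<zeta> * exp (\<tau> / of_real N)) / f \<zeta>)"
    have R8: "8 * norm \<zeta> \<le> R" using r2[of "norm \<zeta>"] \<zeta> r by (simp add: R_def m)
    have Npos: "N > 0" using N(1) e1(1) by (metis divide_pos_pos less_le_trans zero_less_one)
    have NK: "N \<ge> 3 * K" "6 * K\<^sup>2 / \<epsilon> \<le> N" "1 / \<epsilon> \<le> N"
    proof -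
      have "1 / (1 / (3 * K)) \<le> 1 / e1" "1 / (\<epsilon> / (6 * K\<^sup>2)) \<le> 1 / e1" "1 / \<epsilon> \<le> 1 / e1"
        using e1 e K by (intro divide_left_mono; simp)+
      then show "N \<ge> 3 * K" "6 * K\<^sup>2 / \<epsilon> \<le> N" "1 / \<epsilon> \<le> N" using N(1) by auto
    qed
    have Fh: "F holomorphic_on UNIV"
      unfolding F_def using \<zeta>(3) Npos
      by (intro holomorphic_intros holomorphic_on_compose_gen[OF _ fh, unfolded o_def]) auto
    have dF: "deriv F \<tau> = deriv f (\<zeta> * exp (\<tau> / of_real N)) * (\<zeta> * exp (\<tau> / of_real N) / of_real N) / f \<zeta>" for \<tau>
    proof -
      have "((\<lambda>\<tau>. \<zeta> * exp (\<tau> / of_real N)) has_field_derivative \<zeta> * exp (\<tau> / of_real N) / of_real N) (at \<tau>)"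
        using Npos by (auto intro!: derivative_eq_intros)
      from DERIV_cdivide[OF DERIV_chain2[OF df this]] show ?thesis
        unfolding F_def by (rule DERIV_imp_deriv)
    qed
    have "inverse_branches f 1 C \<epsilon> J \<kappa> \<zeta> N R"
      unfolding inverse_branches_def
    proof (intro allI impI)
      fix w :: complex assume w: "R \<le> norm w \<and> norm w \<le> C * R"
      have Rpos: "R > 0" using \<zeta>(3) by (simp add: R_def)
      have wnz: "w \<noteq> 0" using w Rpos by auto
      define \<mu> where "\<mu> = Ln (w / f \<zeta>)"
      have exp\<mu>: "exp \<mu> = w / f \<zeta>" using wnz \<zeta>(3) by (simp add: \<mu>_def)
      have Re\<mu>: "0 \<le> Re \<mu>" "Re \<mu> \<le> ln C"
      proof -
        have "Re \<mu> = ln (norm w / R)" using wnz \<zeta>(3) by (simp add: \<mu>_def norm_divide R_def)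
        moreover have "1 \<le> norm w / R" "norm w / R \<le> C" using w Rpos by (auto simp: field_simps)
        ultimately show "0 \<le> Re \<mu>" "Re \<mu> \<le> ln C" using C by auto
      qed
      have n\<mu>: "norm \<mu> \<le> ln C + 4"
      proof -
        have "\<bar>Im \<mu>\<bar> \<le> pi" using mpi_less_Im_Ln[of "w / f \<zeta>"] Im_Ln_le_pi[of "w / f \<zeta>"] wnz \<zeta>(3)
          by (auto simp: \<mu>_def)
        then show ?thesis using cmod_le[of \<mu>] Re\<mu> pi_less_4 by linarith
      qed
      have "\<exists>G. continuous_on (ball w (\<kappa> * norm w)) G \<and> (\<forall>y\<in>ball w (\<kappa> * norm w).
            norm (of_real N * (G y / \<zeta> - 1) - (\<mu> + of_int j * (2 * pi * \<i>))) < \<epsilon>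
          \<and> (f ^^ 1) (G y) = y
          \<and> N * norm w / (4 * norm \<zeta>) \<le> norm (deriv (f ^^ 1) (G y))
          \<and> (\<forall>i\<in>{1..1}. 4 * norm \<zeta> < norm ((f ^^ i) (G y))))"
        if j: "\<bar>j\<bar> \<le> int J" for j :: int
      proof -
        define \<mu>' where "\<mu>' = \<mu> + of_int j * (2 * pi * \<i>)"
        define L where "L = exp \<mu>'"
        have Lw: "L = w / f \<zeta>"
        proof -
          have "exp (of_int j * (2 * pi * \<i>)) = 1"
            by (subst exp_eq_1) (auto intro!: exI[of _ j])
          then show ?thesis by (simp add: L_def \<mu>'_def exp_add exp\<mu>)
        qed
        have nL: "norm L = norm w / R" by (simp add: Lw norm_divide R_def)
        have L1: "norm L \<ge> 1" using w Rpos by (simp add: nL)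
        have Lnz: "L \<noteq> 0" using L1 by auto
        have n\<mu>': "norm \<mu>' \<le> K - 2"
        proof -
          have "norm \<mu>' \<le> norm \<mu> + norm (of_int j * (2 * pi * \<i>) :: complex)"
            unfolding \<mu>'_def by (rule norm_triangle_ineq)
          also have "norm (of_int j * (2 * pi * \<i>) :: complex) = \<bar>of_int j\<bar> * (2 * pi)"
            by (simp add: norm_mult)
          also have "\<dots> \<le> real J * (2 * pi)" using j by (intro mult_right_mono) auto
          finally show ?thesis using n\<mu> by (simp add: K_def algebra_simps)
        qed
        have inK: "\<tau> \<in> cball 0 K" if "\<tau> \<in> ball \<mu>' s" for \<tau>
          using that n\<mu>' s norm_triangle_ineq2[of \<tau> \<mu>'] by (simp add: dist_norm norm_minus_commute)
        have near: "norm (deriv F \<tau> - L) \<le> norm L / 2" if \<tau>: "\<tau> \<in> ball \<mu>' s" for \<tau>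
        proof -
          have d: "norm (\<tau> - \<mu>') \<le> s" using \<tau> by (simp add: dist_norm norm_minus_commute)
          have "exp \<tau> - L = L * (exp (\<tau> - \<mu>') - 1)" by (simp add: L_def exp_diff algebra_simps)
          then have "norm (exp \<tau> - L) = norm L * norm (exp (\<tau> - \<mu>') - 1)" by (simp add: norm_mult)
          also have "\<dots> \<le> norm L * (3 * s)"
            using norm_exp_minus_one_le(1)[of "\<tau> - \<mu>'"] d s by (intro mult_left_mono) auto
          also have "\<dots> \<le> norm L * (1/4)" using s by (intro mult_left_mono) auto
          finally have 1: "norm (exp \<tau> - L) \<le> norm L / 4" by simp
          have "norm (deriv F \<tau> - exp \<tau>) \<le> norm L / 4"
            using nearF[OF inK[OF \<tau>]] e1 s L1 by (simp add: F_def)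
          then show ?thesis using 1 norm_triangle_ineq[of "deriv F \<tau> - exp \<tau>" "exp \<tau> - L"] by simp
        qed
        obtain H where Hc: "continuous_on (ball (F \<mu>') (norm L * s / 4)) H"
          and H: "\<And>y. y \<in> ball (F \<mu>') (norm L * s / 4) \<Longrightarrow> H y \<in> ball \<mu>' s \<and> F (H y) = y"
          using holomorphic_local_inverse[OF holomorphic_on_subset[OF Fh] s(1) Lnz near] by blast
        define G where "G = (\<lambda>y. \<zeta> * exp (H (y / f \<zeta>) / of_real N))"
        have sub: "y / f \<zeta> \<in> ball (F \<mu>') (norm L * s / 4)" if y: "y \<in> ball w (\<kappa> * norm w)" for y
        proof -
          have "norm (F \<mu>' - L) \<le> e1" using nearF[OF inK, of \<mu>'] s by (simp add: F_def L_def)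
          also have "\<dots> \<le> norm L * (s / 8)" using e1(2) s mult_right_mono[OF L1, of "s / 8"] by linarith
          finally have 1: "norm (F \<mu>' - L) \<le> norm L * (s / 8)" .
          have "L - y / f \<zeta> = (w - y) / f \<zeta>" by (simp add: Lw diff_divide_distrib)
          then have "norm (L - y / f \<zeta>) = norm (w - y) / R" by (simp add: norm_divide R_def)
          also have "\<dots> < \<kappa> * norm w / R" using y Rpos by (intro divide_strict_right_mono) (auto simp: dist_norm)
          finally have "norm (L - y / f \<zeta>) < norm L * (s / 8)" by (simp add: nL \<kappa>_def mult_ac)
          then show ?thesis using 1 norm_triangle_ineq[of "F \<mu>' - L" "L - y / f \<zeta>"] by (simp add: dist_norm)
        qed
        have "continuous_on (ball w (\<kappa> * norm w)) G"
          unfolding G_def using Npos \<zeta>(3) sub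
          by (intro continuous_intros continuous_on_compose2[OF Hc]) auto
        moreover have "norm (of_real N * (G y / \<zeta> - 1) - \<mu>') < \<epsilon>
          \<and> (f ^^ 1) (G y) = y \<and> N * norm w / (4 * norm \<zeta>) \<le> norm (deriv (f ^^ 1) (G y))
          \<and> (\<forall>i\<in>{1..1}. 4 * norm \<zeta> < norm ((f ^^ i) (G y)))"
          if y: "y \<in> ball w (\<kappa> * norm w)" for y
        proof -
          define T where "T = H (y / f \<zeta>)"
          define u where "u = T / of_real N"
          have T: "T \<in> ball \<mu>' s" and FT: "F T = y / f \<zeta>" using H[OF sub[OF y]] by (auto simp: T_def)
          have Gu: "G y = \<zeta> * exp u" by (simp add: G_def T_def u_def)
          have fG: "f (G y) = y" using FT \<zeta>(3) by (simp add: F_def Gu u_def)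
          have nT: "norm T \<le> K" using inK[OF T] by simp
          have nu: "norm u = norm T / N" using Npos by (simp add: u_def norm_divide)
          have u3: "norm u \<le> 1/3"
            using nT NK(1) Npos by (simp add: nu divide_le_eq)
          have "norm (of_real N * (exp u - 1) - T) = N * norm (exp u - 1 - u)"
          proof -
            have "of_real N * (exp u - 1) - T = of_real N * (exp u - 1 - u)"
              using Npos by (simp add: u_def algebra_simps)
            then show ?thesis using Npos by (simp add: norm_mult)
          qed
          also have "\<dots> \<le> N * (3 * (norm u)\<^sup>2)"
            using norm_exp_minus_one_le(2)[of u] u3 Npos by (intro mult_left_mono) auto
          also have "\<dots> = 3 * (norm T)\<^sup>2 / N" using Npos by (simp add: nu power2_eq_square)
          also have "\<dots> \<le> 3 * K\<^sup>2 / N" using nT Npos by (intro divide_right_mono mult_left_mono power_mono) auto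
          also have "\<dots> \<le> \<epsilon> / 2" using NK(2) Npos e by (simp add: field_simps)
          finally have "norm (of_real N * (exp u - 1) - T) \<le> \<epsilon> / 2" .
          moreover have "norm (T - \<mu>') < \<epsilon> / 16" using T s by (simp add: dist_norm norm_minus_commute)
          moreover have "norm (of_real N * (exp u - 1) - \<mu>') \<le> norm (of_real N * (exp u - 1) - T) + norm (T - \<mu>')"
            using norm_triangle_ineq[of "of_real N * (exp u - 1) - T" "T - \<mu>'"] by simp
          ultimately have 1: "norm (of_real N * (exp u - 1) - \<mu>') < \<epsilon>" using e by simp
          have 2: "N * norm w / (4 * norm \<zeta>) \<le> norm (deriv f (G y))"
          proof -
            have "norm L / 2 \<le> norm (deriv F T)"
              using near[OF T] norm_triangle_ineq2[of L "L - deriv F T"] by (simp add: norm_minus_commute)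
            also have "\<dots> = norm (deriv f (G y)) * (norm \<zeta> * norm (exp u) / N) / R"
              using Npos by (simp add: dF Gu u_def norm_mult norm_divide R_def)
            also have "\<dots> \<le> norm (deriv f (G y)) * (norm \<zeta> * 2 / N) / R"
            proof -
              have "norm (exp u) \<le> norm (exp u - 1) + norm (1::complex)"
                using norm_triangle_ineq[of "exp u - 1" 1] by simp
              then have "norm (exp u) \<le> 2" using norm_exp_minus_one_le(1)[of u] u3 by simp
              then show ?thesis using Npos Rpos by (intro divide_right_mono mult_left_mono) auto
            qed
            finally show ?thesis using Npos Rpos znz by (simp add: nL field_simps)
          qed
          have 3: "4 * norm \<zeta> < norm y"
          proof -
            have "norm w - norm y \<le> norm (w - y)" by (rule norm_triangle_ineq2)
            also have "\<dots> < \<kappa> * norm w" using y by (simp add: dist_norm)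
            also have "\<dots> \<le> 1/2 * norm w" using s by (intro mult_right_mono) (auto simp: \<kappa>_def)
            finally show ?thesis using w R8 by linarith
          qed
          have "G y / \<zeta> - 1 = exp u - 1" using znz by (simp add: Gu)
          then show ?thesis using 1 2 3 fG by simp
        qed
        ultimately show ?thesis unfolding \<mu>'_def by blast
      qed
      then show "\<exists>\<mu>. norm \<mu> \<le> ln C + 4 \<and> (\<forall>j::int. \<bar>j\<bar> \<le> int J \<longrightarrow>
          (\<exists>G. continuous_on (ball w (\<kappa> * norm w)) G \<and> (\<forall>y\<in>ball w (\<kappa> * norm w).
            norm (of_real N * (G y / \<zeta> - 1) - (\<mu> + of_int j * (2 * pi * \<i>))) < \<epsilon>
          \<and> (f ^^ 1) (G y) = y
          \<and> N * norm w / (4 * norm \<zeta>) \<le> norm (deriv (f ^^ 1) (G y))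
          \<and> (\<forall>i\<in>{1..1}. 4 * norm \<zeta> < norm ((f ^^ i) (G y))))))"
        using n\<mu> by blast
    qed
    moreover have "norm ((f ^^ 1) z) \<le> R" if "z \<in> cball 0 (norm \<zeta>)" for z
      using norm_le_max_modulus[OF fh, of z "norm \<zeta>"] that by (simp add: R_def m)
    ultimately have "branching_near f 1 C \<epsilon> J \<kappa> r \<zeta> N R"
      unfolding branching_near_def using \<zeta> NK N R8 by blast
    then show ?thesis by blast
  qed
  moreover have "\<kappa> > 0" "max r1 r2 > 0" using s r1 by (auto simp: \<kappa>_def)
  ultimately show ?thesis by blast
qed

lemma holomorphic_funpow:
  assumes f: "f holomorphic_on UNIV"
  shows "(f ^^ m) holomorphic_on UNIV"
proof (induction m)
  case (Suc m)
  then show ?case using holomorphic_on_compose_gen[OF Suc f] by (simp add: o_def)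
qed (simp add: holomorphic_on_id)

lemma deriv_funpow_Suc:
  assumes f: "f holomorphic_on UNIV"
  shows "deriv (f ^^ Suc m) z = deriv (f ^^ m) (f z) * deriv f z"
proof -
  have "(f has_field_derivative deriv f z) (at z)"
    by (rule holomorphic_derivI[OF f]) auto
  moreover have "((f ^^ m) has_field_derivative deriv (f ^^ m) (f z)) (at (f z))"
    by (rule holomorphic_derivI[OF holomorphic_funpow[OF f]]) auto
  ultimately have "((f ^^ m) \<circ> f has_field_derivative deriv (f ^^ m) (f z) * deriv f z) (at z)"
    by (rule DERIV_chain[rotated])
  then show ?thesis by (simp only: funpow_Suc_right DERIV_imp_deriv)
qed

text \<open>The branch of \<open>f ^^ m\<close> near \<open>\<zeta>'\<close>, where
  \<open>R \<le> norm \<zeta>' \<le> 2 * R\<close>, is followed by a branch of \<open>f\<close> near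
  \<open>\<zeta>\<close>. Its values fall into the disc where the latter is defined, because they
  are bounded by \<open>ln C + 6\<close> in a coordinate with large \<open>N'\<close>. Only the
  branch of \<open>f\<close> has to vary with \<open>j\<close>, so \<open>J = 0\<close> suffices for
  \<open>f ^^ m\<close>.\<close>

lemma branching_near_Suc:
  assumes f: "transcendental_entire f" and C: "C \<ge> 2" and e: "\<epsilon> > 0" and m: "m \<ge> 1"
    and IH: "\<And>\<epsilon>. \<epsilon> > 0 \<Longrightarrow> \<exists>\<kappa>>0. \<exists>r1>0. \<forall>r\<ge>r1. \<exists>\<zeta> N R. branching_near f m C \<epsilon> 0 \<kappa> r \<zeta> N R"
  shows "\<exists>\<kappa>>0. \<exists>r1>0. \<forall>r\<ge>r1. \<exists>\<zeta> N R. branching_near f (Suc m) C \<epsilon> J \<kappa> r \<zeta> N R"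
proof -
  have fh: "f holomorphic_on UNIV" using f by (simp add: transcendental_entire_def)
  obtain \<kappa>0 r0 where \<kappa>0: "\<kappa>0 > 0" and r0: "r0 > 0"
    and first: "\<And>r. r \<ge> r0 \<Longrightarrow> \<exists>\<zeta> N R. branching_near f 1 C \<epsilon> J \<kappa>0 r \<zeta> N R"
    using branching_near_one[OF f C e] by blast
  have lnC: "ln C > 0" using C by simp
  \<comment> \<open>The second entry fits the values into
    \<open>ball \<zeta>' (\<kappa>0 * norm \<zeta>')\<close>. The first forces
    \<open>N' \<ge> 4\<close>, so multiplying the two derivative bounds loses nothing despite their
    factors 1/4.\<close>
  define \<epsilon>' where "\<epsilon>' = min (1/4) (\<kappa>0 / (ln C + 6))"
  have \<epsilon>': "\<epsilon>' > 0" "\<epsilon>' \<le> 1/4"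
    using \<kappa>0 lnC min.cobounded1[of "1/4" "\<kappa>0 / (ln C + 6)"] unfolding \<epsilon>'_def by simp_all
  have "\<epsilon>' \<le> \<kappa>0 / (ln C + 6)" by (simp add: \<epsilon>'_def)
  then have \<epsilon>'\<kappa>: "(ln C + 6) * \<epsilon>' \<le> \<kappa>0" using lnC by (simp add: le_divide_eq mult.commute)
  obtain \<kappa> r1 where \<kappa>: "\<kappa> > 0" and r1: "r1 > 0"
    and second: "\<And>r. r \<ge> r1 \<Longrightarrow> \<exists>\<zeta> N R. branching_near f m C \<epsilon>' 0 \<kappa> r \<zeta> N R"
    using IH[OF \<epsilon>'(1)] by blast
  have "\<exists>\<zeta> N R. branching_near f (Suc m) C \<epsilon> J \<kappa> r \<zeta> N R" if r: "r \<ge> max r0 r1" for r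
  proof -
    obtain \<zeta> N R where first: "branching_near f 1 C \<epsilon> J \<kappa>0 r \<zeta> N R"
      using first[of r] r by auto
    have \<zeta>: "r \<le> norm \<zeta>" "norm \<zeta> \<le> 2 * r" "1 / \<epsilon> \<le> N" "N \<le> 4 * (ln (max_modulus (norm \<zeta>) f))\<^sup>2"
      "8 * norm \<zeta> \<le> R" and fR: "\<And>z. z \<in> cball 0 (norm \<zeta>) \<Longrightarrow> norm (f z) \<le> R"
      and br: "inverse_branches f 1 C \<epsilon> J \<kappa>0 \<zeta> N R"
      using first by (auto simp: branching_near_def)
    have "R \<ge> r1" using \<zeta> r r1 by auto
    from second[OF this] obtain \<zeta>' N' R' where \<zeta>': "R \<le> norm \<zeta>'" "norm \<zeta>' \<le> 2 * R" "1 / \<epsilon>' \<le> N'" "8 * norm \<zeta>' \<le> R'"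
      and fR': "\<And>z. z \<in> cball 0 (norm \<zeta>') \<Longrightarrow> norm ((f ^^ m) z) \<le> R'"
      and br': "inverse_branches f m C \<epsilon>' 0 \<kappa> \<zeta>' N' R'"
      by (auto simp: branching_near_def)
    have Rpos: "R > 0" using \<zeta> r r1 by auto
    have \<zeta>'nz: "\<zeta>' \<noteq> 0" using \<zeta>' Rpos by auto
    have \<zeta>pos: "norm \<zeta> > 0" using \<zeta>(1) r r1 by auto
    have Npos: "N > 0" using \<zeta>(3) e by (metis divide_pos_pos less_le_trans zero_less_one)
    have N'pos: "N' > 0" using \<zeta>'(3) \<epsilon>'(1) by (metis divide_pos_pos less_le_trans zero_less_one)
    have N'4: "N' \<ge> 4"
    proof -
      have "4 \<le> 1 / \<epsilon>'" using \<epsilon>' by (simp add: le_divide_eq)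
      then show ?thesis using \<zeta>'(3) by linarith
    qed
    have "norm \<zeta>' \<le> C * R" using \<zeta>'(2) C Rpos mult_right_mono[of 2 C R] by linarith
    then obtain \<mu> where \<mu>: "norm \<mu> \<le> ln C + 4" and G0:
      "\<And>j::int. \<bar>j\<bar> \<le> int J \<Longrightarrow> \<exists>G. continuous_on (ball \<zeta>' (\<kappa>0 * norm \<zeta>')) G \<and>
        (\<forall>y\<in>ball \<zeta>' (\<kappa>0 * norm \<zeta>').
            norm (of_real N * (G y / \<zeta> - 1) - (\<mu> + of_int j * (2 * pi * \<i>))) < \<epsilon>
          \<and> f (G y) = y
          \<and> N * norm \<zeta>' / (4 * norm \<zeta>) \<le> norm (deriv f (G y))
          \<and> 4 * norm \<zeta> < norm (f (G y)))"
      using br \<zeta>'(1) unfolding inverse_branches_def by fastforce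
    have "inverse_branches f (Suc m) C \<epsilon> J \<kappa> \<zeta> N R'"
      unfolding inverse_branches_def
    proof (intro allI impI exI[of _ \<mu>] conjI \<mu>)
      fix w :: complex and j :: int
      assume w: "R' \<le> norm w \<and> norm w \<le> C * R'" and j: "\<bar>j\<bar> \<le> int J"
      obtain G where Gc: "continuous_on (ball \<zeta>' (\<kappa>0 * norm \<zeta>')) G"
        and G: "\<And>y. y \<in> ball \<zeta>' (\<kappa>0 * norm \<zeta>') \<Longrightarrow>
            norm (of_real N * (G y / \<zeta> - 1) - (\<mu> + of_int j * (2 * pi * \<i>))) < \<epsilon>
          \<and> f (G y) = y
          \<and> N * norm \<zeta>' / (4 * norm \<zeta>) \<le> norm (deriv f (G y))
          \<and> 4 * norm \<zeta> < norm (f (G y))"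
        using G0[OF j] by blast
      from br' w obtain \<mu>' where \<mu>': "norm \<mu>' \<le> ln C + 4" and "\<forall>j::int. \<bar>j\<bar> \<le> int 0 \<longrightarrow>
        (\<exists>G. continuous_on (ball w (\<kappa> * norm w)) G \<and>
        (\<forall>y\<in>ball w (\<kappa> * norm w).
            norm (of_real N' * (G y / \<zeta>' - 1) - (\<mu>' + of_int j * (2 * pi * \<i>))) < \<epsilon>'
          \<and> (f ^^ m) (G y) = y
          \<and> N' * norm w / (4 * norm \<zeta>') \<le> norm (deriv (f ^^ m) (G y))
          \<and> (\<forall>i\<in>{1..m}. 4 * norm \<zeta>' < norm ((f ^^ i) (G y)))))"
        unfolding inverse_branches_def by blast
      then obtain G' where G'c: "continuous_on (ball w (\<kappa> * norm w)) G'"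
        and G': "\<And>y. y \<in> ball w (\<kappa> * norm w) \<Longrightarrow>
            norm (of_real N' * (G' y / \<zeta>' - 1) - \<mu>') < \<epsilon>'
          \<and> (f ^^ m) (G' y) = y
          \<and> N' * norm w / (4 * norm \<zeta>') \<le> norm (deriv (f ^^ m) (G' y))
          \<and> (\<forall>i\<in>{1..m}. 4 * norm \<zeta>' < norm ((f ^^ i) (G' y)))"
        by (elim allE[of _ 0]) auto
      have sub: "G' y \<in> ball \<zeta>' (\<kappa>0 * norm \<zeta>')" if y: "y \<in> ball w (\<kappa> * norm w)" for y
      proof -
        have "norm (of_real N' * (G' y / \<zeta>' - 1)) \<le> norm (of_real N' * (G' y / \<zeta>' - 1) - \<mu>') + norm \<mu>'"
          using norm_triangle_ineq[of "of_real N' * (G' y / \<zeta>' - 1) - \<mu>'" \<mu>'] by simp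
        also have "\<dots> < ln C + 6" using G'[OF y] \<mu>' \<epsilon>' by linarith
        finally have "N' * norm (G' y / \<zeta>' - 1) < ln C + 6" using N'pos by (simp add: norm_mult)
        moreover have "G' y / \<zeta>' - 1 = (G' y - \<zeta>') / \<zeta>'" using \<zeta>'nz by (simp add: diff_divide_distrib)
        ultimately have 1: "N' * norm (G' y - \<zeta>') < (ln C + 6) * norm \<zeta>'"
          using \<zeta>'nz by (simp add: norm_divide field_simps)
        have "norm (G' y - \<zeta>') = \<epsilon>' * (1 / \<epsilon>' * norm (G' y - \<zeta>'))" using \<epsilon>' by simp
        also have "\<dots> \<le> \<epsilon>' * (N' * norm (G' y - \<zeta>'))"
          using \<zeta>'(3) \<epsilon>' by (intro mult_left_mono mult_right_mono) auto
        also have "\<dots> < \<epsilon>' * ((ln C + 6) * norm \<zeta>')" using 1 \<epsilon>' by simp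
        also have "\<dots> = ((ln C + 6) * \<epsilon>') * norm \<zeta>'" by simp
        also have "\<dots> \<le> \<kappa>0 * norm \<zeta>'" using \<epsilon>'\<kappa> by (intro mult_right_mono) auto
        finally show ?thesis by (simp add: dist_norm norm_minus_commute)
      qed
      have "continuous_on (ball w (\<kappa> * norm w)) (\<lambda>y. G (G' y))"
        using sub by (intro continuous_on_compose2[OF Gc G'c]) auto
      moreover have "norm (of_real N * (G (G' y) / \<zeta> - 1) - (\<mu> + of_int j * (2 * pi * \<i>))) < \<epsilon>
          \<and> (f ^^ Suc m) (G (G' y)) = y
          \<and> N * norm w / (4 * norm \<zeta>) \<le> norm (deriv (f ^^ Suc m) (G (G' y)))
          \<and> (\<forall>i\<in>{1..Suc m}. 4 * norm \<zeta> < norm ((f ^^ i) (G (G' y))))"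
        if y: "y \<in> ball w (\<kappa> * norm w)" for y
      proof (intro conjI ballI)
        note Gy = G[OF sub[OF y]] and G'y = G'[OF y]
        show "norm (of_real N * (G (G' y) / \<zeta> - 1) - (\<mu> + of_int j * (2 * pi * \<i>))) < \<epsilon>"
          using Gy by blast
        show "(f ^^ Suc m) (G (G' y)) = y"
          using Gy G'y by (simp add: funpow_swap1)
        have "N * norm w / (4 * norm \<zeta>) * 1 \<le> N * norm w / (4 * norm \<zeta>) * (N' / 4)"
          using Npos N'4 by (intro mult_left_mono) auto
        also have "\<dots> = N' * norm w / (4 * norm \<zeta>') * (N * norm \<zeta>' / (4 * norm \<zeta>))"
          using \<zeta>'nz by (simp add: field_simps)
        also have "\<dots> \<le> norm (deriv (f ^^ m) (G' y)) * norm (deriv f (G (G' y)))"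
          using Gy G'y Npos N'pos by (intro mult_mono) auto
        also have "\<dots> = norm (deriv (f ^^ Suc m) (G (G' y)))"
          using Gy by (simp only: deriv_funpow_Suc[OF fh] norm_mult)
        finally show "N * norm w / (4 * norm \<zeta>) \<le> norm (deriv (f ^^ Suc m) (G (G' y)))" by simp
        show "4 * norm \<zeta> < norm ((f ^^ i) (G (G' y)))" if i: "i \<in> {1..Suc m}" for i
        proof (cases "i = 1")
          case True
          have "4 * norm \<zeta> < norm (f (G (G' y)))" using Gy by blast
          then show ?thesis using True by simp
        next
          case False
          then obtain k where k: "i = Suc k" "k \<in> {1..m}" using i by (cases i) auto
          have "4 * norm \<zeta> < 4 * norm \<zeta>'" using \<zeta>(5) \<zeta>'(1) \<zeta>pos by linarith
          also have "\<dots> < norm ((f ^^ k) (G' y))" using G'y k by blast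
          also have "(f ^^ k) (G' y) = (f ^^ i) (G (G' y))"
            using Gy by (simp add: k funpow_swap1)
          finally show ?thesis .
        qed
      qed
      ultimately show "\<exists>G. continuous_on (ball w (\<kappa> * norm w)) G \<and>
        (\<forall>y\<in>ball w (\<kappa> * norm w).
            norm (of_real N * (G y / \<zeta> - 1) - (\<mu> + of_int j * (2 * pi * \<i>))) < \<epsilon>
          \<and> (f ^^ Suc m) (G y) = y
          \<and> N * norm w / (4 * norm \<zeta>) \<le> norm (deriv (f ^^ Suc m) (G y))
          \<and> (\<forall>i\<in>{1..Suc m}. 4 * norm \<zeta> < norm ((f ^^ i) (G y))))"
        by blast
    qed
    moreover have "norm ((f ^^ Suc m) z) \<le> R'" if "z \<in> cball 0 (norm \<zeta>)" for z
      using fR[OF that] \<zeta>'(1) fR'[of "f z"] by (simp add: funpow_swap1)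
    moreover have "8 * norm \<zeta> \<le> R'" using \<zeta>(5) \<zeta>'(1,4) norm_ge_zero[of \<zeta>'] by linarith
    ultimately have "branching_near f (Suc m) C \<epsilon> J \<kappa> r \<zeta> N R'"
      unfolding branching_near_def using \<zeta> by blast
    then show ?thesis by blast
  qed
  moreover have "max r0 r1 > 0" using r0 by simp
  ultimately show ?thesis using \<kappa> by blast
qed

lemma exists_branching_near:
  assumes f: "transcendental_entire f" and C: "C \<ge> 2" and m: "m \<ge> 1" and e: "\<epsilon> > 0"
  shows "\<exists>\<kappa>>0. \<exists>r1>0. \<forall>r\<ge>r1. \<exists>\<zeta> N R. branching_near f m C \<epsilon> J \<kappa> r \<zeta> N R"
  using m e
proof (induction m arbitrary: \<epsilon> J rule: nat_induct_at_least)
  case base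
  then show ?case by (intro branching_near_one f C)
next
  case (Suc m)
  show ?case by (rule branching_near_Suc[OF f C Suc.prems Suc.hyps Suc.IH])
qed

section \<open>Rescaling at a point of large derivative\<close>

text \<open>Here \<^term>\<open>x\<close> is the bound that \<open>large_boundary_derivative\<close> gives for the spherical
  derivative of \<^term>\<open>\<lambda>z. of_real N * (f (of_real \<rho> * z) / \<zeta> - 1)\<close>, and \<^term>\<open>g\<close> is the result of
  \<open>Zalcman_rescale\<close>.\<close>

definition rescaled_return ::
  "(complex \<Rightarrow> complex) \<Rightarrow> nat \<Rightarrow> real \<Rightarrow> nat \<Rightarrow> complex \<Rightarrow> real \<Rightarrow> real \<Rightarrow> real \<Rightarrow> complex \<Rightarrow> real \<Rightarrow> complex \<Rightarrow> bool" where
  "rescaled_return f m C k \<zeta> N \<rho> \<kappa> p \<sigma> \<mu> \<longleftrightarrow>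
    (let x = ln (max_modulus \<rho> f) / (4 * 3 ^ 13);
         g = (\<lambda>z. of_real N * (f (of_real \<rho> * (p + of_real \<sigma> * z)) / \<zeta> - 1));
         w = of_real \<rho> * p
     in real k + 1 \<le> norm \<zeta> \<and> real k + 1 \<le> N \<and> (\<forall>z\<in>cball 0 (norm \<zeta>). norm ((f ^^ m) z) \<le> \<rho>)
      \<and> 0 < \<rho> \<and> 0 < \<kappa> \<and> (real k + 1) / \<kappa> \<le> x \<and> real k + 1 \<le> x
      \<and> 1/4 \<le> norm p \<and> 0 < \<sigma> \<and> \<sigma> * x \<le> 1
      \<and> spherical_deriv g 0 = 1 \<and> (\<forall>z\<in>cball 0 (x / 8). spherical_deriv g z \<le> 2)
      \<and> norm \<mu> \<le> ln C + 4
      \<and> (\<forall>j::int. \<bar>j\<bar> \<le> int k \<longrightarrow> (\<exists>G. continuous_on (ball w (\<kappa> * norm w)) G \<and>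
        (\<forall>y\<in>ball w (\<kappa> * norm w).
            norm (of_real N * (G y / \<zeta> - 1) - (\<mu> + of_int j * (2 * pi * \<i>))) < 1 / (real k + 1)
          \<and> (f ^^ m) (G y) = y
          \<and> N * norm w / (4 * norm \<zeta>) \<le> norm (deriv (f ^^ m) (G y))
          \<and> (\<forall>i\<in>{1..m}. 4 * norm \<zeta> < norm ((f ^^ i) (G y)))))))"

text \<open>The Harnack loss \<open>3 ^ 13\<close> falls on
  \<open>ln (2 * N) \<le> ln (8 * x\<^sup>2)\<close> and must stay below half of
  \<open>x = ln M\<close>. With \<open>s = sqrt (3 * x)\<close> this reduces to
  \<open>ln s \<le> s\<close>, the threshold supplying \<open>3 ^ 13 \<le> s / 25\<close>.\<close>

lemma ln_growth_bound:
  fixes x :: real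
  assumes x: "x \<ge> (25 * 3 ^ 13)\<^sup>2"
  shows "3 ^ 13 * ln (8 * x\<^sup>2) < x / 2"
proof -
  define s where "s = sqrt (3 * x)"
  have xpos: "x > 0" using x by (rule less_le_trans[rotated]) simp
  have s2: "s * s = 3 * x" using xpos by (simp add: s_def)
  have "25 * 3 ^ 13 \<le> s"
    unfolding s_def using x xpos by (intro real_le_rsqrt) linarith
  then have s: "s \<ge> 25 * 3 ^ 13" "s > 0" by auto
  have "8 * x\<^sup>2 \<le> (s * s)\<^sup>2" unfolding s2 by (simp add: power_mult_distrib)
  then have "ln (8 * x\<^sup>2) \<le> ln ((s * s)\<^sup>2)" using xpos s by (intro ln_mono) auto
  also have "\<dots> = 4 * ln s" using s by (simp add: ln_mult ln_realpow)
  also have "\<dots> \<le> 4 * s" using ln_le_minus_one[of s] s by simp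
  finally have "3 ^ 13 * ln (8 * x\<^sup>2) \<le> 4 * (3 ^ 13 * s)" by simp
  also have "\<dots> \<le> 4 * (s / 25 * s)" using s by (intro mult_left_mono mult_right_mono) auto
  also have "\<dots> = 12 / 25 * x" using s2 by simp
  also have "\<dots> < x / 2" using xpos by simp
  finally show ?thesis .
qed

text \<open>Here the minimum modulus enters: it gives \<open>norm (h z0) \<le> 2 * N\<close> on the
  same circle where \<open>norm (h z1) \<ge> sqrt M\<close>. As \<open>N\<close> is at most of order
  \<open>(ln M)\<^sup>2\<close>, the Harnack and Hopf estimates produce the large derivative at a
  point of modulus one.\<close>

lemma exists_rescaled_return:
  assumes f: "transcendental_entire f" and a: "a > 0" and b: "b > 1" and r0: "r0 > 0"
    and small: "\<And>r. r \<ge> r0 \<Longrightarrow> \<exists>\<rho>\<in>{r<..<b * r}. min_modulus \<rho> f \<le> a"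
    and m: "m \<ge> 1"
  shows "\<exists>\<zeta> N \<rho> \<kappa> p \<sigma> \<mu>. rescaled_return f m (16 * b) k \<zeta> N \<rho> \<kappa> p \<sigma> \<mu>"
proof -
  have fh: "f holomorphic_on UNIV" using f by (simp add: transcendental_entire_def)
  \<comment> \<open>The base point \<open>w\<close> will have modulus between
    \<open>\<rho> / 4\<close> and \<open>7 * \<rho> / 4\<close>, where
    \<open>8 * R < \<rho> < 8 * b * R\<close>, so it lies between \<open>R\<close> and
    \<open>16 * b * R\<close>.\<close>
  define C where "C = 16 * b"
  have C: "C \<ge> 2" using b by (simp add: C_def)
  define \<epsilon> where "\<epsilon> = 1 / (real k + 1)"
  have \<epsilon>: "\<epsilon> > 0" by (simp add: \<epsilon>_def)
  obtain \<kappa> r1 where \<kappa>: "\<kappa> > 0"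
    and br: "\<And>r. r \<ge> r1 \<Longrightarrow> \<exists>\<zeta> N R. branching_near f m C \<epsilon> k \<kappa> r \<zeta> N R"
    using exists_branching_near[OF f C m \<epsilon>] by blast
  \<comment> \<open>The threshold of \<open>ln_growth_bound\<close>, and lower bounds for
    \<open>x\<close> that make \<open>x / (4 * 3 ^ 13)\<close> exceed
    \<open>(k + 1) / \<kappa>\<close> and \<open>k + 1\<close>. As \<open>\<kappa>\<close> depends
    on \<open>k\<close>, the radius is chosen after it.\<close>
  define X where "X = Max {(25 * 3 ^ 13)\<^sup>2, 4 * 3 ^ 13 * ((real k + 1) / \<kappa>), 4 * 3 ^ 13 * (real k + 1)}"
  obtain r2 where r2: "\<And>r. r \<ge> r2 \<Longrightarrow> exp X * r ^ 0 \<le> max_modulus r f"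
    using transcendental_max_modulus_growth[OF f] by blast
  obtain r3 where r3: "\<And>r. r \<ge> r3 \<Longrightarrow> 4 * r ^ 2 \<le> max_modulus r f"
    using transcendental_max_modulus_growth[OF f] by blast
  define r where "r = Max {real k + 1, a, r0, r1, r2, r3}"
  have r: "real k + 1 \<le> r" "a \<le> r" "r0 \<le> r" "r1 \<le> r" "r2 \<le> r" "r3 \<le> r" by (simp_all add: r_def)
  obtain \<zeta> N R where "branching_near f m C \<epsilon> k \<kappa> r \<zeta> N R" using br[OF r(4)] by blast
  then have \<zeta>: "r \<le> norm \<zeta>" and N: "1 / \<epsilon> \<le> N" "N \<le> 4 * (ln (max_modulus (norm \<zeta>) f))\<^sup>2"
    and R: "8 * norm \<zeta> \<le> R" and fR: "\<And>z. z \<in> cball 0 (norm \<zeta>) \<Longrightarrow> norm ((f ^^ m) z) \<le> R"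
    and inv: "inverse_branches f m C \<epsilon> k \<kappa> \<zeta> N R"
    by (auto simp: branching_near_def)
  have rpos: "r \<ge> 1" using r by simp
  have \<zeta>pos: "norm \<zeta> \<ge> 1" using \<zeta> rpos by simp
  have \<zeta>nz: "\<zeta> \<noteq> 0" using \<zeta>pos by auto
  have Nk: "real k + 1 \<le> N" using N(1) by (simp add: \<epsilon>_def)
  have "8 * R \<ge> r0" using R \<zeta> r \<zeta>pos by linarith
  then obtain \<rho> where \<rho>: "8 * R < \<rho>" "\<rho> < b * (8 * R)" "min_modulus \<rho> f \<le> a"
    using small by force
  have \<rho>\<zeta>: "64 * norm \<zeta> \<le> \<rho>" using \<rho>(1) R by simp
  have \<rho>pos: "\<rho> > 0" using \<rho>\<zeta> \<zeta>pos by simp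
  define M where "M = max_modulus \<rho> f"
  define x where "x = ln M"
  have MX: "exp X \<le> max_modulus t f" if "t \<ge> r" for t using r2[of t] r that by simp
  have M\<zeta>: "max_modulus (norm \<zeta>) f \<le> M"
    unfolding M_def using \<rho>\<zeta> \<zeta>pos by (intro max_modulus_mono[OF fh]) auto
  have Mpos: "M > 0" using MX[OF \<zeta>] M\<zeta> exp_gt_zero[of X] by linarith
  have xX: "X \<le> x" using MX[OF \<zeta>] M\<zeta> Mpos by (simp add: x_def ln_ge_iff)
  have X: "(25 * 3 ^ 13)\<^sup>2 \<le> X" "4 * 3 ^ 13 * ((real k + 1) / \<kappa>) \<le> X" "4 * 3 ^ 13 * (real k + 1) \<le> X"
    unfolding X_def by (intro Max_ge finite.intros; blast)+
  have xpos: "x > 0" using X(1) xX by (smt (verit) zero_less_power2 zero_less_mult_iff zero_less_numeral zero_less_power)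
  have N8: "2 * N \<le> 8 * x\<^sup>2"
  proof -
    define t where "t = ln (max_modulus (norm \<zeta>) f)"
    have tp: "max_modulus (norm \<zeta>) f > 0" using MX[OF \<zeta>] exp_gt_zero[of X] by linarith
    have "X \<le> t" using MX[OF \<zeta>] tp by (simp add: t_def ln_ge_iff)
    then have "0 \<le> t" using X(1) by (smt (verit) zero_le_power2)
    moreover have "t \<le> x" unfolding t_def x_def using M\<zeta> tp by (intro ln_mono) auto
    ultimately have "t\<^sup>2 \<le> x\<^sup>2" by (intro power_mono) auto
    then show ?thesis using N(2) by (simp add: t_def)
  qed
  define h where "h = (\<lambda>z. of_real N * (f (of_real \<rho> * z) / \<zeta> - 1))"
  have hh: "h holomorphic_on UNIV"
    unfolding h_def using holomorphic_affine[OF fh, of 0 "of_real \<rho>"] \<zeta>nz by (intro holomorphic_intros) auto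
  obtain v0 where v0: "norm v0 = \<rho>" "norm (f v0) \<le> a"
    using min_modulus_attained[OF fh, of \<rho>] \<rho>pos \<rho>(3) by auto
  obtain v1 where v1: "norm v1 = \<rho>" "norm (f v1) = M"
    using max_modulus_attained[OF fh, of \<rho>] \<rho>pos by (auto simp: M_def)
  define z0 z1 where "z0 = v0 / of_real \<rho>" "z1 = v1 / of_real \<rho>"
  have z01: "norm z0 = 1" "norm z1 = 1" "of_real \<rho> * z0 = v0" "of_real \<rho> * z1 = v1"
    using v0 v1 \<rho>pos by (auto simp: z0_z1_def norm_divide)
  have Npos: "N \<ge> 1" using Nk by simp
  have hz0: "norm (h z0) \<le> 2 * N"
  proof -
    have "norm (f v0 / \<zeta>) \<le> 1" using v0(2) r(2) \<zeta> \<zeta>nz by (simp add: norm_divide divide_le_eq)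
    then have "norm (f v0 / \<zeta> - 1) \<le> 2" using norm_triangle_ineq4[of "f v0 / \<zeta>" 1] by simp
    then show ?thesis using Npos by (simp add: h_def z01 norm_mult)
  qed
  have hz1: "x / 2 \<le> ln (norm (h z1))"
  proof -
    define t where "t = sqrt M"
    have t2: "t * t = M" using Mpos by (simp add: t_def)
    have tpos: "t > 0" using Mpos by (simp add: t_def)
    have "(16 * norm \<zeta>)\<^sup>2 \<le> 4 * \<rho>\<^sup>2"
    proof -
      have "(8 * norm \<zeta>)\<^sup>2 \<le> \<rho>\<^sup>2" using \<rho>\<zeta> \<zeta>pos by (intro power_mono) auto
      then show ?thesis by (simp add: power_mult_distrib)
    qed
    also have "\<dots> \<le> M" unfolding M_def using r(6) \<zeta> \<rho>\<zeta> \<zeta>pos by (intro r3) linarith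
    finally have t16: "16 * norm \<zeta> \<le> t" unfolding t_def using real_le_rsqrt by blast
    have "t \<le> 16 * t - 1" using t16 \<zeta>pos by linarith
    also have "16 * t \<le> M / norm \<zeta>"
    proof -
      have "16 * norm \<zeta> * t \<le> t * t" using t16 tpos by (intro mult_right_mono) auto
      then show ?thesis using \<zeta>pos \<zeta>nz t2 by (simp add: le_divide_eq mult_ac)
    qed
    also have "M / norm \<zeta> - 1 \<le> norm (f v1 / \<zeta> - 1)"
      using norm_triangle_ineq2[of "f v1 / \<zeta>" 1] v1 by (simp add: norm_divide)
    also have "\<dots> \<le> N * norm (f v1 / \<zeta> - 1)" using Npos mult_right_mono[of 1 N "norm (f v1 / \<zeta> - 1)"] by simp
    also have "\<dots> = norm (h z1)" using Npos by (simp add: h_def z01 norm_mult)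
    finally have "ln t \<le> ln (norm (h z1))" using tpos by (intro ln_mono) auto
    then show ?thesis using Mpos by (simp add: t_def x_def ln_sqrt)
  qed
  have "3 ^ 13 * ln (2 * N) < ln (norm (h z1))"
  proof -
    have "3 ^ 13 * ln (2 * N) \<le> 3 ^ 13 * ln (8 * x\<^sup>2)"
      using N8 Npos by (intro mult_left_mono ln_mono) auto
    also have "\<dots> < x / 2" using X(1) xX by (intro ln_growth_bound) linarith
    finally show ?thesis using hz1 by simp
  qed
  then obtain z2 where z2: "1/2 \<le> norm z2" "norm z2 \<le> 3/2" "norm (h z2) = 1"
    "ln (norm (h z1)) \<le> 3 ^ 13 * norm (deriv h z2)"
    using large_boundary_derivative[OF hh z01(1,2) hz0] Npos by auto
  \<comment> \<open>Of the factor 4, one 2 comes from \<open>norm (h z2) = 1\<close> in the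
    spherical derivative, the other from \<open>hz1\<close>.\<close>
  define c where "c = x / (4 * 3 ^ 13)"
  have cpos: "c > 0" using xpos by (simp add: c_def)
  have hs: "c \<le> spherical_deriv h z2"
    using z2(3,4) hz1 by (simp add: spherical_deriv_def c_def)
  then have hspos: "spherical_deriv h z2 > 0" using cpos by simp
  obtain p \<sigma> where p: "p \<in> ball z2 (1/4)" and \<sigma>: "\<sigma> > 0" "\<sigma> \<le> 1 / spherical_deriv h z2"
    and g1: "spherical_deriv (\<lambda>z. h (p + of_real \<sigma> * z)) 0 = 1"
    and g2: "\<And>z. z \<in> cball 0 (1/4 * spherical_deriv h z2 / 2) \<Longrightarrow> spherical_deriv (\<lambda>z. h (p + of_real \<sigma> * z)) z \<le> 2"
    using Zalcman_rescale[OF hh _ hspos, of "1/4"] by auto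
  have np: "1/4 \<le> norm p" "norm p \<le> 7/4"
  proof -
    have "norm (z2 - p) < 1/4" using p by (simp add: dist_norm)
    then show "1/4 \<le> norm p" "norm p \<le> 7/4"
      using z2(1,2) norm_triangle_ineq2[of z2 p] norm_triangle_ineq2[of p z2]
      by (auto simp: norm_minus_commute)
  qed
  have \<sigma>c: "\<sigma> * c \<le> 1"
  proof -
    have "\<sigma> * c \<le> 1 / spherical_deriv h z2 * spherical_deriv h z2"
      using \<sigma> hs cpos hspos by (intro mult_mono) auto
    then show ?thesis using hspos by simp
  qed
  define w where "w = of_real \<rho> * p"
  have nw: "norm w = \<rho> * norm p" using \<rho>pos by (simp add: w_def norm_mult)
  have Rpos: "R > 0" using R \<zeta>pos by simp
  have "R \<le> norm w"
  proof -
    have "R \<le> \<rho> * (1/4)" using \<rho>(1) Rpos by simp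
    also have "\<dots> \<le> norm w" unfolding nw using np \<rho>pos by (intro mult_left_mono) auto
    finally show ?thesis .
  qed
  moreover have "norm w \<le> C * R"
  proof -
    have "norm w \<le> (b * (8 * R)) * (7/4)" unfolding nw using \<rho> np \<rho>pos b Rpos by (intro mult_mono) auto
    also have "\<dots> \<le> C * R" using b Rpos by (simp add: C_def)
    finally show ?thesis .
  qed
  ultimately obtain \<mu> where "norm \<mu> \<le> ln C + 4 \<and> (\<forall>j::int. \<bar>j\<bar> \<le> int k \<longrightarrow> (\<exists>G. continuous_on (ball w (\<kappa> * norm w)) G \<and>
        (\<forall>y\<in>ball w (\<kappa> * norm w).
            norm (of_real N * (G y / \<zeta> - 1) - (\<mu> + of_int j * (2 * pi * \<i>))) < \<epsilon>
          \<and> (f ^^ m) (G y) = y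
          \<and> N * norm w / (4 * norm \<zeta>) \<le> norm (deriv (f ^^ m) (G y))
          \<and> (\<forall>i\<in>{1..m}. 4 * norm \<zeta> < norm ((f ^^ i) (G y))))))"
    using inv unfolding inverse_branches_def by blast
  moreover have "real k + 1 \<le> norm \<zeta>" using r \<zeta> by simp
  moreover have "norm ((f ^^ m) z) \<le> \<rho>" if "z \<in> cball 0 (norm \<zeta>)" for z
    using fR[OF that] \<rho>(1) Rpos by simp
  moreover have "(real k + 1) / \<kappa> \<le> c" "real k + 1 \<le> c"
    using X(2,3) xX by (auto simp: c_def le_divide_eq mult_ac)
  moreover have "spherical_deriv (\<lambda>z. h (p + of_real \<sigma> * z)) z \<le> 2" if "z \<in> cball 0 (c / 8)" for z
    using that hs by (intro g2) auto
  ultimately have "rescaled_return f m C k \<zeta> N \<rho> \<kappa> p \<sigma> \<mu>"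
    unfolding rescaled_return_def Let_def
    using Nk \<rho>pos \<kappa> np \<sigma> \<sigma>c g1
    unfolding h_def w_def c_def x_def M_def \<epsilon>_def by blast
  then show ?thesis unfolding C_def by blast
qed

lemma deriv_funpow_comp:
  assumes f: "f holomorphic_on UNIV"
  shows "deriv (f ^^ Suc m) z = deriv f ((f ^^ m) z) * deriv (f ^^ m) z"
proof -
  have "((f ^^ m) has_field_derivative deriv (f ^^ m) z) (at z)"
    by (rule holomorphic_derivI[OF holomorphic_funpow[OF f]]) auto
  moreover have "(f has_field_derivative deriv f ((f ^^ m) z)) (at ((f ^^ m) z))"
    by (rule holomorphic_derivI[OF f]) auto
  ultimately have "(f \<circ> (f ^^ m) has_field_derivative deriv f ((f ^^ m) z) * deriv (f ^^ m) z) (at z)"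
    by (rule DERIV_chain[rotated])
  then show ?thesis by (simp only: funpow.simps DERIV_imp_deriv)
qed

text \<open>\<open>g\<close> and the branch \<open>G\<close> are compared in the same coordinate. A
  fixed point of \<open>Q\<close> after \<open>\<Phi>\<close> satisfies
  \<open>g z = \<Phi> z\<close>, that is, \<open>f (Y z) = G (Y z)\<close>; so
  \<open>\<xi> = G (Y z)\<close> is mapped to \<open>Y z\<close> by \<open>f ^^ m\<close> and back
  to itself by \<open>f\<close>.\<close>

lemma rescaled_return_periodic:
  assumes f: "f holomorphic_on UNIV"
    and rr: "rescaled_return f m C k \<zeta> N \<rho> \<kappa> p \<sigma> \<mu>"
    and j: "\<bar>j\<bar> \<le> int k" and L: "L \<noteq> 0" and s: "s > 0"
    and near: "\<And>w. w \<in> ball z0 s \<Longrightarrow>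
      norm (deriv (\<lambda>z. of_real N * (f (of_real \<rho> * (p + of_real \<sigma> * z)) / \<zeta> - 1)) w - L) \<le> norm L / 2"
    and close: "norm (of_real N * (f (of_real \<rho> * (p + of_real \<sigma> * z0)) / \<zeta> - 1) - v) < norm L * s / 12"
      "norm (\<mu> + of_int j * (2 * pi * \<i>) - v) < norm L * s / 12" "1 / (real k + 1) < norm L * s / 12"
    and far: "4 * (norm z0 + s) < real k + 1" "norm v + norm L * s \<le> real k + 1"
  shows "\<exists>\<xi>. periodic_point f \<xi> \<and> period f \<xi> = Suc m
    \<and> norm (\<xi> / \<zeta> - 1) \<le> (norm v + norm L * s) / (real k + 1)
    \<and> norm L / 256 / 3 ^ 13 * ln (max_modulus (norm \<zeta>) (f ^^ Suc m)) < norm (deriv (f ^^ Suc m) \<xi>)"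
proof -
  define x where "x = ln (max_modulus \<rho> f) / (4 * 3 ^ 13)"
  define g where "g = (\<lambda>z. of_real N * (f (of_real \<rho> * (p + of_real \<sigma> * z)) / \<zeta> - 1))"
  define w where "w = of_real \<rho> * p"
  have \<zeta>: "real k + 1 \<le> norm \<zeta>" and N: "real k + 1 \<le> N"
    and fm: "\<forall>z\<in>cball 0 (norm \<zeta>). norm ((f ^^ m) z) \<le> \<rho>"
    and \<rho>: "0 < \<rho>" and \<kappa>: "0 < \<kappa>" and x: "(real k + 1) / \<kappa> \<le> x" "real k + 1 \<le> x"
    and p: "1/4 \<le> norm p" and \<sigma>: "0 < \<sigma>" "\<sigma> * x \<le> 1"
    and branches: "\<forall>j::int. \<bar>j\<bar> \<le> int k \<longrightarrow> (\<exists>G. continuous_on (ball w (\<kappa> * norm w)) G \<and>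
        (\<forall>y\<in>ball w (\<kappa> * norm w).
            norm (of_real N * (G y / \<zeta> - 1) - (\<mu> + of_int j * (2 * pi * \<i>))) < 1 / (real k + 1)
          \<and> (f ^^ m) (G y) = y
          \<and> N * norm w / (4 * norm \<zeta>) \<le> norm (deriv (f ^^ m) (G y))
          \<and> (\<forall>i\<in>{1..m}. 4 * norm \<zeta> < norm ((f ^^ i) (G y)))))"
    using rr unfolding rescaled_return_def Let_def x_def w_def by - (elim conjE, assumption)+
  have \<zeta>nz: "\<zeta> \<noteq> 0" using \<zeta> by auto
  have Npos: "N > 0" using N by simp
  have nw: "norm w = \<rho> * norm p" using \<rho> by (simp add: w_def norm_mult)
  have gh: "g holomorphic_on UNIV"
  proof -
    have "(\<lambda>z. f (of_real \<rho> * (p + of_real \<sigma> * z))) holomorphic_on UNIV"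
      by (rule holomorphic_on_compose_gen[OF _ f, unfolded o_def]) (auto intro!: holomorphic_intros)
    then show ?thesis unfolding g_def using \<zeta>nz by (intro holomorphic_intros) auto
  qed
  obtain Q where Qc: "continuous_on (ball (g z0) (norm L * s / 4)) Q"
    and Q: "\<And>y. y \<in> ball (g z0) (norm L * s / 4) \<Longrightarrow> Q y \<in> ball z0 s \<and> g (Q y) = y"
    using holomorphic_local_inverse[OF holomorphic_on_subset[OF gh] s L near[folded g_def]] by blast
  obtain G where Gc: "continuous_on (ball w (\<kappa> * norm w)) G"
    and G: "\<And>y. y \<in> ball w (\<kappa> * norm w) \<Longrightarrow>
            norm (of_real N * (G y / \<zeta> - 1) - (\<mu> + of_int j * (2 * pi * \<i>))) < 1 / (real k + 1)
          \<and> (f ^^ m) (G y) = y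
          \<and> N * norm w / (4 * norm \<zeta>) \<le> norm (deriv (f ^^ m) (G y))
          \<and> (\<forall>i\<in>{1..m}. 4 * norm \<zeta> < norm ((f ^^ i) (G y)))"
    using branches j by blast
  define Y where "Y = (\<lambda>z. of_real \<rho> * (p + of_real \<sigma> * z))"
  define \<Phi> where "\<Phi> = (\<lambda>z. of_real N * (G (Y z) / \<zeta> - 1))"
  \<comment> \<open>From \<open>\<sigma> * x \<le> 1\<close> and
    \<open>(k + 1) / \<kappa> \<le> x\<close> the scale \<open>\<sigma>\<close> is at most
    \<open>\<kappa> / (k + 1)\<close>, so \<open>Y\<close> keeps the whole disc inside the domain of
    the branch.\<close>
  have Y: "Y z \<in> ball w (\<kappa> * norm w)" if z: "z \<in> cball z0 s" for z
  proof -
    have "norm z \<le> norm z0 + s" using z norm_triangle_ineq2[of z z0] by (simp add: dist_norm norm_minus_commute)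
    then have z4: "4 * norm z < real k + 1" using far(1) by simp
    have "\<sigma> * ((real k + 1) / \<kappa>) \<le> \<sigma> * x" using x \<sigma> by (intro mult_left_mono) auto
    also have "\<dots> \<le> 1" by (rule \<sigma>(2))
    finally have "\<sigma> * (real k + 1) \<le> \<kappa>" using \<kappa> by (simp add: field_simps)
    moreover have "\<sigma> * (4 * norm z) < \<sigma> * (real k + 1)" using z4 \<sigma> by simp
    ultimately have "\<sigma> * norm z < \<kappa> * (1/4)" by simp
    also have "\<dots> \<le> \<kappa> * norm p" using p \<kappa> by (intro mult_left_mono) auto
    finally have "\<rho> * (\<sigma> * norm z) < \<rho> * (\<kappa> * norm p)" using \<rho> by simp
    moreover have "w - Y z = - (of_real \<rho> * (of_real \<sigma> * z))" by (simp add: w_def Y_def algebra_simps)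
    then have "norm (w - Y z) = \<rho> * (\<sigma> * norm z)" using \<rho> \<sigma> by (simp add: norm_mult)
    ultimately show ?thesis by (simp add: dist_norm nw mult_ac)
  qed
  have \<Phi>: "\<Phi> z \<in> ball (g z0) (norm L * s / 4)" if z: "z \<in> cball z0 s" for z
  proof -
    \<comment> \<open>Three errors below \<open>e\<close> add up to the radius
      \<open>norm L * s / 4\<close> of the disc on which \<open>Q\<close> is defined.\<close>
    define e where "e = norm L * s / 12"
    define \<mu>' where "\<mu>' = \<mu> + of_int j * (2 * pi * \<i>)"
    have "norm (\<Phi> z - \<mu>') < e" using G[OF Y[OF z]] close(3) unfolding \<Phi>_def e_def \<mu>'_def by linarith
    moreover have "norm (\<mu>' - v) < e" using close(2) by (simp add: e_def \<mu>'_def)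
    moreover have "norm (g z0 - v) < e" using close(1) by (simp add: e_def g_def)
    moreover have "norm (g z0 - \<Phi> z) \<le> norm (g z0 - v) + norm (\<mu>' - v) + norm (\<Phi> z - \<mu>')"
      using norm_triangle_ineq4[of "g z0 - v" "\<mu>' - v"] norm_triangle_ineq4[of "g z0 - v - (\<mu>' - v)" "\<Phi> z - \<mu>'"]
      by simp
    ultimately show ?thesis by (simp add: dist_norm e_def)
  qed
  have \<Phi>c: "continuous_on (cball z0 s) \<Phi>"
    unfolding \<Phi>_def using Y \<zeta>nz
    by (intro continuous_intros continuous_on_compose2[OF Gc]) (auto simp: Y_def intro!: continuous_intros)
  obtain z where z: "z \<in> cball z0 s" and fix_z: "Q (\<Phi> z) = z"
  proof (rule brouwer[of "cball z0 s" "\<lambda>z. Q (\<Phi> z)"])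
    show "continuous_on (cball z0 s) (\<lambda>z. Q (\<Phi> z))"
      using \<Phi> by (intro continuous_on_compose2[OF Qc \<Phi>c]) auto
    show "(\<lambda>z. Q (\<Phi> z)) \<in> cball z0 s \<rightarrow> cball z0 s"
      using Q[OF \<Phi>] by (force simp: less_imp_le)
  qed (use s in auto)
  define \<xi> where "\<xi> = G (Y z)"
  have zb: "z \<in> ball z0 s" and gz: "g z = \<Phi> z" using Q[OF \<Phi>[OF z]] fix_z by auto
  have f\<xi>: "f (Y z) = \<xi>"
    using gz Npos \<zeta>nz by (simp add: g_def \<Phi>_def Y_def \<xi>_def)
  have fmk: "(f ^^ m) \<xi> = Y z" and dm: "N * norm w / (4 * norm \<zeta>) \<le> norm (deriv (f ^^ m) \<xi>)"
    and big: "\<And>i. i \<in> {1..m} \<Longrightarrow> 4 * norm \<zeta> < norm ((f ^^ i) \<xi>)"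
    using G[OF Y[OF z]] by (auto simp: \<xi>_def)
  have per: "(f ^^ Suc m) \<xi> = \<xi>" by (simp add: fmk f\<xi>)
  have bound: "norm (\<xi> / \<zeta> - 1) \<le> (norm v + norm L * s) / (real k + 1)"
  proof -
    have "norm (\<Phi> z) \<le> norm v + norm L * s"
    proof -
      have "norm (\<Phi> z - v) \<le> norm (g z0 - v) + norm (g z0 - \<Phi> z)"
        using norm_triangle_ineq4[of "g z0 - v" "g z0 - \<Phi> z"] by simp
      also have "\<dots> < norm L * s / 12 + norm L * s / 4"
        using \<Phi>[OF z] close(1) by (intro add_strict_mono) (auto simp: dist_norm g_def)
      also have "\<dots> \<le> norm L * s" using s L by (simp add: field_simps)
      finally show ?thesis using norm_triangle_ineq2[of "\<Phi> z" v] by simp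
    qed
    moreover have "norm (\<Phi> z) = N * norm (\<xi> / \<zeta> - 1)" using Npos by (simp add: \<Phi>_def \<xi>_def norm_mult)
    moreover have "(real k + 1) * norm (\<xi> / \<zeta> - 1) \<le> N * norm (\<xi> / \<zeta> - 1)"
      using N by (intro mult_right_mono) auto
    ultimately show ?thesis by (simp add: le_divide_eq mult.commute)
  qed
  have small: "norm \<xi> \<le> 4 * norm \<zeta>"
  proof -
    have "norm (\<xi> / \<zeta>) \<le> norm (\<xi> / \<zeta> - 1) + 1"
      using norm_triangle_ineq[of "\<xi> / \<zeta> - 1" 1] by simp
    moreover have "(norm v + norm L * s) / (real k + 1) \<le> 1" using far(2) by simp
    ultimately have "norm (\<xi> / \<zeta>) \<le> 2" using bound by linarith
    then have "norm \<xi> \<le> 2 * norm \<zeta>" using \<zeta>nz by (simp add: norm_divide divide_le_eq)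
    then show ?thesis by (rule order_trans) simp
  qed
  have "(f ^^ i) \<xi> \<noteq> \<xi>" if "1 \<le> i" "i \<le> m" for i
    using big[of i] that small by auto
  then have period: "period f \<xi> = Suc m"
    unfolding period_def using per
    by (intro Least_equality) (auto simp: not_less_eq_eq[symmetric] simp del: funpow.simps)
  have periodic: "periodic_point f \<xi>"
    unfolding periodic_point_def using per by (intro exI[of _ "Suc m"]) auto
  \<comment> \<open>Apart from \<open>norm L / 2\<close> and 1/16, the two factors are bounded below
    by \<open>norm \<zeta> / (N * \<rho> * \<sigma>)\<close> and
    \<open>N * \<rho> / norm \<zeta>\<close>. Their product is \<open>1 / \<sigma>\<close>, which is
    at least \<open>x\<close>.\<close>
  have deriv_ge: "norm L / 32 * x \<le> norm (deriv (f ^^ Suc m) \<xi>)"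
  proof -
    have "deriv g z = of_real N * (deriv f (Y z) * (of_real \<rho> * of_real \<sigma>)) / \<zeta>"
    proof -
      have "(f has_field_derivative deriv f (Y z)) (at (Y z))"
        by (rule holomorphic_derivI[OF f]) auto
      moreover have "(Y has_field_derivative of_real \<rho> * of_real \<sigma>) (at z)"
        unfolding Y_def by (auto intro!: derivative_eq_intros)
      ultimately have "((\<lambda>z. f (Y z)) has_field_derivative deriv f (Y z) * (of_real \<rho> * of_real \<sigma>)) (at z)"
        by (rule DERIV_chain2)
      then have "((\<lambda>z. of_real N * (f (Y z) / \<zeta> - 1)) has_field_derivative
          of_real N * (deriv f (Y z) * (of_real \<rho> * of_real \<sigma>) / \<zeta>)) (at z)"
        using \<zeta>nz by (auto intro!: derivative_eq_intros)
      then show ?thesis unfolding g_def Y_def by (simp add: DERIV_imp_deriv)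
    qed
    then have "norm (deriv g z) = N * (norm (deriv f (Y z)) * (\<rho> * \<sigma>)) / norm \<zeta>"
      using Npos \<rho> \<sigma> by (simp add: norm_mult norm_divide)
    moreover have "norm L / 2 \<le> norm (deriv g z)"
      using near[OF zb] norm_triangle_ineq2[of L "L - deriv g z"] by (simp add: norm_minus_commute g_def)
    ultimately have "norm L / 2 \<le> N * (norm (deriv f (Y z)) * (\<rho> * \<sigma>)) / norm \<zeta>" by simp
    then have 1: "norm L * norm \<zeta> / (2 * (N * (\<rho> * \<sigma>))) \<le> norm (deriv f (Y z))"
      using Npos \<rho> \<sigma> \<zeta>nz by (simp add: field_simps)
    have "\<rho> * (1/4) \<le> norm w" unfolding nw using p \<rho> by (intro mult_left_mono) auto
    then have "N * (\<rho> * (1/4)) / (4 * norm \<zeta>) \<le> N * norm w / (4 * norm \<zeta>)"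
      using Npos by (intro divide_right_mono mult_left_mono) auto
    then have 2: "N * \<rho> / (16 * norm \<zeta>) \<le> norm (deriv (f ^^ m) \<xi>)" using dm by simp
    have "x \<le> 1 / \<sigma>" using \<sigma> by (simp add: le_divide_eq mult.commute)
    then have "norm L / 32 * x \<le> norm L / 32 * (1 / \<sigma>)" by (intro mult_left_mono) auto
    also have "\<dots> = norm L * norm \<zeta> / (2 * (N * (\<rho> * \<sigma>))) * (N * \<rho> / (16 * norm \<zeta>))"
      using Npos \<rho> \<sigma> \<zeta>nz by (simp add: field_simps)
    also have "\<dots> \<le> norm (deriv f (Y z)) * norm (deriv (f ^^ m) \<xi>)"
      using 1 2 Npos \<rho> \<sigma> by (intro mult_mono) auto
    also have "\<dots> = norm (deriv (f ^^ Suc m) \<xi>)"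
      by (simp only: deriv_funpow_comp[OF f] norm_mult fmk)
    finally show ?thesis .
  qed
  have "norm L / 256 / 3 ^ 13 * ln (max_modulus (norm \<zeta>) (f ^^ Suc m)) < norm (deriv (f ^^ Suc m) \<xi>)"
  proof -
    have xp: "x > 0" using x(2) by (rule less_le_trans[rotated]) simp
    obtain u where u: "norm u = norm \<zeta>" "norm ((f ^^ Suc m) u) = max_modulus (norm \<zeta>) (f ^^ Suc m)"
      using max_modulus_attained[OF holomorphic_funpow[OF f], of "norm \<zeta>" "Suc m"] by auto
    have "norm ((f ^^ Suc m) u) \<le> max_modulus \<rho> f"
      using bspec[OF fm, of u] u(1) by (simp add: norm_le_max_modulus[OF f])
    then have le: "max_modulus (norm \<zeta>) (f ^^ Suc m) \<le> max_modulus \<rho> f" by (simp only: u(2))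
    \<comment> \<open>Monotonicity of \<open>ln\<close> needs a positive argument; for the value 0
      the default \<open>ln 0 = 0\<close> suffices.\<close>
    have "ln (max_modulus (norm \<zeta>) (f ^^ Suc m)) \<le> 4 * 3 ^ 13 * x"
    proof (cases "max_modulus (norm \<zeta>) (f ^^ Suc m) > 0")
      case True
      then have "ln (max_modulus (norm \<zeta>) (f ^^ Suc m)) \<le> ln (max_modulus \<rho> f)" using le by simp
      then show ?thesis by (simp add: x_def)
    next
      case False
      then have "max_modulus (norm \<zeta>) (f ^^ Suc m) = 0" using u(2) norm_ge_zero[of "(f ^^ Suc m) u"] by linarith
      then show ?thesis using xp by (simp del: funpow.simps)
    qed
    then have "norm L / 256 / 3 ^ 13 * ln (max_modulus (norm \<zeta>) (f ^^ Suc m))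
        \<le> norm L / 256 / 3 ^ 13 * (4 * 3 ^ 13 * x)"
      by (intro mult_left_mono) auto
    \<comment> \<open>The left side is \<open>norm L / 64 * x\<close>; the spare factor 2 makes the
      final inequality strict.\<close>
    also have "\<dots> < norm L / 32 * x" using L xp by (simp add: field_simps)
    finally show ?thesis using deriv_ge by linarith
  qed
  then show ?thesis using periodic period bound by blast
qed

section \<open>Periodic points with large multiplier\<close>

lemma uniform_limit_subseq:
  assumes "uniform_limit K g G sequentially" and "strict_mono (r :: nat \<Rightarrow> nat)"
  shows "uniform_limit K (g \<circ> r) G sequentially"
  using filterlim_compose[OF assms(1) filterlim_subseq[OF assms(2)]] by (simp add: o_def)

theorem theorem1p1:
  fixes f :: "complex \<Rightarrow> complex" and a b r0 :: real and n :: nat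
  assumes "transcendental_entire f"
    and "a > 0" and "b > 1" and "r0 > 0"
    and "\<forall>r\<ge>r0. \<exists>\<rho>\<in>{r<..<b * r}. min_modulus \<rho> f \<le> a"
    and "n \<ge> 2"
  shows "\<exists>(c :: real) (\<xi> :: nat \<Rightarrow> complex) (\<delta> :: nat \<Rightarrow> real).
           c > 0
         \<and> (\<forall>k. periodic_point f (\<xi> k) \<and> period f (\<xi> k) = n)
         \<and> filterlim (\<lambda>k. norm (\<xi> k)) at_top sequentially
         \<and> \<delta> \<longlonglongrightarrow> 0
         \<and> (\<forall>k. (1 - \<delta> k) * norm (\<xi> k) > 0
               \<and> norm (deriv (f ^^ n) (\<xi> k))
                   > c * ln (max_modulus ((1 - \<delta> k) * norm (\<xi> k)) (f ^^ n)))"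
proof -
  have fh: "f holomorphic_on UNIV" using assms(1) by (simp add: transcendental_entire_def)
  obtain m where n: "n = Suc m" and m: "m \<ge> 1" using assms(6) by (cases n) auto
  define C where "C = 16 * b"
  have "\<exists>\<zeta> N \<rho> \<kappa> p \<sigma> \<mu>. rescaled_return f m C k \<zeta> N \<rho> \<kappa> p \<sigma> \<mu>" for k
    unfolding C_def using assms(5) by (intro exists_rescaled_return[OF assms(1-4) _ m]) auto
  then obtain \<zeta> N \<rho> \<kappa> p \<sigma> \<mu> where
    rr: "\<And>k. rescaled_return f m C k (\<zeta> k) (N k) (\<rho> k) (\<kappa> k) (p k) (\<sigma> k) (\<mu> k)"
    by metis
  define x where "x = (\<lambda>k. ln (max_modulus (\<rho> k) f) / (4 * 3 ^ 13))"
  define g where "g = (\<lambda>k z. of_real (N k) * (f (of_real (\<rho> k) * (p k + of_real (\<sigma> k) * z)) / \<zeta> k - 1))"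
  have \<zeta>: "real k + 1 \<le> norm (\<zeta> k)" and xk: "real k + 1 \<le> x k"
    and g1: "spherical_deriv (g k) 0 = 1"
    and g2: "\<And>z. z \<in> cball 0 (x k / 8) \<Longrightarrow> spherical_deriv (g k) z \<le> 2"
    and \<mu>: "norm (\<mu> k) \<le> ln C + 4" for k
    using rr[of k] unfolding rescaled_return_def Let_def x_def g_def by blast+
  have \<zeta>nz: "\<zeta> k \<noteq> 0" for k using \<zeta>[of k] by auto
  have gh: "g k holomorphic_on UNIV" for k
  proof -
    have "(\<lambda>z. f (of_real (\<rho> k) * (p k + of_real (\<sigma> k) * z))) holomorphic_on UNIV"
      by (rule holomorphic_on_compose_gen[OF _ fh, unfolded o_def]) (auto intro!: holomorphic_intros)
    then show ?thesis unfolding g_def using \<zeta>nz by (intro holomorphic_intros) auto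
  qed
  have "filterlim (\<lambda>k. x k / 8) at_top sequentially"
  proof (rule filterlim_at_top_mono)
    show "filterlim (\<lambda>k. 1/8 * real k) at_top sequentially"
      by (rule filterlim_tendsto_pos_mult_at_top[OF tendsto_const _ filterlim_real_sequentially]) simp
    show "\<forall>\<^sub>F k in sequentially. 1/8 * real k \<le> x k / 8"
    proof (intro always_eventually allI)
      show "1/8 * real k \<le> x k / 8" for k using xk[of k] by simp
    qed
  qed
  from Zalcman_limit[of g, OF gh this g2 g1] obtain G r where
    r: "strict_mono (r :: nat \<Rightarrow> nat)" and G: "G holomorphic_on UNIV"
    and ul: "\<And>K. compact K \<Longrightarrow> uniform_limit K (g \<circ> r) G sequentially"
    and G0: "spherical_deriv G 0 = 1"
    by blast
  have Gnc: "\<not> G constant_on UNIV"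
  proof
    assume "G constant_on UNIV"
    then obtain c where "G = (\<lambda>_. c)" by (auto simp: constant_on_def fun_eq_iff)
    then show False using G0 by (simp add: spherical_deriv_def)
  qed
  \<comment> \<open>The offsets \<open>\<mu> k\<close> vary with \<open>k\<close> but are bounded. A
    further subsequence makes them converge, so that \<open>G\<close> faces a single limit
    lattice.\<close>
  have "\<forall>k. (\<mu> \<circ> r) k \<in> cball 0 (ln C + 4)" using \<mu> by simp
  then obtain \<mu>0 r' where r': "strict_mono (r' :: nat \<Rightarrow> nat)" and \<mu>0: "((\<mu> \<circ> r) \<circ> r') \<longlonglongrightarrow> \<mu>0"
    using compact_cball[of "0::complex" "ln C + 4"] unfolding compact_def by blast
  define q where "q = r \<circ> r'"
  have q: "strict_mono q" unfolding q_def by (rule strict_mono_o[OF r r'])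
  have ulq: "uniform_limit K (\<lambda>t. g (q t)) G sequentially" if "compact K" for K
    using uniform_limit_subseq[OF ul[OF that] r'] by (simp add: q_def o_def)
  have \<mu>q: "(\<lambda>t. \<mu> (q t)) \<longlonglongrightarrow> \<mu>0" using \<mu>0 by (simp add: q_def o_def)
  obtain z0 and j :: int where z0: "G z0 = \<mu>0 + of_int j * (2 * pi * \<i>)" and L: "deriv G z0 \<noteq> 0"
    using entire_simple_value_mod_2pi_i[OF G Gnc] by blast
  define L where "L = deriv G z0"
  have Lnz: "L \<noteq> 0" using L by (simp add: L_def)
  obtain s where s: "s > 0" and near: "\<forall>\<^sub>F t in sequentially. \<forall>w\<in>ball z0 s.
      norm (deriv (g (q t)) w - L) \<le> norm L / 2"
    using eventually_deriv_near[OF gh G ulq L zero_less_one] unfolding L_def by auto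
  define e where "e = norm L * s / 12"
  have e: "e > 0" using Lnz s by (simp add: e_def)
  define B where "B = norm (G z0) + norm L * s"
  define c where "c = norm L / 256 / 3 ^ 13"
  have cpos: "c > 0" using Lnz by (simp add: c_def)
  have q_real: "filterlim (\<lambda>t. real (q t) + 1) at_top sequentially"
    by (rule filterlim_at_top_mono[OF filterlim_compose[OF filterlim_real_sequentially filterlim_subseq[OF q]]])
      simp
  have "\<forall>\<^sub>F t in sequentially. \<exists>\<xi>. periodic_point f \<xi> \<and> period f \<xi> = n
    \<and> norm (\<xi> / \<zeta> (q t) - 1) \<le> B / (real (q t) + 1) \<and> B / (real (q t) + 1) < 1 / 2
    \<and> c * ln (max_modulus (norm (\<zeta> (q t))) (f ^^ n)) < norm (deriv (f ^^ n) \<xi>)"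
  proof -
    have "(\<lambda>t. g (q t) z0) \<longlonglongrightarrow> G z0" using tendsto_uniform_limitI[OF ulq[of "{z0}"]] by simp
    then have 1: "\<forall>\<^sub>F t in sequentially. dist (g (q t) z0) (G z0) < e" using e by (rule tendstoD)
    have "(\<lambda>t. \<mu> (q t) + of_int j * (2 * pi * \<i>)) \<longlonglongrightarrow> G z0" unfolding z0 by (intro tendsto_intros \<mu>q)
    then have 2: "\<forall>\<^sub>F t in sequentially. dist (\<mu> (q t) + of_int j * (2 * pi * \<i>)) (G z0) < e" using e by (rule tendstoD)
    have 3: "\<forall>\<^sub>F t in sequentially. Max {1 / e + 1, 4 * (norm z0 + s) + 1, B, 2 * B + 1, of_int \<bar>j\<bar> + 1} \<le> real (q t) + 1"
      using q_real unfolding filterlim_at_top by blast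
    show ?thesis
      using near 1 2 3
    proof eventually_elim
      case (elim t)
      have big: "1 / e + 1 \<le> real (q t) + 1" "4 * (norm z0 + s) + 1 \<le> real (q t) + 1" "B \<le> real (q t) + 1"
        "2 * B + 1 \<le> real (q t) + 1" "of_int \<bar>j\<bar> + 1 \<le> real (q t) + 1"
        using elim(4) by simp_all
      have "1 / (real (q t) + 1) < e"
      proof -
        have "1 / e < real (q t) + 1" using big(1) by simp
        then show ?thesis using e by (simp add: field_simps)
      qed
      moreover have "\<bar>j\<bar> \<le> int (q t)" using big(5) by linarith
      moreover have "B / (real (q t) + 1) < 1 / 2" using big(4) by (simp add: divide_less_eq)
      ultimately show ?case
        using rescaled_return_periodic[OF fh rr[of "q t"], of j L s z0 "G z0"] Lnz s elim(1-3) big(2,3)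
        unfolding n c_def B_def e_def g_def dist_norm by auto
    qed
  qed
  then obtain T where T: "\<And>t. t \<ge> T \<Longrightarrow> \<exists>\<xi>. periodic_point f \<xi> \<and> period f \<xi> = n
    \<and> norm (\<xi> / \<zeta> (q t) - 1) \<le> B / (real (q t) + 1) \<and> B / (real (q t) + 1) < 1 / 2
    \<and> c * ln (max_modulus (norm (\<zeta> (q t))) (f ^^ n)) < norm (deriv (f ^^ n) \<xi>)"
    unfolding eventually_sequentially by blast
  \<comment> \<open>Drops the first \<open>T\<close> terms, since the conclusion is required for
    every \<open>k\<close>.\<close>
  define \<tau> where "\<tau> = (\<lambda>k. q (k + T))"
  have "\<exists>\<xi>. periodic_point f \<xi> \<and> period f \<xi> = n
    \<and> norm (\<xi> / \<zeta> (\<tau> k) - 1) \<le> B / (real (\<tau> k) + 1) \<and> B / (real (\<tau> k) + 1) < 1 / 2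
    \<and> c * ln (max_modulus (norm (\<zeta> (\<tau> k))) (f ^^ n)) < norm (deriv (f ^^ n) \<xi>)" for k
    unfolding \<tau>_def by (rule T) simp
  then obtain \<xi> where \<xi>: "\<And>k. periodic_point f (\<xi> k)" "\<And>k. period f (\<xi> k) = n"
    and close: "\<And>k. norm (\<xi> k / \<zeta> (\<tau> k) - 1) \<le> B / (real (\<tau> k) + 1)" "\<And>k. B / (real (\<tau> k) + 1) < 1 / 2"
    and big: "\<And>k. c * ln (max_modulus (norm (\<zeta> (\<tau> k))) (f ^^ n)) < norm (deriv (f ^^ n) (\<xi> k))"
    by metis
  define Q where "Q = (\<lambda>k. norm (\<xi> k / \<zeta> (\<tau> k)))"
  \<comment> \<open>Chosen so that \<open>(1 - \<delta> k) * norm (\<xi> k)\<close> is exactly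
    \<open>norm (\<zeta> (\<tau> k))\<close>; no sign of \<open>\<delta> k\<close> is
    claimed.\<close>
  define \<delta> where "\<delta> = (\<lambda>k. 1 - 1 / Q k)"
  have \<tau>_real: "filterlim (\<lambda>k. real (\<tau> k) + 1) at_top sequentially"
    unfolding \<tau>_def by (rule filterlim_compose[OF q_real filterlim_add_const_nat_at_top])
  have Q12: "Q k > 1/2" for k
  proof -
    have "1 - norm (\<xi> k / \<zeta> (\<tau> k) - 1) \<le> Q k"
      using norm_triangle_ineq2[of 1 "1 - \<xi> k / \<zeta> (\<tau> k)"] by (simp add: Q_def norm_minus_commute)
    then show ?thesis using close[of k] by linarith
  qed
  have \<zeta>\<xi>: "norm (\<xi> k) = Q k * norm (\<zeta> (\<tau> k))" for k
    using \<zeta>nz by (simp add: Q_def norm_divide)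
  have \<delta>\<xi>: "(1 - \<delta> k) * norm (\<xi> k) = norm (\<zeta> (\<tau> k))" for k
    using Q12[of k] by (simp add: \<delta>_def \<zeta>\<xi>)
  have "\<delta> \<longlonglongrightarrow> 0"
  proof -
    have "(\<lambda>k. B / (real (\<tau> k) + 1)) \<longlonglongrightarrow> 0"
      by (intro tendsto_divide_0[OF tendsto_const] filterlim_at_top_imp_at_infinity \<tau>_real)
    then have "(\<lambda>k. \<xi> k / \<zeta> (\<tau> k) - 1) \<longlonglongrightarrow> 0"
      by (rule Lim_null_comparison[rotated]) (use close in auto)
    then have "(\<lambda>k. \<xi> k / \<zeta> (\<tau> k)) \<longlonglongrightarrow> 1" by (rule LIM_zero_cancel)
    from tendsto_norm[OF this] have "Q \<longlonglongrightarrow> 1" by (simp add: Q_def)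
    then have "(\<lambda>k. 1 - 1 / Q k) \<longlonglongrightarrow> 1 - 1 / 1" by (intro tendsto_intros) auto
    then show ?thesis by (simp add: \<delta>_def)
  qed
  moreover have "filterlim (\<lambda>k. norm (\<xi> k)) at_top sequentially"
  proof (rule filterlim_at_top_mono)
    show "filterlim (\<lambda>k. 1/2 * (real (\<tau> k) + 1)) at_top sequentially"
      by (rule filterlim_tendsto_pos_mult_at_top[OF tendsto_const _ \<tau>_real]) simp
    show "\<forall>\<^sub>F k in sequentially. 1/2 * (real (\<tau> k) + 1) \<le> norm (\<xi> k)"
    proof (intro always_eventually allI)
      fix k
      show "1/2 * (real (\<tau> k) + 1) \<le> norm (\<xi> k)"
        unfolding \<zeta>\<xi> using Q12[of k] \<zeta>[of "\<tau> k"] by (intro mult_mono) auto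
    qed
  qed
  \<comment> \<open>The radius is positive, so \<open>max_modulus\<close> is a genuine maximum over
    a circle.\<close>
  moreover have "(1 - \<delta> k) * norm (\<xi> k) > 0" for k unfolding \<delta>\<xi> using \<zeta>nz by simp
  moreover have "c * ln (max_modulus ((1 - \<delta> k) * norm (\<xi> k)) (f ^^ n)) < norm (deriv (f ^^ n) (\<xi> k))" for k
    unfolding \<delta>\<xi> by (rule big)
  ultimately show ?thesis using cpos \<xi> by blast
qed

end
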